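(* Let $\mathbb{F}$ be an algebraically closed field of characteristic $0$, let $G$ be an abelian group, and let $G^\#=\mathbb{Z}\times G$. Let $n=n_1+\dots+n_s$ with all $n_i\ge1$ and let $U(\mathscr{F})_0$ be the Lie algebra of trace-zero matrices in $U(\mathscr{F})=UT(n_1,\ldots,n_s)\subset M_n(\mathbb{F})$. The mapping that sends an admissible $G^\#$-grading $\mathfrak{sl}_n=\bigoplus_{(m,g)\in G^\#}A_{(m,g)}$ to the $G$-grading $U(\mathscr{F})_0=\bigoplus_{g\in G}B_g$, $B_g=\bigoplus_{m\ge0}A_{(m,g)}$ (restriction to $U(\mathscr{F})_0$ followed by coarsening along the projection $G^\#\to G$), yields a bijection between the admissible isomorphism classes of $G^\#$-gradings on the Lie algebra $\mathfrak{sl}_n=\mathfrak{sl}_n(\mathbb{F})$ and the isomorphism classes of $G$-gradings on the Lie algebra $U(\mathscr{F})_0$.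
   Context: A $G$-grading on a Lie algebra $L$ is a vector space decomposition $L=\bigoplus_{g\in G}L_g$ with $[L_g,L_h]\subset L_{gh}$. Two $G$-gradings on $L$ are isomorphic if some automorphism of $L$ maps each component of the first onto the component of the same degree of the second. For a group homomorphism $\alpha:G\to H$, the coarsening induced by $\alpha$ is the $H$-grading with components $L'_h=\bigoplus_{g\in\alpha^{-1}(h)}L_g$. $UT(n_1,\ldots,n_s)$ is the algebra of $n\times n$ upper block-triangular matrices with diagonal blocks of sizes $n_1,\ldots,n_s$; $U(\mathscr{F})_0=\{x\in U(\mathscr{F})\mid \mathrm{tr}(x)=0\}$ with bracket $[x,y]=xy-yx$. For $m\in\mathbb{Z}$, $J_m\subset M_n(\mathbb{F})$ is the $m$-th block-diagonal: the span of matrix units lying in blocks of block-position $(q,q+m)$ with $1\le q\le s$, $1\le q+m\le s$ (and $J_m=0$ if $|m|\ge s$). The natural $\mathbb{Z}$-grading on $U(\mathscr{F})_0$ has homogeneous component of degree $m$ equal to $J_m\cap U(\mathscr{F})_0$ if $0\le m<s$ and $0$ otherwise. A $G^\#$-grading on $\mathfrak{sl}_n$ is admissible if, with respect to the $\mathbb{Z}$-grading on $\mathfrak{sl}_n$ obtained as the coarsening induced by the projection $G^\#\to\mathbb{Z}$, the algebra $U(\mathscr{F})_0$ with its natural $\mathbb{Z}$-grading is a graded subalgebra (i.e. $J_m\cap U(\mathscr{F})_0$ is contained in the component of degree $m$ for every $m\ge0$). An isomorphism class of $G^\#$-gradings on $\mathfrak{sl}_n$ is admissible if it contains an admissible grading.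 *)

theory Defs
  imports "HOL-Analysis.Analysis" "HOL-Computational_Algebra.Polynomial"
begin

text \<open>
  Square matrices are indexed by a finite type \<open>'n\<close>. Where the block structure matters,
  \<open>'n\<close> is moreover linearly ordered and plays the role of \<open>{1, \<dots>, n}\<close>. Grading groups are
  abelian groups written additively, and a family of subspaces indexed by such a group is a
  function into sets of matrices.
\<close>

type_synonym ('f, 'n) sqmat = "(('f, 'n) vec, 'n) vec"

definition mat_smult :: "'f::field \<Rightarrow> ('f, 'n::finite) sqmat \<Rightarrow> ('f, 'n) sqmat" where
  "mat_smult c x = (\<chi> i j. c * x $ i $ j)"

interpretation mats: vector_space "mat_smult :: 'f::field \<Rightarrow> ('f, 'n::finite) sqmat \<Rightarrow> ('f, 'n) sqmat"
  by unfold_locales (simp_all add: mat_smult_def vec_eq_iff algebra_simps)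

definition bracket :: "('f::field, 'n::finite) sqmat \<Rightarrow> ('f, 'n) sqmat \<Rightarrow> ('f, 'n) sqmat" where
  "bracket x y = x ** y - y ** x"

definition sl :: "('f::field, 'n::finite) sqmat set" where
  "sl = {x. trace x = 0}"


section \<open>Block-triangular matrices\<close>

text \<open>
  The block sizes are given by a list \<open>ns\<close>, used only when its sum is \<open>CARD('n)\<close>.
  Positions of indices and of blocks are counted from 0.
\<close>

definition pos :: "'n::{finite,linorder} \<Rightarrow> nat" where
  "pos i = card {j. j < i}"

definition block :: "nat list \<Rightarrow> 'n::{finite,linorder} \<Rightarrow> nat" where
  "block ns i = (LEAST q. pos i < sum_list (take (Suc q) ns))"

definition UT :: "nat list \<Rightarrow> ('f::field, 'n::{finite,linorder}) sqmat set" where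
  "UT ns = {x. \<forall>i j. block ns j < block ns i \<longrightarrow> x $ i $ j = 0}"

definition UT0 :: "nat list \<Rightarrow> ('f::field, 'n::{finite,linorder}) sqmat set" where
  "UT0 ns = {x \<in> UT ns. trace x = 0}"

text \<open>\<open>axis i (axis j 1)\<close> is the matrix unit with entry 1 in row \<open>i\<close> and column \<open>j\<close>.\<close>

definition block_diagonal :: "nat list \<Rightarrow> int \<Rightarrow> ('f::field, 'n::{finite,linorder}) sqmat set" where
  "block_diagonal ns m =
     mats.span {axis i (axis j 1) | i j. int (block ns j) = int (block ns i) + m}"

definition natural_grading ::
    "nat list \<Rightarrow> int \<Rightarrow> ('f::field, 'n::{finite,linorder}) sqmat set" where
  "natural_grading ns m =
     (if 0 \<le> m \<and> m < int (length ns) then block_diagonal ns m \<inter> UT0 ns else {0})"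


section \<open>Gradings on Lie algebras of matrices\<close>

definition is_grading ::
    "('f::field, 'n::finite) sqmat set \<Rightarrow> ('g::ab_group_add \<Rightarrow> ('f, 'n) sqmat set) \<Rightarrow> bool" where
  "is_grading L A \<longleftrightarrow>
     (\<forall>g. mats.subspace (A g) \<and> A g \<subseteq> L) \<and>
     (\<forall>x\<in>L. \<exists>!f. (\<forall>g. f g \<in> A g) \<and> finite {g. f g \<noteq> 0} \<and> x = (\<Sum>g | f g \<noteq> 0. f g)) \<and>
     (\<forall>g h. \<forall>x\<in>A g. \<forall>y\<in>A h. bracket x y \<in> A (g + h))"

text \<open>Only the values of \<open>\<phi>\<close> on \<open>L\<close> are relevant.\<close>

definition lie_automorphism ::
    "('f::field, 'n::finite) sqmat set \<Rightarrow> (('f, 'n) sqmat \<Rightarrow> ('f, 'n) sqmat) \<Rightarrow> bool" where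
  "lie_automorphism L \<phi> \<longleftrightarrow>
     bij_betw \<phi> L L \<and>
     (\<forall>x\<in>L. \<forall>y\<in>L. \<phi> (x + y) = \<phi> x + \<phi> y) \<and>
     (\<forall>c. \<forall>x\<in>L. \<phi> (mat_smult c x) = mat_smult c (\<phi> x)) \<and>
     (\<forall>x\<in>L. \<forall>y\<in>L. \<phi> (bracket x y) = bracket (\<phi> x) (\<phi> y))"

definition grading_iso ::
    "('f::field, 'n::finite) sqmat set \<Rightarrow>
     (('g::ab_group_add \<Rightarrow> ('f, 'n) sqmat set) \<times> ('g \<Rightarrow> ('f, 'n) sqmat set)) set" where
  "grading_iso L = {(A, B). is_grading L A \<and> is_grading L B \<and>
     (\<exists>\<phi>. lie_automorphism L \<phi> \<and> (\<forall>g. \<phi> ` A g = B g))}"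

definition iso_classes ::
    "('f::field, 'n::finite) sqmat set \<Rightarrow> ('g::ab_group_add \<Rightarrow> ('f, 'n) sqmat set) set set" where
  "iso_classes L = {A. is_grading L A} // grading_iso L"

text \<open>
  The (internal) sum of a family of subspaces is rendered as the span of their union. In all
  uses below the family consists of components of a grading, so this sum is direct.
\<close>

definition coarsening ::
    "('g \<Rightarrow> 'h) \<Rightarrow> ('g \<Rightarrow> ('f::field, 'n::finite) sqmat set) \<Rightarrow> 'h \<Rightarrow> ('f, 'n) sqmat set" where
  "coarsening \<alpha> A h = mats.span (\<Union>g \<in> \<alpha> -` {h}. A g)"


section \<open>Admissible gradings\<close>

definition admissible ::
    "nat list \<Rightarrow> (int \<times> 'g::ab_group_add \<Rightarrow> ('f::field, 'n::{finite,linorder}) sqmat set) \<Rightarrow> bool" where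
  "admissible ns A \<longleftrightarrow>
     is_grading sl A \<and> (\<forall>m. natural_grading ns m \<subseteq> coarsening fst A m)"

definition admissible_classes ::
    "nat list \<Rightarrow> (int \<times> 'g::ab_group_add \<Rightarrow> ('f::field, 'n::{finite,linorder}) sqmat set) set set" where
  "admissible_classes ns = {C \<in> iso_classes sl. \<exists>A\<in>C. admissible ns A}"

definition nonneg_part ::
    "(int \<times> 'g \<Rightarrow> ('f::field, 'n::finite) sqmat set) \<Rightarrow> 'g \<Rightarrow> ('f, 'n) sqmat set" where
  "nonneg_part A g = mats.span (\<Union>m \<in> {0..}. A (m, g))"

end

theory Submission
  imports Defs
begin

text \<open>
  Let \<open>P\<close> be the Lie algebra of traceless block-triangular matrices, let \<open>N\<close> be its ideal of strictly
  block-triangular matrices, and let \<open>\<D> m\<close> be the traceless part of the \<open>m\<close>-th block-diagonal. The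
  theorem holds because \<open>P\<close> carries enough intrinsic structure to reconstruct \<open>sl\<close> together with its
  block-diagonals, both for automorphisms and for gradings. The structure comes from traces.

  \<^item> The Killing form of \<open>P\<close> has radical \<open>N\<close> (\<open>killing_radical\<close>). Killing forms are preserved by
    automorphisms and pair only opposite degrees of a grading (\<open>killing_automorphism\<close>,
    \<open>killing_graded\<close>). So automorphisms preserve the powers of \<open>N\<close>, and \<open>N\<close> and its square are
    graded subspaces for every grading of \<open>P\<close>.
  \<^item> On \<open>\<D> 0\<close> the trace form is a combination of the Killing forms of \<open>P\<close> and of \<open>\<D> 0\<close>
    (\<open>trace_form_eq_killing\<close>). So it is respected by those automorphisms and gradings of \<open>P\<close> that
    respect the block-diagonals.
  \<^item> \<open>sl\<close> is determined by \<open>P\<close> and the trace form: \<open>\<D> (- m)\<close> is the dual of \<open>\<D> m\<close>, and the brackets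
    with negative degrees are determined by invariance of the form, the Jacobi identity, and the
    fact that \<open>\<D> 1\<close> generates all positive degrees. \<open>bracket_closed_extension\<close> states this once for
    subspaces of a graded Lie algebra with an invariant form; applied to components it extends
    gradings from \<open>P\<close> to \<open>sl\<close>, applied to graphs it extends automorphisms.

  Surjectivity: given a grading of \<open>P\<close>, consider the diagonal matrix \<open>deg_elt\<close>, for which \<open>ad deg_elt\<close>
  acts as \<open>m\<close> on \<open>\<D> m\<close>. It acts as a scalar on \<open>P/N\<close> and on \<open>N/N\<^sup>2\<close>, so its components of nonzero
  degree act as zero there and hence lie in \<open>N\<close>. The component of degree zero is thus \<open>deg_elt\<close> plus an
  element of \<open>N\<close>, and it is conjugate to \<open>deg_elt\<close> by a unipotent matrix (\<open>normalize_grading\<close>). After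
  this conjugation \<open>deg_elt\<close> has degree zero, so its eigenspaces \<open>\<D> m\<close> are graded subspaces. This is a
  grading of \<open>P\<close> by the integers times the group, and it extends to \<open>sl\<close>
  (\<open>is_grading_extend_grading\<close>).

  Well-definedness and injectivity: in an admissible grading the components of integer degree \<open>m\<close>
  add up to \<open>\<D> m\<close>, for negative \<open>m\<close> as well (\<open>refines_diagonalsI\<close>). Isomorphisms of admissible
  gradings therefore preserve all \<open>\<D> m\<close> and restrict to \<open>P\<close>. Conversely, an isomorphism between the
  resulting gradings of \<open>P\<close> preserves the filtration by the powers of \<open>N\<close>. Its leading terms form an
  automorphism of \<open>P\<close> that preserves the \<open>\<D> m\<close> and still matches the components. It extends to \<open>sl\<close>
  and matches the components of negative degree by duality (\<open>iso_of_nonneg_part_iso\<close>).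
\<close>

section \<open>Matrices with prescribed support\<close>

lemma mat_smult_nth [simp]: "mat_smult c x $ i $ j = c * x $ i $ j"
  by (simp add: mat_smult_def)

lemma mat_mult_nth: "(x ** y) $ i $ j = (\<Sum>k\<in>UNIV. x $ i $ k * y $ k $ j)"
  by (simp add: matrix_matrix_mult_def)

lemma mat_eqI: "(\<And>i j. x $ i $ j = y $ i $ j) \<Longrightarrow> x = (y :: ('f, 'n::finite) sqmat)"
  by (simp add: vec_eq_iff)

definition munit :: "'n::finite \<Rightarrow> 'n \<Rightarrow> ('f::field, 'n) sqmat" where
  "munit i j = axis i (axis j 1)"

lemma munit_nth [simp]: "munit i j $ k $ l = (if k = i \<and> l = j then 1 else 0)"
  by (simp add: munit_def axis_def)

lemma trace_munit [simp]: "trace (munit i j :: ('f::field, 'n::finite) sqmat) = (if i = j then 1 else 0)"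
proof -
  have "(\<Sum>k\<in>(UNIV::'n set). if k = i \<and> k = j then 1 else 0 :: 'f) =
        (\<Sum>k\<in>UNIV. if k = i then (if i = j then 1 else 0) else 0)"
    by (rule sum.cong) auto
  then show ?thesis by (simp add: trace_def)
qed

lemma trace_smult [simp]: "trace (mat_smult c x) = c * trace x"
  by (simp add: trace_def sum_distrib_left)

lemma trace_sum: "trace (\<Sum>a\<in>S. f a :: ('f::field, 'n::finite) sqmat) = (\<Sum>a\<in>S. trace (f a))"
  unfolding trace_def by (simp add: sum.swap[of _ S])

lemma trace_zero [simp]: "trace (0 :: ('f::field, 'n::finite) sqmat) = 0"
  by (simp add: trace_def)

lemma mult_add_mat:
  "x ** (y + z) = x ** y + (x ** z :: ('f::field, 'n::finite) sqmat)"
  "(y + z) ** x = y ** x + (z ** x :: ('f::field, 'n::finite) sqmat)"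
  by (simp_all add: vec_eq_iff mat_mult_nth algebra_simps sum.distrib)

lemma mult_diff_mat:
  "x ** (y - z) = x ** y - (x ** z :: ('f::field, 'n::finite) sqmat)"
  "(y - z) ** x = y ** x - (z ** x :: ('f::field, 'n::finite) sqmat)"
  by (simp_all add: vec_eq_iff mat_mult_nth algebra_simps sum_subtractf)

lemma mult_smult_mat:
  "x ** mat_smult c y = mat_smult c (x ** y)"
  "mat_smult c x ** y = mat_smult c (x ** y)"
  by (simp_all add: vec_eq_iff mat_mult_nth algebra_simps sum_distrib_left)

lemma mult_sum_mat:
  "x ** (\<Sum>a\<in>S. f a) = (\<Sum>a\<in>S. x ** (f a :: ('f::field, 'n::finite) sqmat))"
  "(\<Sum>a\<in>S. f a) ** x = (\<Sum>a\<in>S. (f a :: ('f::field, 'n::finite) sqmat) ** x)"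
  by (induction S rule: infinite_finite_induct) (simp_all add: mult_add_mat)

lemma munit_mult: "munit i j ** munit k l = (if j = k then munit i l else (0 :: ('f::field, 'n::finite) sqmat))"
  by (rule mat_eqI) (auto simp: mat_mult_nth if_distrib[of "\<lambda>a. a * _"] cong: if_cong)

lemma mult_munit_nth:
  "(x ** munit i j) $ k $ l = (if l = j then x $ k $ i else (0 :: 'f::field))"
  "(munit i j ** x) $ k $ l = (if k = i then x $ j $ l else (0 :: 'f::field))"
proof -
  have "(x ** munit i j) $ k $ l = (\<Sum>m\<in>UNIV. if m = i then (if l = j then x $ k $ i else 0) else 0)"
    unfolding mat_mult_nth by (rule sum.cong) auto
  then show "(x ** munit i j) $ k $ l = (if l = j then x $ k $ i else 0)" by simp
  have "(munit i j ** x) $ k $ l = (\<Sum>m\<in>UNIV. if m = j then (if k = i then x $ j $ l else 0) else 0)"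
    unfolding mat_mult_nth by (rule sum.cong) auto
  then show "(munit i j ** x) $ k $ l = (if k = i then x $ j $ l else 0)" by simp
qed

lemma trace_mult_munit [simp]:
  "trace (x ** munit j i) = (x $ i $ j :: 'f::field)"
  by (simp add: trace_def mult_munit_nth)

lemma sum_munit: "x = (\<Sum>i\<in>UNIV. \<Sum>j\<in>UNIV. mat_smult (x $ i $ j) (munit i j))"
proof (rule mat_eqI)
  fix k l
  have "(\<Sum>i\<in>UNIV. \<Sum>j\<in>UNIV. x $ i $ j * (if k = i \<and> l = j then 1 else 0)) =
        (\<Sum>i\<in>UNIV. if k = i then x $ k $ l else 0)"
  proof (rule sum.cong)
    fix i
    have "(\<Sum>j\<in>UNIV. x $ i $ j * (if k = i \<and> l = j then 1 else 0)) =
      (\<Sum>j\<in>UNIV. if l = j then (if k = i then x $ k $ l else 0) else 0)"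
      by (rule sum.cong) auto
    then show "(\<Sum>j\<in>UNIV. x $ i $ j * (if k = i \<and> l = j then 1 else 0)) = (if k = i then x $ k $ l else 0)"
      by simp
  qed simp
  then show "x $ k $ l = (\<Sum>i\<in>UNIV. \<Sum>j\<in>UNIV. mat_smult (x $ i $ j) (munit i j)) $ k $ l"
    by simp
qed

lemma bracket_linear:
  "bracket x (y + z) = bracket x y + bracket x z"
  "bracket (y + z) x = bracket y x + bracket z x"
  "bracket x (y - z) = bracket x y - bracket x z"
  "bracket x (mat_smult c y) = mat_smult c (bracket x y)"
  "bracket (mat_smult c y) x = mat_smult c (bracket y x)"
  "bracket x 0 = 0" "bracket 0 x = 0"
  by (simp_all add: bracket_def mult_add_mat mult_diff_mat mult_smult_mat mats.scale_right_diff_distrib)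

lemma bracket_antisym: "bracket x y = - bracket y x"
  by (simp add: bracket_def)

lemma bracket_sum:
  "bracket x (\<Sum>a\<in>S. f a) = (\<Sum>a\<in>S. bracket x (f a))"
  "bracket (\<Sum>a\<in>S. f a) x = (\<Sum>a\<in>S. bracket (f a) x)"
  by (simp_all add: bracket_def mult_sum_mat sum_subtractf)

lemma bracket_jacobi: "bracket x (bracket y z) = bracket (bracket x y) z + bracket y (bracket x z)"
  by (simp add: bracket_def mult_diff_mat matrix_mul_assoc)

lemma trace_bracket [simp]: "trace (bracket x y) = 0"
  unfolding bracket_def trace_sub by (simp add: trace_mul_sym[of x])

lemma trace_bracket_invariant: "trace (bracket x y ** z) = trace (x ** bracket y z)"
proof -
  have "trace ((y ** x) ** z) = trace (x ** (z ** y))"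
    by (metis matrix_mul_assoc trace_mul_sym)
  then show ?thesis
    by (simp add: bracket_def mult_diff_mat trace_sub matrix_mul_assoc)
qed

definition supported :: "('n \<times> 'n) set \<Rightarrow> ('f::field, 'n::finite) sqmat set" where
  "supported K = {x. \<forall>i j. (i, j) \<notin> K \<longrightarrow> x $ i $ j = 0}"

definition sl_on :: "('n \<times> 'n) set \<Rightarrow> ('f::field, 'n::finite) sqmat set" where
  "sl_on K = supported K \<inter> sl"

lemma supportedD: "x \<in> supported K \<Longrightarrow> (i, j) \<notin> K \<Longrightarrow> x $ i $ j = 0"
  by (simp add: supported_def)

lemma sl_onD: "x \<in> sl_on K \<Longrightarrow> (i, j) \<notin> K \<Longrightarrow> x $ i $ j = 0"
  by (simp add: sl_on_def supported_def)

lemma sl_on_trace: "x \<in> sl_on K \<Longrightarrow> trace x = 0"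
  by (simp add: sl_on_def sl_def)

lemma sl_on_mono: "K \<subseteq> K' \<Longrightarrow> sl_on K \<subseteq> sl_on K'"
  by (auto simp: sl_on_def supported_def)

lemma sl_on_UNIV: "sl_on UNIV = sl"
  by (auto simp: sl_on_def supported_def)

lemma subspace_supported: "mats.subspace (supported K)"
  by (auto simp: mats.subspace_def supported_def)

lemma subspace_sl: "mats.subspace sl"
  by (auto simp: mats.subspace_def sl_def trace_add)

lemma subspace_sl_on: "mats.subspace (sl_on K)"
  unfolding sl_on_def by (rule mats.subspace_inter[OF subspace_supported subspace_sl])

lemmas sl_on_zero = mats.subspace_0[OF subspace_sl_on]
  and sl_on_add = mats.subspace_add[OF subspace_sl_on]
  and sl_on_diff = mats.subspace_diff[OF subspace_sl_on]
  and sl_on_neg = mats.subspace_neg[OF subspace_sl_on]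
  and sl_on_sum = mats.subspace_sum[OF subspace_sl_on]
  and sl_on_scale = mats.subspace_scale[OF subspace_sl_on]

lemma supported_irrefl: "Id \<inter> K = {} \<Longrightarrow> supported K = sl_on K"
  by (auto simp: sl_on_def supported_def sl_def trace_def intro!: sum.neutral)

lemma munit_supported: "(i, j) \<in> K \<Longrightarrow> munit i j \<in> supported K"
  by (auto simp: supported_def)

lemma munit_sl_on: "(i, j) \<in> K \<Longrightarrow> i \<noteq> j \<Longrightarrow> munit i j \<in> sl_on K"
  by (auto simp: supported_def sl_on_def sl_def)

lemma munit_diff_sl_on: "(i, i) \<in> K \<Longrightarrow> (j, j) \<in> K \<Longrightarrow> munit i i - munit j j \<in> sl_on K"
  by (auto simp: supported_def sl_on_def sl_def trace_sub)

lemma mult_supported: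
  assumes "x \<in> supported K" "y \<in> supported K'" "K O K' \<subseteq> K''"
  shows "x ** y \<in> supported K''"
  unfolding supported_def
proof (clarify)
  fix i j assume "(i, j) \<notin> K''"
  then have "\<forall>k. (i, k) \<notin> K \<or> (k, j) \<notin> K'" using assms(3) by blast
  then show "(x ** y) $ i $ j = 0"
    unfolding mat_mult_nth by (intro sum.neutral) (metis assms(1,2) mult_zero_left mult_zero_right supportedD)
qed

lemma bracket_sl_on:
  assumes "x \<in> sl_on K" "y \<in> sl_on K'" "K O K' \<subseteq> K''" "K' O K \<subseteq> K''"
  shows "bracket x y \<in> sl_on K''"
  using mult_supported[OF _ _ assms(3), of x y] mult_supported[OF _ _ assms(4), of y x] assms(1,2)
  by (auto simp: sl_on_def sl_def bracket_def[of x y] mats.subspace_diff[OF subspace_supported])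
    (simp flip: bracket_def)

text \<open>
  The trace form pairs the matrices supported on \<open>K\<close> with those supported on the transpose of \<open>K\<close>.
  If \<open>K\<close> contains the diagonal, a traceless diagonal matrix orthogonal to all
  \<open>munit i i - munit j j\<close> is scalar, hence zero in characteristic zero.
\<close>

lemma trace_form_nondegenerate:
  fixes x :: "('f::field_char_0, 'n::finite) sqmat"
  assumes x: "x \<in> sl_on K" and K: "Id \<subseteq> K \<or> Id \<inter> K = {}"
    and orth: "\<And>y. y \<in> sl_on (K\<inverse>) \<Longrightarrow> trace (x ** y) = 0"
  shows "x = 0"
proof -
  have off: "x $ i $ j = 0" if "i \<noteq> j" for i j
  proof (cases "(i, j) \<in> K")
    case True
    then have "trace (x ** munit j i) = 0" using that by (intro orth munit_sl_on) auto
    then show ?thesis by simp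
  qed (use x sl_onD in blast)
  have diag: "x $ i $ i = 0" for i
  proof (cases "Id \<subseteq> K")
    case True
    have "x $ j $ j = x $ i $ i" for j
    proof -
      have "trace (x ** (munit i i - munit j j)) = 0" using True by (intro orth munit_diff_sl_on) auto
      then show ?thesis by (simp add: mult_diff_mat trace_sub)
    qed
    then have "trace x = (\<Sum>j\<in>(UNIV :: 'n set). x $ i $ i)"
      unfolding trace_def by (intro sum.cong) auto
    then show ?thesis using sl_on_trace[OF x] by simp
  next
    case False
    then show ?thesis using K x sl_onD[of x K i i] by blast
  qed
  show ?thesis by (rule mat_eqI) (metis diag off zero_index)
qed

text \<open>
  For distinct \<open>i\<close>, \<open>k\<close>, \<open>j\<close> the matrix unit \<open>munit i j\<close> is the bracket of \<open>munit i k\<close> and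
  \<open>munit k j\<close>. This generates the higher powers of the radical by the radical, and the
  block-diagonals of positive degree by the first one.
\<close>

lemma supported_bracket_induct [consumes 2, case_names factor zero add bracket]:
  assumes "x \<in> sl_on K" "Id \<inter> K = {}"
    and factor: "\<And>i j. (i, j) \<in> K \<Longrightarrow> \<exists>k. (i, k) \<in> I \<and> (k, j) \<in> I' \<and> k \<noteq> i \<and> k \<noteq> j"
    and zero: "Q 0" and add: "\<And>u v. Q u \<Longrightarrow> Q v \<Longrightarrow> Q (u + v)"
    and bracket: "\<And>y z. y \<in> sl_on I \<Longrightarrow> z \<in> sl_on I' \<Longrightarrow> Q (bracket y z)"
  shows "Q x"
proof -
  have sumQ: "Q (\<Sum>a\<in>S. f a)" if "\<And>a. a \<in> S \<Longrightarrow> Q (f a)" for f and S :: "'b set"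
    using that by (induction S rule: infinite_finite_induct) (auto intro: zero add)
  have "Q (mat_smult (x $ i $ j) (munit i j))" for i j
  proof (cases "(i, j) \<in> K")
    case True
    then obtain k where k: "(i, k) \<in> I" "(k, j) \<in> I'" "k \<noteq> i" "k \<noteq> j" using factor by blast
    have "i \<noteq> j" using True assms(2) by blast
    then have "mat_smult (x $ i $ j) (munit i j) = bracket (mat_smult (x $ i $ j) (munit i k)) (munit k j)"
      by (simp add: bracket_linear) (simp add: bracket_def munit_mult)
    then show ?thesis
      using k by (auto intro!: bracket sl_on_scale munit_sl_on)
  next
    case False
    then have "x $ i $ j = 0" using sl_onD[OF assms(1)] by simp
    then show ?thesis using zero by simp
  qed
  then have "Q (\<Sum>i\<in>UNIV. \<Sum>j\<in>UNIV. mat_smult (x $ i $ j) (munit i j))"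
    by (intro sumQ)
  then show ?thesis using sum_munit[of x] by simp
qed


section \<open>Homogeneous components\<close>

lemma sum_support:
  fixes f :: "'g \<Rightarrow> 'a::comm_monoid_add"
  shows "finite S \<Longrightarrow> (\<And>g. g \<notin> S \<Longrightarrow> f g = 0) \<Longrightarrow> (\<Sum>g | f g \<noteq> 0. f g) = (\<Sum>g\<in>S. f g)"
  by (rule sum.mono_neutral_left) auto

text \<open>
  The value is meaningful only for \<open>x\<close> in the graded space.
\<close>

definition component ::
    "('g \<Rightarrow> ('f::field, 'n::finite) sqmat set) \<Rightarrow> ('f, 'n) sqmat \<Rightarrow> 'g \<Rightarrow> ('f, 'n) sqmat" where
  "component A x = (THE f. (\<forall>g. f g \<in> A g) \<and> finite {g. f g \<noteq> 0} \<and> x = (\<Sum>g | f g \<noteq> 0. f g))"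

lemma grading_subspace: "is_grading L A \<Longrightarrow> mats.subspace (A g)"
  and grading_subset: "is_grading L A \<Longrightarrow> A g \<subseteq> L"
  and grading_bracket: "is_grading L A \<Longrightarrow> x \<in> A g \<Longrightarrow> y \<in> A h \<Longrightarrow> bracket x y \<in> A (g + h)"
  by (auto simp: is_grading_def)

lemma component_spec:
  assumes "is_grading L A" "x \<in> L"
  shows "component A x g \<in> A g" "finite {g. component A x g \<noteq> 0}"
    "(\<Sum>g | component A x g \<noteq> 0. component A x g) = x"
proof -
  have "\<exists>!f. (\<forall>g. f g \<in> A g) \<and> finite {g. f g \<noteq> 0} \<and> x = (\<Sum>g | f g \<noteq> 0. f g)"
    using assms by (simp add: is_grading_def)
  from theI'[OF this] show "component A x g \<in> A g" "finite {g. component A x g \<noteq> 0}"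
    "(\<Sum>g | component A x g \<noteq> 0. component A x g) = x"
    unfolding component_def by simp_all
qed

lemma component_eqI:
  assumes "is_grading L A" "x \<in> L" "\<And>g. f g \<in> A g" "finite S" "\<And>g. g \<notin> S \<Longrightarrow> f g = 0" "x = (\<Sum>g\<in>S. f g)"
  shows "component A x = f"
proof -
  have "\<exists>!f. (\<forall>g. f g \<in> A g) \<and> finite {g. f g \<noteq> 0} \<and> x = (\<Sum>g | f g \<noteq> 0. f g)"
    using assms(1,2) by (simp add: is_grading_def)
  moreover have "finite {g. f g \<noteq> 0}" by (rule finite_subset[OF _ assms(4)]) (use assms(5) in blast)
  ultimately show ?thesis
    unfolding component_def by (intro the1_equality) (use assms sum_support[OF assms(4,5)] in auto)
qed

lemma component_homogeneous:
  assumes "is_grading L A" "x \<in> A g"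
  shows "component A x = (\<lambda>h. if h = g then x else 0)"
  using assms grading_subset[OF assms(1), of g] mats.subspace_0[OF grading_subspace[OF assms(1)]]
  by (intro component_eqI[OF assms(1), where S = "{g}"]) auto

lemma grading_disjoint:
  assumes "is_grading L A" "x \<in> A g" "x \<in> A h" "g \<noteq> h"
  shows "x = 0"
  using component_homogeneous[OF assms(1,2)] component_homogeneous[OF assms(1,3)] assms(4) by metis

lemma additive_on_sum:
  assumes L: "mats.subspace L" and T: "\<And>x y. x \<in> L \<Longrightarrow> y \<in> L \<Longrightarrow> T (x + y) = T x + (T y :: 'b::ab_group_add)"
    and f: "\<And>a. a \<in> S \<Longrightarrow> f a \<in> L"
  shows "T (\<Sum>a\<in>S. f a) = (\<Sum>a\<in>S. T (f a))"
proof -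
  have "T 0 = T 0 + T 0" using T[of 0 0] mats.subspace_0[OF L] by simp
  then have T0: "T 0 = 0" by simp
  show ?thesis
    using f by (induction S rule: infinite_finite_induct) (simp_all add: T0 T mats.subspace_sum[OF L])
qed

text \<open>
  The images of the components of \<open>x\<close> form a homogeneous decomposition of \<open>T x\<close>, and such a
  decomposition is unique.
\<close>

lemma component_map:
  fixes A A' :: "'g::ab_group_add \<Rightarrow> ('f::field, 'n::finite) sqmat set"
  assumes A: "is_grading L A" and A': "is_grading L' A'" and L: "mats.subspace L" and x: "x \<in> L"
    and T: "\<And>x y. x \<in> L \<Longrightarrow> y \<in> L \<Longrightarrow> T (x + y) = T x + T y" and TL: "T x \<in> L'"
    and hom: "\<And>g x. x \<in> A g \<Longrightarrow> T x \<in> A' (g + k)"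
  shows "component A' (T x) (g + k) = T (component A x g)"
proof -
  let ?S = "{g. component A x g \<noteq> 0}"
  note cx = component_spec[OF A x]
  have cL: "component A x g \<in> L" for g using cx(1) grading_subset[OF A] by blast
  have T0: "T 0 = 0" using additive_on_sum[OF L T, of "{}"] by simp
  have "component A' (T x) = (\<lambda>h. T (component A x (h - k)))"
  proof (rule component_eqI[OF A' TL, where S = "(\<lambda>h. h + k) ` ?S"])
    fix h show "T (component A x (h - k)) \<in> A' h" using hom[OF cx(1), of "h - k"] by simp
    show "h \<notin> (\<lambda>h. h + k) ` ?S \<Longrightarrow> T (component A x (h - k)) = 0"
      using T0 by (metis (mono_tags, lifting) add.commute add_diff_cancel_left' diff_add_cancel image_eqI mem_Collect_eq)
    have "T x = T (\<Sum>g\<in>?S. component A x g)" using cx(3) by simp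
    also have "\<dots> = (\<Sum>g\<in>?S. T (component A x g))" by (rule additive_on_sum[OF L T]) (use cL in auto)
    also have "\<dots> = (\<Sum>h\<in>(\<lambda>h. h + k) ` ?S. T (component A x (h - k)))"
      by (subst sum.reindex) (auto intro: inj_onI)
    finally show "T x = (\<Sum>h\<in>(\<lambda>h. h + k) ` ?S. T (component A x (h - k)))" .
  qed (use cx(2) in auto)
  then show ?thesis by simp
qed

lemma component_add:
  assumes A: "is_grading L A" and L: "mats.subspace L" and "x \<in> L" "y \<in> L"
  shows "component A (x + y) g = component A x g + component A y g"
proof -
  let ?S = "{g. component A x g \<noteq> 0} \<union> {g. component A y g \<noteq> 0}"
  note cx = component_spec[OF A assms(3)] and cy = component_spec[OF A assms(4)]
  have f: "finite ?S" using cx cy by simp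
  have "(\<Sum>g\<in>?S. component A x g) = x" "(\<Sum>g\<in>?S. component A y g) = y"
    using sum_support[OF f, of "component A x"] sum_support[OF f, of "component A y"] cx(3) cy(3) by auto
  then have "component A (x + y) = (\<lambda>g. component A x g + component A y g)"
    using assms by (intro component_eqI[OF A _ _ f])
      (auto simp: sum.distrib intro!: mats.subspace_add[OF L] mats.subspace_add[OF grading_subspace[OF A]] cx cy)
  then show ?thesis by simp
qed

lemma component_smult:
  fixes A :: "'g::ab_group_add \<Rightarrow> ('f::field, 'n::finite) sqmat set"
  assumes A: "is_grading L A" and L: "mats.subspace L" and x: "x \<in> L"
  shows "component A (mat_smult c x) g = mat_smult c (component A x g)"
  using component_map[OF A A L x, of "mat_smult c" 0 g]
  by (simp add: mats.scale_right_distrib mats.subspace_scale[OF L x] mats.subspace_scale[OF grading_subspace[OF A]])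

lemma component_sum:
  assumes A: "is_grading L A" and L: "mats.subspace L" and "\<And>a. a \<in> S \<Longrightarrow> f a \<in> L"
  shows "component A (\<Sum>a\<in>S. f a) g = (\<Sum>a\<in>S. component A (f a) g)"
  by (rule additive_on_sum[OF L]) (use assms component_add[OF A L] in auto)

lemma component_bracket:
  fixes A :: "'g::ab_group_add \<Rightarrow> ('f::field, 'n::finite) sqmat set"
  assumes A: "is_grading L A" and L: "mats.subspace L" and x: "x \<in> L" and y: "y \<in> A h"
    and b: "bracket x y \<in> L"
  shows "component A (bracket x y) (g + h) = bracket (component A x g) y"
  using component_map[OF A A L x, of "\<lambda>x. bracket x y" h g] b y
  by (simp add: bracket_linear grading_bracket[OF A])

lemma component_induct:
  assumes A: "is_grading L A" and x: "x \<in> L"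
    and "Q 0" "\<And>u v. Q u \<Longrightarrow> Q v \<Longrightarrow> Q (u + v)" "\<And>g. Q (component A x g)"
  shows "Q x"
proof -
  have "Q (\<Sum>g\<in>S. component A x g)" for S
    by (induction S rule: infinite_finite_induct) (use assms in auto)
  then show ?thesis using component_spec(3)[OF A x] by metis
qed

lemma is_gradingI:
  fixes A :: "'g::ab_group_add \<Rightarrow> ('f::field, 'n::finite) sqmat set"
  assumes sub: "\<And>g. mats.subspace (A g)" "\<And>g. A g \<subseteq> L"
    and ex: "\<And>x. x \<in> L \<Longrightarrow> \<exists>f S. finite S \<and> (\<forall>g. f g \<in> A g) \<and> (\<forall>g. g \<notin> S \<longrightarrow> f g = 0) \<and> x = (\<Sum>g\<in>S. f g)"
    and indep: "\<And>f S. finite S \<Longrightarrow> (\<And>g. f g \<in> A g) \<Longrightarrow> (\<And>g. g \<notin> S \<Longrightarrow> f g = 0) \<Longrightarrow> (\<Sum>g\<in>S. f g) = 0 \<Longrightarrow> f = (\<lambda>g. 0)"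
    and br: "\<And>g h x y. x \<in> A g \<Longrightarrow> y \<in> A h \<Longrightarrow> bracket x y \<in> A (g + h)"
  shows "is_grading L A"
  unfolding is_grading_def
proof (intro conjI allI ballI)
  fix x assume "x \<in> L"
  then obtain f S where f: "finite S" "\<forall>g. f g \<in> A g" "\<forall>g. g \<notin> S \<longrightarrow> f g = 0" "x = (\<Sum>g\<in>S. f g)"
    using ex by blast
  show "\<exists>!f. (\<forall>g. f g \<in> A g) \<and> finite {g. f g \<noteq> 0} \<and> x = (\<Sum>g | f g \<noteq> 0. f g)"
  proof (rule ex1I[of _ f], intro conjI)
    show "finite {g. f g \<noteq> 0}" by (rule finite_subset[OF _ f(1)]) (use f(3) in blast)
    show "x = (\<Sum>g | f g \<noteq> 0. f g)" using sum_support[OF f(1), of f] f(3,4) by simp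
  next
    fix f' assume f': "(\<forall>g. f' g \<in> A g) \<and> finite {g. f' g \<noteq> 0} \<and> x = (\<Sum>g | f' g \<noteq> 0. f' g)"
    let ?S = "S \<union> {g. f' g \<noteq> 0}"
    have fin: "finite ?S" using f f' by simp
    have 1: "(\<Sum>g\<in>?S. f' g) = x" using sum_support[OF fin, of f'] f' by auto
    have 2: "(\<Sum>g\<in>?S. f g) = x"
      using sum_support[OF fin, of f] sum_support[OF f(1), of f] f(3,4) by auto
    have "(\<lambda>g. f' g - f g) = (\<lambda>g. 0)"
    proof (rule indep[OF fin])
      show "f' g - f g \<in> A g" for g using f f' by (intro mats.subspace_diff sub) auto
      show "g \<notin> ?S \<Longrightarrow> f' g - f g = 0" for g using f by simp
      show "(\<Sum>g\<in>?S. f' g - f g) = 0" using 1 2 by (simp add: sum_subtractf)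
    qed
    then show "f' = f" by (simp add: fun_eq_iff)
  qed (use f in auto)
qed (use sub br in auto)

lemma grading_independent:
  assumes A: "is_grading L A" and L: "mats.subspace L" and f: "finite S" "\<And>g. f g \<in> A g"
    and S: "\<And>g. g \<notin> S \<Longrightarrow> f g = 0" and "(\<Sum>g\<in>S. f g) = 0"
  shows "f = (\<lambda>g. 0)"
proof -
  have "component A 0 = f" by (rule component_eqI[OF A]) (use assms mats.subspace_0[OF L] in auto)
  moreover have "component A 0 = (\<lambda>g. 0)"
    by (rule component_eqI[OF A, of _ _ "{}"])
       (use assms mats.subspace_0[OF L] mats.subspace_0[OF grading_subspace[OF A]] in auto)
  ultimately show ?thesis by metis
qed

lemma homogeneousI:
  assumes "is_grading L A" "x \<in> L" "\<And>h. h \<noteq> g \<Longrightarrow> component A x h = 0"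
  shows "x \<in> A g"
proof -
  have "x = component A x g"
    using component_spec(3)[OF assms(1,2)] sum_support[of "{g}" "component A x"] assms(3) by auto
  then show ?thesis using component_spec(1)[OF assms(1,2)] by metis
qed

lemma component_diff:
  assumes A: "is_grading L A" and L: "mats.subspace L" and "x \<in> L" "y \<in> L"
  shows "component A (x - y) g = component A x g - component A y g"
  using component_add[OF A L mats.subspace_diff[OF L assms(3,4)] assms(4), of g]
  by (simp only: diff_add_cancel add_diff_cancel_right')

lemma component_zero: "is_grading L A \<Longrightarrow> mats.subspace L \<Longrightarrow> component A 0 g = 0"
  using component_sum[of L A "{}"] by simp

text \<open>
  The functionals of interest are \<open>u \<mapsto> F u y\<close> for a graded bilinear form \<open>F\<close> and a homogeneous
  \<open>y\<close>: only the component of \<open>x\<close> of the opposite degree contributes.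
\<close>

lemma functional_component:
  fixes F :: "('f::field, 'n::finite) sqmat \<Rightarrow> 'b::ab_group_add"
  assumes A: "is_grading L A" and L: "mats.subspace L" and x: "x \<in> L"
    and F: "\<And>x y. F (x + y) = F x + F y" and van: "\<And>k u. k \<noteq> g \<Longrightarrow> u \<in> A k \<Longrightarrow> F u = 0"
  shows "F x = F (component A x g)"
proof -
  note c = component_spec[OF A x]
  have F0: "F 0 = 0" using F[of 0 0] by simp
  have Fs: "F (\<Sum>k\<in>S. f k) = (\<Sum>k\<in>S. F (f k))" for S and f :: "'c \<Rightarrow> ('f, 'n) sqmat"
    by (induction S rule: infinite_finite_induct) (simp_all add: F F0)
  let ?S = "insert g {k. component A x k \<noteq> 0}"
  have fin: "finite ?S" using c(2) by simp
  have "x = (\<Sum>k | component A x k \<noteq> 0. component A x k)" by (rule c(3)[symmetric])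
  also have "\<dots> = (\<Sum>k\<in>?S. component A x k)" by (rule sum_support[OF fin]) auto
  also have "F \<dots> = (\<Sum>k\<in>?S. F (component A x k))" by (rule Fs)
  also have "\<dots> = (\<Sum>k\<in>{g}. F (component A x k))"
    by (rule sum.mono_neutral_right[OF fin]) (use van c(1) in auto)
  finally show ?thesis by simp
qed

lemma component_bracket_sum:
  fixes A :: "'g::ab_group_add \<Rightarrow> ('f::field, 'n::finite) sqmat set"
  assumes A: "is_grading L A" and L: "mats.subspace L" and x: "x \<in> L" and y: "y \<in> L"
    and br: "\<And>x y. x \<in> L \<Longrightarrow> y \<in> L \<Longrightarrow> bracket x y \<in> L"
  shows "component A (bracket x y) g =
    (\<Sum>h | component A y h \<noteq> 0. bracket (component A x (g - h)) (component A y h))"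
proof -
  have cy: "component A y h \<in> A h" "component A y h \<in> L" for h
    using component_spec(1)[OF A y] grading_subset[OF A] by blast+
  have "bracket x y = (\<Sum>h | component A y h \<noteq> 0. bracket x (component A y h))"
    unfolding bracket_sum(1)[symmetric] component_spec(3)[OF A y] ..
  then have "component A (bracket x y) g = component A (\<Sum>h | component A y h \<noteq> 0. bracket x (component A y h)) g"
    by simp
  also have "\<dots> = (\<Sum>h | component A y h \<noteq> 0. component A (bracket x (component A y h)) g)"
    by (rule component_sum[OF A L br[OF x cy(2)]])
  also have "\<dots> = (\<Sum>h | component A y h \<noteq> 0. bracket (component A x (g - h)) (component A y h))"
  proof (rule sum.cong[OF refl])
    fix h show "component A (bracket x (component A y h)) g = bracket (component A x (g - h)) (component A y h)"
      using component_bracket[OF A L x cy(1)[of h] br[OF x cy(2)[of h]], of "g - h"] by simp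
  qed
  finally show ?thesis .
qed

lemma restrict_grading:
  fixes A :: "'g::ab_group_add \<Rightarrow> ('f::field, 'n::finite) sqmat set"
  assumes A: "is_grading L A" and L: "mats.subspace L" and L': "mats.subspace L'" "L' \<subseteq> L"
    and br: "\<And>x y. x \<in> L' \<Longrightarrow> y \<in> L' \<Longrightarrow> bracket x y \<in> L'"
    and c: "\<And>x g. x \<in> L' \<Longrightarrow> component A x g \<in> L'"
  shows "is_grading L' (\<lambda>g. A g \<inter> L')"
proof (rule is_gradingI)
  show "mats.subspace (A g \<inter> L')" for g by (rule mats.subspace_inter[OF grading_subspace[OF A] L'(1)])
  show "\<exists>f S. finite S \<and> (\<forall>g. f g \<in> A g \<inter> L') \<and> (\<forall>g. g \<notin> S \<longrightarrow> f g = 0) \<and> x = (\<Sum>g\<in>S. f g)"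
    if "x \<in> L'" for x
  proof -
    have xL: "x \<in> L" using that L' by blast
    show ?thesis
      using component_spec[OF A xL] c[OF that]
      by (intro exI[of _ "component A x"] exI[of _ "{g. component A x g \<noteq> 0}"]) auto
  qed
qed (use grading_independent[OF A L] grading_bracket[OF A] br in auto)

section \<open>Automorphisms and transport of gradings\<close>

lemma lie_automorphism_inv:
  assumes \<phi>: "lie_automorphism L \<phi>" and L: "mats.subspace L"
    and br: "\<And>x y. x \<in> L \<Longrightarrow> y \<in> L \<Longrightarrow> bracket x y \<in> L"
  shows "lie_automorphism L (inv_into L \<phi>)"
proof -
  let ?\<psi> = "inv_into L \<phi>"
  have bij: "bij_betw \<phi> L L" using \<phi> by (simp add: lie_automorphism_def)
  have \<psi>L: "?\<psi> x \<in> L" if "x \<in> L" for x using bij that by (metis bij_betw_def inv_into_into)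
  have r: "\<phi> (?\<psi> x) = x" if "x \<in> L" for x using bij that by (metis bij_betw_inv_into_right)
  have l: "?\<psi> y = x" if "x \<in> L" "\<phi> x = y" for x y using bij that by (metis bij_betw_inv_into_left)
  show ?thesis
    unfolding lie_automorphism_def
  proof (intro conjI allI ballI)
    show "bij_betw ?\<psi> L L" using bij by (rule bij_betw_inv_into)
    fix x y assume xy: "x \<in> L" "y \<in> L"
    show "?\<psi> (x + y) = ?\<psi> x + ?\<psi> y"
      by (rule l) (use xy \<phi> in \<open>simp_all add: \<psi>L r lie_automorphism_def mats.subspace_add[OF L]\<close>)
    show "?\<psi> (bracket x y) = bracket (?\<psi> x) (?\<psi> y)"
      by (rule l) (use xy \<phi> in \<open>simp_all add: \<psi>L r lie_automorphism_def br\<close>)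
  next
    fix c x assume x: "x \<in> L"
    show "?\<psi> (mat_smult c x) = mat_smult c (?\<psi> x)"
      by (rule l) (use x \<phi> in \<open>simp_all add: \<psi>L r lie_automorphism_def mats.subspace_scale[OF L]\<close>)
  qed
qed

lemma lie_automorphism_id: "lie_automorphism L (\<lambda>x. x)"
  by (simp add: lie_automorphism_def bij_betw_def)

lemma lie_automorphism_comp:
  assumes "lie_automorphism L \<phi>" "lie_automorphism L \<psi>"
  shows "lie_automorphism L (\<psi> \<circ> \<phi>)"
proof -
  have "x \<in> L \<Longrightarrow> \<phi> x \<in> L" for x using assms(1) by (auto simp: lie_automorphism_def bij_betw_def)
  then show ?thesis using assms unfolding lie_automorphism_def
    by (auto intro: bij_betw_trans)
qed

lemma lie_automorphism_sum:
  assumes "lie_automorphism L \<phi>" "mats.subspace L" "\<And>a. a \<in> S \<Longrightarrow> f a \<in> L"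
  shows "\<phi> (\<Sum>a\<in>S. f a) = (\<Sum>a\<in>S. \<phi> (f a))"
  by (rule additive_on_sum[OF assms(2)]) (use assms in \<open>auto simp: lie_automorphism_def\<close>)

lemma lie_automorphism_zero:
  assumes "lie_automorphism L \<phi>" "mats.subspace L"
  shows "\<phi> 0 = 0"
  using lie_automorphism_sum[OF assms, of "{}"] by simp

text \<open>
  An inclusion suffices: if \<open>\<phi> x\<close> is homogeneous, then the images of the other components of \<open>x\<close>
  vanish, because they are components of \<open>\<phi> x\<close>.
\<close>

lemma grading_isoI:
  fixes A A' :: "'g::ab_group_add \<Rightarrow> ('f::field, 'n::finite) sqmat set"
  assumes A: "is_grading L A" and A': "is_grading L A'" and \<phi>: "lie_automorphism L \<phi>"
    and L: "mats.subspace L" and sub: "\<And>g. \<phi> ` A g \<subseteq> A' g"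
  shows "(A, A') \<in> grading_iso L"
proof -
  have bij: "bij_betw \<phi> L L" and add: "\<And>x y. x \<in> L \<Longrightarrow> y \<in> L \<Longrightarrow> \<phi> (x + y) = \<phi> x + \<phi> y"
    using \<phi> by (simp_all add: lie_automorphism_def)
  have "y \<in> \<phi> ` A g" if y: "y \<in> A' g" for y g
  proof -
    have "y \<in> L" using y grading_subset[OF A'] by blast
    then obtain x where x: "x \<in> L" "y = \<phi> x" using bij by (auto simp: bij_betw_def)
    have hom: "z \<in> A k \<Longrightarrow> \<phi> z \<in> A' (k + 0)" for z k using sub[of k] by auto
    have "\<phi> (component A x h) = component A' y h" for h
      using component_map[OF A A' L x(1) add _ hom, of h] x \<open>y \<in> L\<close> by simp
    then have "\<phi> (component A x h) = 0" if "h \<noteq> g" for h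
      using component_homogeneous[OF A' y] that by simp
    moreover have "component A x h \<in> L" for h using component_spec(1)[OF A x(1)] grading_subset[OF A] by blast
    ultimately have "component A x h = 0" if "h \<noteq> g" for h
      using that bij mats.subspace_0[OF L] lie_automorphism_zero[OF \<phi> L]
      unfolding bij_betw_def inj_on_def by metis
    then have "x = (\<Sum>h\<in>{g}. component A x h)"
      using component_spec(3)[OF A x(1)] sum_support[of "{g}" "component A x"] by auto
    then show ?thesis using x component_spec(1)[OF A x(1), of g] by auto
  qed
  then have "\<phi> ` A g = A' g" for g using sub by blast
  then show ?thesis using A A' \<phi> unfolding grading_iso_def by blast
qed

lemma image_grading:
  fixes A :: "'g::ab_group_add \<Rightarrow> ('f::field, 'n::finite) sqmat set"
  assumes A: "is_grading L A" and \<phi>: "lie_automorphism L \<phi>" and L: "mats.subspace L"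
  shows "is_grading L (\<lambda>g. \<phi> ` A g)"
proof (rule is_gradingI)
  have bij: "bij_betw \<phi> L L" and add: "\<And>x y. x \<in> L \<Longrightarrow> y \<in> L \<Longrightarrow> \<phi> (x + y) = \<phi> x + \<phi> y"
    and smult: "\<And>c x. x \<in> L \<Longrightarrow> \<phi> (mat_smult c x) = mat_smult c (\<phi> x)"
    and br: "\<And>x y. x \<in> L \<Longrightarrow> y \<in> L \<Longrightarrow> \<phi> (bracket x y) = bracket (\<phi> x) (\<phi> y)"
    using \<phi> by (simp_all add: lie_automorphism_def)
  have \<phi>0: "\<phi> 0 = 0" by (rule lie_automorphism_zero[OF \<phi> L])
  have AL: "x \<in> A g \<Longrightarrow> x \<in> L" for x g using grading_subset[OF A] by blast
  note sub = grading_subspace[OF A]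
  show "mats.subspace (\<phi> ` A g)" for g
    unfolding mats.subspace_def
  proof (intro conjI ballI allI)
    show "0 \<in> \<phi> ` A g" using mats.subspace_0[OF sub] \<phi>0 by (metis image_eqI)
  next
    fix u v assume "u \<in> \<phi> ` A g" "v \<in> \<phi> ` A g"
    then obtain x y where "x \<in> A g" "u = \<phi> x" "y \<in> A g" "v = \<phi> y" by auto
    then show "u + v \<in> \<phi> ` A g" using add[of x y] AL mats.subspace_add[OF sub, of x g y] by (metis image_eqI)
  next
    fix c u assume "u \<in> \<phi> ` A g"
    then obtain x where "x \<in> A g" "u = \<phi> x" by auto
    then show "mat_smult c u \<in> \<phi> ` A g"
      using smult[of x c] AL mats.subspace_scale[OF sub, of x g c] by (metis image_eqI)
  qed
  show "\<phi> ` A g \<subseteq> L" for g using bij AL by (auto simp: bij_betw_def)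
  show "bracket u v \<in> \<phi> ` A (g + h)" if uv: "u \<in> \<phi> ` A g" "v \<in> \<phi> ` A h" for g h u v
  proof -
    obtain x y where xy: "x \<in> A g" "u = \<phi> x" "y \<in> A h" "v = \<phi> y" using uv by blast
    then show ?thesis using br[of x y] AL grading_bracket[OF A xy(1,3)] by (metis image_eqI)
  qed
  show "\<exists>f S. finite S \<and> (\<forall>g. f g \<in> \<phi> ` A g) \<and> (\<forall>g. g \<notin> S \<longrightarrow> f g = 0) \<and> u = (\<Sum>g\<in>S. f g)"
    if u: "u \<in> L" for u
  proof -
    obtain x where x: "x \<in> L" "u = \<phi> x" using bij u unfolding bij_betw_def by blast
    note c = component_spec[OF A x(1)]
    have "u = (\<Sum>g | component A x g \<noteq> 0. \<phi> (component A x g))"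
      using lie_automorphism_sum[OF \<phi> L, of _ "component A x"] c AL x(2) by metis
    then show ?thesis
      using c \<phi>0 by (intro exI[of _ "\<lambda>g. \<phi> (component A x g)"] exI[of _ "{g. component A x g \<noteq> 0}"]) auto
  qed
  fix f S assume S: "finite S" and f: "\<And>g. f g \<in> \<phi> ` A g" "\<And>g. g \<notin> S \<Longrightarrow> f g = 0" "(\<Sum>g\<in>S. f g) = 0"
  let ?h = "\<lambda>g. inv_into L \<phi> (f g)"
  have h: "?h g \<in> A g" "\<phi> (?h g) = f g" for g
  proof -
    obtain x where "x \<in> A g" "f g = \<phi> x" using f(1) by blast
    then show "?h g \<in> A g" "\<phi> (?h g) = f g" using bij AL by (auto simp: bij_betw_inv_into_left)
  qed
  have hL: "?h g \<in> L" for g using h(1) AL by blast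
  have inv0: "x = 0" if "x \<in> L" "\<phi> x = 0" for x
    using that bij \<phi>0 mats.subspace_0[OF L] by (metis bij_betw_inv_into_left)
  have "?h = (\<lambda>g. 0)"
  proof (rule grading_independent[OF A L S h(1)])
    show "g \<notin> S \<Longrightarrow> ?h g = 0" for g using f(2) h AL inv0 by metis
    have "\<phi> (\<Sum>g\<in>S. ?h g) = 0" using lie_automorphism_sum[OF \<phi> L, of S ?h] hL h(2) f(3) by simp
    then show "(\<Sum>g\<in>S. ?h g) = 0" using hL by (intro inv0[OF mats.subspace_sum[OF L]])
  qed
  then have "?h g = 0" for g by (rule fun_cong)
  then show "f = (\<lambda>g. 0)" using h(2) \<phi>0 by metis
qed


section \<open>Traces of operators and Killing forms\<close>

abbreviation mat_linear :: "(('f::field, 'n::finite) sqmat \<Rightarrow> ('f, 'n) sqmat) \<Rightarrow> bool" where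
  "mat_linear \<equiv> module_hom mat_smult mat_smult"

lemma mat_linearI:
  "(\<And>x y. T (x + y) = T x + T y) \<Longrightarrow> (\<And>c x. T (mat_smult c x) = mat_smult c (T x)) \<Longrightarrow> mat_linear T"
  by (simp add: module_hom_iff mats.module_axioms)

definition op_trace :: "(('f::field, 'n::finite) sqmat \<Rightarrow> ('f, 'n) sqmat) \<Rightarrow> 'f" where
  "op_trace T = (\<Sum>i\<in>UNIV. \<Sum>j\<in>UNIV. T (munit i j) $ i $ j)"

lemma op_trace_comp:
  assumes "mat_linear S"
  shows "op_trace (\<lambda>z. S (T z)) =
    (\<Sum>i\<in>UNIV. \<Sum>j\<in>UNIV. \<Sum>k\<in>UNIV. \<Sum>l\<in>UNIV. T (munit i j) $ k $ l * S (munit k l) $ i $ j)"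
proof -
  have "S (T z) = (\<Sum>k\<in>UNIV. \<Sum>l\<in>UNIV. mat_smult (T z $ k $ l) (S (munit k l)))" for z
  proof -
    have "S (T z) = S (\<Sum>k\<in>UNIV. \<Sum>l\<in>UNIV. mat_smult (T z $ k $ l) (munit k l))"
      using sum_munit[of "T z"] by simp
    then show ?thesis by (simp add: module_hom.sum[OF assms] module_hom.scale[OF assms])
  qed
  then show ?thesis by (simp add: op_trace_def)
qed

lemma op_trace_commute:
  fixes S T :: "('a::field, 'b::finite) sqmat \<Rightarrow> ('a, 'b) sqmat"
  assumes "mat_linear S" "mat_linear T"
  shows "op_trace (\<lambda>z. S (T z)) = op_trace (\<lambda>z. T (S z))"
proof -
  let ?t = "\<lambda>i j k l. T (munit i j) $ k $ l * S (munit k l) $ i $ j"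
  have pairs: "(\<Sum>i\<in>UNIV. \<Sum>j\<in>UNIV. h i j) = (\<Sum>p\<in>UNIV. h (fst p) (snd p))"
    for h :: "'b \<Rightarrow> 'b \<Rightarrow> 'a"
    by (simp add: sum.cartesian_product case_prod_unfold)
  have "(\<Sum>i\<in>UNIV. \<Sum>j\<in>UNIV. \<Sum>k\<in>UNIV. \<Sum>l\<in>UNIV. ?t i j k l) =
        (\<Sum>p\<in>UNIV. \<Sum>q\<in>UNIV. ?t (fst p) (snd p) (fst q) (snd q))"
    unfolding pairs ..
  also have "\<dots> = (\<Sum>q\<in>UNIV. \<Sum>p\<in>UNIV. ?t (fst p) (snd p) (fst q) (snd q))"
    by (rule sum.swap)
  also have "\<dots> = (\<Sum>k\<in>UNIV. \<Sum>l\<in>UNIV. \<Sum>i\<in>UNIV. \<Sum>j\<in>UNIV. ?t i j k l)"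
    unfolding pairs ..
  finally show ?thesis
    unfolding op_trace_comp[OF assms(1)] op_trace_comp[OF assms(2)] by (simp add: mult.commute)
qed

text \<open>
  The trace of an operator on \<open>sl_on K\<close> is the trace of its composition with this projection from
  the space of all matrices, so the basis of matrix units can be used throughout. The scalar matrix
  that is subtracted disappears under brackets.
\<close>

definition sl_proj :: "('n \<times> 'n) set \<Rightarrow> ('f::field, 'n::finite) sqmat \<Rightarrow> ('f, 'n) sqmat" where
  "sl_proj K x = (\<chi> i j. (if (i, j) \<in> K then x $ i $ j else 0) - (if i = j then trace x / of_nat CARD('n) else 0))"

lemma sl_proj_linear: "mat_linear (sl_proj K)"
  by (rule mat_linearI) (auto simp: vec_eq_iff sl_proj_def trace_add add_divide_distrib algebra_simps)

lemma sl_proj_in: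
  fixes x :: "('f::field_char_0, 'n::finite) sqmat"
  assumes "Id \<subseteq> K"
  shows "sl_proj K x \<in> sl_on K"
proof -
  have "(\<Sum>i\<in>UNIV. sl_proj K x $ i $ i) = (\<Sum>i\<in>UNIV. x $ i $ i - trace x / of_nat CARD('n))"
    by (rule sum.cong) (use assms in \<open>auto simp: sl_proj_def\<close>)
  then have "trace (sl_proj K x) = 0" by (simp add: trace_def sum_subtractf)
  then show ?thesis using assms by (auto simp: sl_on_def supported_def sl_def sl_proj_def)
qed

lemma sl_proj_id: "x \<in> sl_on K \<Longrightarrow> sl_proj K x = x"
  by (rule mat_eqI) (auto simp: sl_proj_def sl_on_trace dest: sl_onD)

text \<open>
  For \<open>x\<close>, \<open>y\<close> in the Lie algebra \<open>sl_on K\<close> this is its Killing form, the trace of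
  \<open>ad x \<circ> ad y\<close>, evaluated on matrix units.
\<close>

definition killing :: "('n \<times> 'n) set \<Rightarrow> ('f::field, 'n::finite) sqmat \<Rightarrow> ('f, 'n) sqmat \<Rightarrow> 'f" where
  "killing K x y = (\<Sum>(i, j)\<in>K. (x ** y) $ i $ i + (y ** x) $ j $ j - x $ i $ i * y $ j $ j - y $ i $ i * x $ j $ j)"

lemma bracket_bracket_munit:
  fixes x y :: "('f::field, 'n::finite) sqmat"
  shows "bracket x (bracket y (munit i j)) $ i $ j =
     (x ** y) $ i $ i + (y ** x) $ j $ j - x $ i $ i * y $ j $ j - y $ i $ i * x $ j $ j"
proof -
  have 1: "(x ** munit i j ** y) $ i $ j = x $ i $ i * y $ j $ j" for x y :: "('f, 'n) sqmat"
  proof -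
    have "(x ** munit i j ** y) $ i $ j = (\<Sum>k\<in>UNIV. if k = j then x $ i $ i * y $ j $ j else 0)"
      unfolding mat_mult_nth[of "x ** munit i j"] mult_munit_nth by (rule sum.cong) auto
    then show ?thesis by simp
  qed
  have 2: "(x ** (munit i j ** y)) $ i $ j = x $ i $ i * y $ j $ j" for x y :: "('f, 'n) sqmat"
    using 1 by (simp add: matrix_mul_assoc)
  have "x ** (y ** munit i j) = (x ** y) ** munit i j" "munit i j ** y ** x = munit i j ** (y ** x)"
    by (simp_all add: matrix_mul_assoc)
  then have 3: "(x ** (y ** munit i j)) $ i $ j = (x ** y) $ i $ i" "(munit i j ** y ** x) $ i $ j = (y ** x) $ j $ j"
    by (simp_all add: mult_munit_nth)
  show ?thesis
    unfolding bracket_def mult_diff_mat by (simp add: 1 2 3)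
qed

lemma op_trace_ad:
  fixes x y :: "('f::field_char_0, 'n::finite) sqmat"
  shows "op_trace (\<lambda>z. bracket x (bracket y (sl_proj K z))) = killing K x y"
proof -
  have b: "bracket y (sl_proj K (munit i j)) = (if (i, j) \<in> K then bracket y (munit i j) else 0)" for i j
  proof -
    define c :: 'f where "c = (if i = j then 1 else 0) / of_nat CARD('n)"
    have "sl_proj K (munit i j) = (if (i, j) \<in> K then munit i j else 0) - mat_smult c (mat 1)"
      by (rule mat_eqI) (auto simp: sl_proj_def c_def mat_def)
    moreover have "bracket y (mat_smult c (mat 1)) = 0"
      by (simp add: bracket_linear) (simp add: bracket_def)
    ultimately show ?thesis by (simp add: bracket_linear)
  qed
  have "op_trace (\<lambda>z. bracket x (bracket y (sl_proj K z))) = (\<Sum>i\<in>UNIV. \<Sum>j\<in>UNIV. if (i, j) \<in> K then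
      (x ** y) $ i $ i + (y ** x) $ j $ j - x $ i $ i * y $ j $ j - y $ i $ i * x $ j $ j else 0)"
    unfolding op_trace_def b by (intro sum.cong refl) (simp add: bracket_bracket_munit bracket_linear)
  also have "\<dots> = (\<Sum>p\<in>UNIV. if p \<in> K then (case p of (i, j) \<Rightarrow>
      (x ** y) $ i $ i + (y ** x) $ j $ j - x $ i $ i * y $ j $ j - y $ i $ i * x $ j $ j) else 0)"
    unfolding sum.cartesian_product UNIV_Times_UNIV by (rule sum.cong) auto
  also have "\<dots> = killing K x y"
    unfolding killing_def by (simp add: sum.If_cases)
  finally show ?thesis .
qed

lemma grading_finite_support:
  fixes B :: "'g::ab_group_add \<Rightarrow> ('f::field_char_0, 'n::finite) sqmat set"
  assumes K: "Id \<subseteq> K" and B: "is_grading (sl_on K) B"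
  obtains S where "finite S" "\<And>x g. x \<in> sl_on K \<Longrightarrow> g \<notin> S \<Longrightarrow> component B x g = 0"
proof
  note L = subspace_sl_on[of K]
  let ?u = "\<lambda>i j. sl_proj K (munit i j) :: ('f, 'n) sqmat"
  let ?S = "\<Union>i. \<Union>j. {g. component B (?u i j) g \<noteq> 0}"
  have u: "?u i j \<in> sl_on K" for i j by (rule sl_proj_in[OF K])
  show "finite ?S" using component_spec(2)[OF B u] by simp
  fix x :: "('f, 'n) sqmat" and g assume x: "x \<in> sl_on K" and g: "g \<notin> ?S"
  have "sl_proj K x = sl_proj K (\<Sum>i\<in>UNIV. \<Sum>j\<in>UNIV. mat_smult (x $ i $ j) (munit i j))"
    by (rule arg_cong[OF sum_munit])
  also have "\<dots> = (\<Sum>i\<in>UNIV. \<Sum>j\<in>UNIV. mat_smult (x $ i $ j) (?u i j))"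
    by (simp add: module_hom.sum[OF sl_proj_linear] module_hom.scale[OF sl_proj_linear])
  finally have "component B x g = component B (\<Sum>i\<in>UNIV. \<Sum>j\<in>UNIV. mat_smult (x $ i $ j) (?u i j)) g"
    unfolding sl_proj_id[OF x] by (rule arg_cong)
  moreover have "component B (\<Sum>i\<in>UNIV. \<Sum>j\<in>UNIV. mat_smult (x $ i $ j) (?u i j)) g = 0"
    using g u by (simp add: component_sum[OF B L] component_smult[OF B L] mats.subspace_sum[OF L] mats.subspace_scale[OF L])
  ultimately show "component B x g = 0" by simp
qed

text \<open>
  If \<open>x\<close> and \<open>y\<close> have degrees \<open>g\<close> and \<open>h\<close> with \<open>g + h \<noteq> 0\<close>, the operator \<open>ad x \<circ> ad y\<close>
  shifts all degrees by \<open>g + h\<close>, so its trace vanishes.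
\<close>

lemma killing_graded:
  fixes B :: "'g::ab_group_add \<Rightarrow> ('f::field_char_0, 'n::finite) sqmat set"
  assumes K: "Id \<subseteq> K" "trans K" and B: "is_grading (sl_on K) B"
    and xy: "x \<in> B g" "y \<in> B h" "g + h \<noteq> 0"
  shows "killing K x y = 0"
proof -
  let ?L = "sl_on K :: ('f, 'n) sqmat set"
  note L = subspace_sl_on[of K]
  obtain S where S: "finite S" "\<And>x g. x \<in> ?L \<Longrightarrow> g \<notin> S \<Longrightarrow> component B x g = 0"
    by (rule grading_finite_support[OF K(1) B]) blast
  define \<pi> where "\<pi> k z = component B (sl_proj K z) k" for k z
  have pL: "sl_proj K z \<in> ?L" for z by (rule sl_proj_in[OF K(1)])
  have \<pi>B: "\<pi> k z \<in> B k" for k z unfolding \<pi>_def by (rule component_spec(1)[OF B pL])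
  then have \<pi>L: "\<pi> k z \<in> ?L" for k z using grading_subset[OF B] by blast
  have \<pi>lin: "mat_linear (\<pi> k)" for k
    by (rule mat_linearI) (simp_all add: \<pi>_def module_hom.add[OF sl_proj_linear]
      module_hom.scale[OF sl_proj_linear] component_add[OF B L pL pL] component_smult[OF B L pL])
  have \<pi>hom: "\<pi> k z = (if k = l then z else 0)" if "z \<in> B l" for k l z
  proof -
    have "z \<in> ?L" using that grading_subset[OF B] by blast
    then show ?thesis unfolding \<pi>_def by (simp add: sl_proj_id component_homogeneous[OF B that])
  qed
  have sum\<pi>: "sl_proj K z = (\<Sum>k\<in>S. \<pi> k z)" for z
    unfolding \<pi>_def using component_spec(3)[OF B pL, of z] sum_support[OF S(1), of "component B (sl_proj K z)"]
      S(2)[OF pL] by simp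
  define T where "T z = bracket x (bracket y z)" for z
  have Tlin: "mat_linear T" by (rule mat_linearI) (simp_all add: T_def bracket_linear)
  have T\<pi>: "T (\<pi> k z) \<in> B (g + (h + k))" for k z
    unfolding T_def by (intro grading_bracket[OF B] xy \<pi>B)
  have "killing K x y = op_trace (\<lambda>z. T (\<Sum>k\<in>S. \<pi> k z))"
    unfolding T_def sum\<pi>[symmetric] op_trace_ad ..
  also have "\<dots> = op_trace (\<lambda>z. \<Sum>k\<in>S. T (\<pi> k z))" by (simp add: module_hom.sum[OF Tlin])
  also have "\<dots> = (\<Sum>k\<in>S. op_trace (\<lambda>z. T (\<pi> k z)))"
    unfolding op_trace_def by (simp add: sum.swap[of _ S])
  also have "\<dots> = 0"
  proof (rule sum.neutral, rule ballI)
    fix k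
    have lin: "mat_linear (\<lambda>z. T (\<pi> k z))"
      by (rule mat_linearI) (simp_all add: module_hom.add[OF Tlin] module_hom.scale[OF Tlin]
        module_hom.add[OF \<pi>lin] module_hom.scale[OF \<pi>lin])
    \<comment> \<open>The projection to degree \<open>g + h + k\<close> may be inserted; moved to the right it annihilates \<open>\<pi> k\<close>.\<close>
    have "op_trace (\<lambda>z. T (\<pi> k z)) = op_trace (\<lambda>z. \<pi> (g + (h + k)) (T (\<pi> k z)))"
      using \<pi>hom[OF T\<pi>] by simp
    also have "\<dots> = op_trace (\<lambda>z. T (\<pi> k (\<pi> (g + (h + k)) z)))"
      by (rule op_trace_commute[OF \<pi>lin lin])
    also have "\<dots> = op_trace (\<lambda>z :: ('f, 'n) sqmat. 0)"
      using xy(3) by (simp add: \<pi>hom[OF \<pi>B] T_def bracket_linear flip: add.assoc)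
    finally show "op_trace (\<lambda>z. T (\<pi> k z)) = 0" by (simp add: op_trace_def)
  qed
  finally show ?thesis .
qed

text \<open>
  The operators \<open>ad (\<psi> x)\<close> and \<open>ad x\<close> are conjugate by \<open>\<psi>\<close>.
\<close>

lemma killing_automorphism:
  fixes x y :: "('f::field_char_0, 'n::finite) sqmat"
  assumes K: "Id \<subseteq> K" "trans K" and \<psi>: "lie_automorphism (sl_on K) \<psi>"
    and xy: "x \<in> sl_on K" "y \<in> sl_on K"
  shows "killing K (\<psi> x) (\<psi> y) = killing K x y"
proof -
  let ?L = "sl_on K :: ('f, 'n) sqmat set"
  note L = subspace_sl_on[of K]
  have br: "u \<in> ?L \<Longrightarrow> v \<in> ?L \<Longrightarrow> bracket u v \<in> ?L" for u v
    by (rule bracket_sl_on) (use K in \<open>auto dest: transD\<close>)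
  define \<psi>' where "\<psi>' = inv_into ?L \<psi>"
  have \<psi>': "lie_automorphism ?L \<psi>'" unfolding \<psi>'_def by (rule lie_automorphism_inv[OF \<psi> L br])
  have bij: "bij_betw \<psi> ?L ?L" "bij_betw \<psi>' ?L ?L"
    using \<psi> \<psi>' by (simp_all add: lie_automorphism_def)
  have pL: "sl_proj K z \<in> ?L" for z :: "('f, 'n) sqmat" by (rule sl_proj_in[OF K(1)])
  define U where "U z = \<psi> (sl_proj K z)" for z
  define V where "V z = bracket x (bracket y (\<psi>' (sl_proj K z)))" for z
  have lin: "mat_linear (\<lambda>z. \<theta> (sl_proj K z))" if "lie_automorphism ?L \<theta>" for \<theta>
    using that by (intro mat_linearI) (simp_all add: module_hom.add[OF sl_proj_linear]
      module_hom.scale[OF sl_proj_linear] lie_automorphism_def pL)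
  have Ulin: "mat_linear U" unfolding U_def by (rule lin[OF \<psi>])
  have Vlin: "mat_linear V"
    by (rule mat_linearI) (simp_all add: V_def module_hom.add[OF lin[OF \<psi>']]
      module_hom.scale[OF lin[OF \<psi>']] bracket_linear)
  have \<psi>'L: "\<psi>' z \<in> ?L" "\<psi> (\<psi>' z) = z" "\<psi>' (\<psi> z) = z" if "z \<in> ?L" for z
    using bij(2) that bij_betw_inv_into_right[OF bij(1)] bij_betw_inv_into_left[OF bij(1)]
    unfolding \<psi>'_def by (auto simp: bij_betw_def)
  have \<psi>L: "\<psi> z \<in> ?L" if "z \<in> ?L" for z using bij that by (auto simp: bij_betw_def)
  have VL: "V z \<in> ?L" for z unfolding V_def by (intro br xy \<psi>'L pL)
  have 1: "U (V z) = bracket (\<psi> x) (bracket (\<psi> y) (sl_proj K z))" for z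
  proof -
    have "U (V z) = \<psi> (V z)" unfolding U_def by (simp add: sl_proj_id[OF VL])
    also have "\<dots> = bracket (\<psi> x) (bracket (\<psi> y) (sl_proj K z))"
      using \<psi> xy by (simp add: V_def lie_automorphism_def br \<psi>'L pL)
    finally show ?thesis .
  qed
  have 2: "V (U z) = bracket x (bracket y (sl_proj K z))" for z
    by (simp add: V_def U_def sl_proj_id[OF \<psi>L[OF pL]] \<psi>'L[OF pL])
  show ?thesis
    using op_trace_commute[OF Ulin Vlin] by (simp add: 1 2 op_trace_ad)
qed

lemma sum_split_pairs:
  fixes f :: "'n::finite \<Rightarrow> 'n \<Rightarrow> 'a::comm_monoid_add"
  shows "(\<Sum>(i, j)\<in>{(i, j). P i j}. f i j) = (\<Sum>i\<in>UNIV. \<Sum>j | P i j. f i j)"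
proof -
  have "{(i, j). P i j} = Sigma UNIV (\<lambda>i. {j. P i j})" by auto
  then show ?thesis by (simp add: sum.Sigma)
qed

lemma killing_UNIV:
  "killing UNIV x y = 2 * of_nat CARD('n) * trace (x ** y) - 2 * trace x * trace (y :: ('f::field, 'n::finite) sqmat)"
proof -
  have "killing UNIV x y = (\<Sum>i\<in>UNIV. \<Sum>j\<in>UNIV. (x ** y) $ i $ i + (y ** x) $ j $ j - x $ i $ i * y $ j $ j - y $ i $ i * x $ j $ j)"
    using sum_split_pairs[where P = "\<lambda>_ _. True"] unfolding killing_def by simp
  also have "\<dots> = of_nat CARD('n) * trace (x ** y) + of_nat CARD('n) * trace (y ** x) - trace x * trace y - trace y * trace x"
  proof -
    have "(\<Sum>i\<in>UNIV. \<Sum>j\<in>UNIV. u $ i $ i * v $ j $ j) = trace u * trace v" for u v :: "('f, 'n) sqmat"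
      by (simp add: trace_def sum_product)
    then show ?thesis
      by (simp add: sum.distrib sum_subtractf) (simp add: trace_def sum_distrib_left)
  qed
  finally show ?thesis by (simp add: trace_mul_sym[of y])
qed

lemma killing_add:
  "killing K (x + x') y = killing K x y + killing K x' y"
  "killing K x (y + y') = killing K x y + killing K x y'"
  unfolding killing_def sum.distrib[symmetric]
  by (auto intro!: sum.cong simp: mult_add_mat distrib_left distrib_right)

lemma killing_zero [simp]: "killing K 0 y = 0" "killing K x 0 = 0"
  by (simp_all add: killing_def case_prod_unfold)

section \<open>Block structure and the trace form\<close>

text \<open>
  The map \<open>b\<close> sends an index to the number of its block, counted from 0; it hits every number below
  \<open>s\<close> because no block is empty.
\<close>

locale blocks =
  fixes b :: "'n::finite \<Rightarrow> nat" and s :: nat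
  assumes range_b: "range b = {..<s}"
begin

definition upper :: "nat \<Rightarrow> ('n \<times> 'n) set" where
  "upper k = {(i, j). b i + k \<le> b j}"

definition diagonal :: "int \<Rightarrow> ('n \<times> 'n) set" where
  "diagonal m = {(i, j). int (b j) = int (b i) + m}"

abbreviation diagonal_sl :: "int \<Rightarrow> ('f::field, 'n) sqmat set" ("\<D>") where
  "\<D> m \<equiv> sl_on (diagonal m)"

abbreviation upper_sl :: "nat \<Rightarrow> ('f::field, 'n) sqmat set" ("\<U>") where
  "\<U> k \<equiv> sl_on (upper k)"

lemma b_less: "b i < s" using range_b by blast

lemma ex_block: "q < s \<Longrightarrow> \<exists>i. b i = q" using range_b by (metis imageE lessThan_iff)

lemma upper_0_refl: "Id \<subseteq> upper 0" and upper_0_trans: "trans (upper 0)"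
  and diagonal_0_refl: "Id \<subseteq> diagonal 0" and diagonal_0_trans: "trans (diagonal 0)"
  by (auto simp: upper_def diagonal_def trans_def)

lemma upper_comp: "upper k O upper l \<subseteq> upper (k + l)"
  by (auto simp: upper_def)

lemma diagonal_comp: "diagonal k O diagonal l \<subseteq> diagonal (k + l)"
  by (auto simp: diagonal_def)

lemma bracket_upper: "x \<in> \<U> k \<Longrightarrow> y \<in> \<U> l \<Longrightarrow> bracket x y \<in> \<U> (k + l)"
  by (rule bracket_sl_on[of x "upper k" y "upper l"])
    (use upper_comp[of k l] upper_comp[of l k] in \<open>simp_all add: add.commute\<close>)

lemma bracket_diagonal:
  "x \<in> \<D> k \<Longrightarrow> y \<in> \<D> l \<Longrightarrow> bracket x y \<in> \<D> (k + l)"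
  by (rule bracket_sl_on[of x "diagonal k" y "diagonal l"])
    (use diagonal_comp[of k l] diagonal_comp[of l k] in \<open>simp_all add: add.commute\<close>)

lemma upper_mono: "k \<le> l \<Longrightarrow> upper l \<subseteq> upper k"
  by (auto simp: upper_def)

lemma diagonal_upper: "int k \<le> m \<Longrightarrow> diagonal m \<subseteq> upper k"
  by (auto simp: diagonal_def upper_def)

lemma converse_diagonal: "(diagonal m)\<inverse> = diagonal (- m)"
  by (auto simp: diagonal_def)

lemma diagonal_refl_or_irrefl: "Id \<subseteq> diagonal m \<or> Id \<inter> diagonal m = {}"
  by (auto simp: diagonal_def)

lemma sl_on_upper_1: "\<U> 1 \<subseteq> \<U> 0"
  by (intro sl_on_mono upper_mono) simp

lemma sum_over_blocks:
  fixes c :: "'n \<Rightarrow> 'a::comm_ring_1"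
  assumes "\<And>q. (\<Sum>i | b i = q. c i) = 0"
  shows "(\<Sum>i\<in>UNIV. f (b i) * c i) = 0"
proof -
  have "(\<Sum>i\<in>UNIV. f (b i) * c i) = (\<Sum>q\<in>range b. \<Sum>i\<in>{i \<in> UNIV. b i = q}. f (b i) * c i)"
    by (rule sum.group[symmetric]) auto
  also have "\<dots> = (\<Sum>q\<in>range b. f q * (\<Sum>i | b i = q. c i))"
    by (simp add: sum_distrib_left)
  finally show ?thesis using assms by simp
qed

lemma block_trace_bracket:
  fixes x y :: "('f::field, 'n) sqmat"
  assumes x: "x \<in> supported (upper 0)" and y: "y \<in> supported (upper 0)"
  shows "(\<Sum>i | b i = q. bracket x y $ i $ i) = 0"
proof -
  have "bracket x y $ i $ i = (\<Sum>k | b k = q. x $ i $ k * y $ k $ i - y $ i $ k * x $ k $ i)" if "b i = q" for i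
  proof -
    have "x $ i $ k * y $ k $ i - y $ i $ k * x $ k $ i = 0" if "b k \<noteq> q" for k
    proof -
      have "(i, k) \<notin> upper 0 \<or> (k, i) \<notin> upper 0" using that \<open>b i = q\<close> by (auto simp: upper_def)
      then show ?thesis using supportedD[OF x] supportedD[OF y] by (metis diff_zero mult_zero_left mult_zero_right)
    qed
    then have "(\<Sum>k | b k = q. x $ i $ k * y $ k $ i - y $ i $ k * x $ k $ i) =
       (\<Sum>k\<in>UNIV. x $ i $ k * y $ k $ i - y $ i $ k * x $ k $ i)"
      by (intro sum.mono_neutral_left) auto
    then show ?thesis by (simp add: bracket_def mat_mult_nth sum_subtractf)
  qed
  then have "(\<Sum>i | b i = q. bracket x y $ i $ i) =
      (\<Sum>i | b i = q. \<Sum>k | b k = q. x $ i $ k * y $ k $ i) - (\<Sum>i | b i = q. \<Sum>k | b k = q. y $ i $ k * x $ k $ i)"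
    by (simp add: sum_subtractf)
  also have "(\<Sum>i | b i = q. \<Sum>k | b k = q. y $ i $ k * x $ k $ i) = (\<Sum>i | b i = q. \<Sum>k | b k = q. x $ i $ k * y $ k $ i)"
    by (subst sum.swap) (simp add: mult.commute)
  finally show ?thesis by simp
qed

text \<open>
  The positions below the block diagonal contribute as much to the Killing form of \<open>sl\<close> as
  those above it, because blockwise traces of brackets vanish.
\<close>

lemma two_killing_upper:
  fixes x y :: "('f::field, 'n) sqmat"
  assumes x: "x \<in> supported (upper 0)" and y: "y \<in> supported (upper 0)"
  shows "2 * killing (upper 0) x y = killing UNIV x y + killing (diagonal 0) x y"
proof -
  define F where "F i j = (x ** y) $ i $ i + (y ** x) $ j $ j - x $ i $ i * y $ j $ j - y $ i $ i * x $ j $ j" for i j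
  have kF: "killing K x y = (\<Sum>(i, j)\<in>K. F i j)" for K by (simp add: killing_def F_def)
  let ?c = "\<lambda>i. bracket x y $ i $ i"
  have un: "killing (K \<union> K') x y = killing K x y + killing K' x y" if "K \<inter> K' = {}" for K K'
    unfolding kF using that by (intro sum.union_disjoint) auto
  have "upper 0 = diagonal 0 \<union> upper 1" "diagonal 0 \<inter> upper 1 = {}"
    by (auto simp: upper_def diagonal_def)
  then have 1: "killing (upper 0) x y = killing (diagonal 0) x y + killing (upper 1) x y" using un by metis
  have "UNIV = upper 0 \<union> (upper 1)\<inverse>" "upper 0 \<inter> (upper 1)\<inverse> = {}"
    by (auto simp: upper_def)
  then have 2: "killing UNIV x y = killing (upper 0) x y + killing ((upper 1)\<inverse>) x y" using un by metis
  have "killing ((upper 1)\<inverse>) x y = (\<Sum>(i, j)\<in>upper 1. F j i)"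
    unfolding kF by (rule sum.reindex_bij_witness[of _ "\<lambda>(i, j). (j, i)" "\<lambda>(i, j). (j, i)"]) auto
  then have "killing (upper 1) x y - killing ((upper 1)\<inverse>) x y = (\<Sum>(i, j)\<in>upper 1. ?c i - ?c j)"
    unfolding kF sum_subtractf[symmetric]
    by (simp add: case_prod_unfold F_def bracket_def algebra_simps flip: sum_subtractf)
  also have "\<dots> = (\<Sum>(i, j)\<in>upper 1. ?c i) - (\<Sum>(i, j)\<in>upper 1. ?c j)"
    by (simp add: case_prod_unfold sum_subtractf)
  also have "(\<Sum>(i, j)\<in>upper 1. ?c i) = (\<Sum>i\<in>UNIV. of_nat (card {j. b i + 1 \<le> b j}) * ?c i)"
    unfolding upper_def sum_split_pairs by simp
  also have "\<dots> = 0" by (rule sum_over_blocks[OF block_trace_bracket[OF x y]])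
  also have "(\<Sum>(i, j)\<in>upper 1. ?c j) = (\<Sum>(j, i)\<in>(upper 1)\<inverse>. ?c j)"
    by (rule sum.reindex_bij_witness[of _ "\<lambda>(i, j). (j, i)" "\<lambda>(i, j). (j, i)"]) auto
  also have "(\<Sum>(j, i)\<in>(upper 1)\<inverse>. ?c j) = (\<Sum>j\<in>UNIV. of_nat (card {i. b i + 1 \<le> b j}) * ?c j)"
    unfolding upper_def converse_unfold mem_Collect_eq case_prod_conv sum_split_pairs by simp
  also have "\<dots> = 0" by (rule sum_over_blocks[OF block_trace_bracket[OF x y]])
  finally show ?thesis using 1 2 by simp
qed

text \<open>
  The block-triangular algebra knows the trace form of \<open>sl\<close>: it is a combination of the Killing
  form of that algebra and the Killing form of its block-diagonal part.
\<close>

lemma trace_form_eq_killing: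
  fixes x y :: "('f::field, 'n) sqmat"
  assumes "x \<in> \<U> 0" "y \<in> \<U> 0"
  shows "2 * of_nat CARD('n) * trace (x ** y) = 2 * killing (upper 0) x y - killing (diagonal 0) x y"
  using two_killing_upper[of x y] assms sl_on_trace[OF assms(1)] by (simp add: sl_on_def killing_UNIV)

lemma killing_diagonal:
  fixes x y :: "('f::field, 'n) sqmat"
  defines "\<beta> \<equiv> \<lambda>i. of_nat (card {j. b j = b i})"
  shows "killing (diagonal 0) x y =
    (\<Sum>i\<in>UNIV. \<beta> i * ((x ** y) $ i $ i + (y ** x) $ i $ i)) - 2 * (\<Sum>i\<in>UNIV. x $ i $ i * (\<Sum>j | b j = b i. y $ j $ j))"
proof -
  have sw: "(\<Sum>i\<in>UNIV. \<Sum>j | b j = b i. h i j) = (\<Sum>j\<in>UNIV. \<Sum>i | b i = b j. h i j)"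
    for h :: "'n \<Rightarrow> 'n \<Rightarrow> 'f"
    using sum.swap_restrict[of "UNIV :: 'n set" "UNIV :: 'n set" h "\<lambda>i j. b j = b i"] by (simp add: eq_commute)
  have "killing (diagonal 0) x y = (\<Sum>i\<in>UNIV. \<Sum>j | b j = b i.
      (x ** y) $ i $ i + (y ** x) $ j $ j - x $ i $ i * y $ j $ j - y $ i $ i * x $ j $ j)"
    unfolding killing_def diagonal_def sum_split_pairs by simp
  also have "\<dots> = (\<Sum>i\<in>UNIV. \<Sum>j | b j = b i. (x ** y) $ i $ i) + (\<Sum>i\<in>UNIV. \<Sum>j | b j = b i. (y ** x) $ j $ j)
      - (\<Sum>i\<in>UNIV. \<Sum>j | b j = b i. x $ i $ i * y $ j $ j) - (\<Sum>i\<in>UNIV. \<Sum>j | b j = b i. y $ i $ i * x $ j $ j)"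
    by (simp add: sum.distrib sum_subtractf)
  also have "(\<Sum>i\<in>UNIV. \<Sum>j | b j = b i. (y ** x) $ j $ j) = (\<Sum>j\<in>UNIV. \<Sum>i | b i = b j. (y ** x) $ j $ j)"
    by (rule sw)
  also have "(\<Sum>i\<in>UNIV. \<Sum>j | b j = b i. y $ i $ i * x $ j $ j) = (\<Sum>j\<in>UNIV. \<Sum>i | b i = b j. y $ i $ i * x $ j $ j)"
    by (rule sw)
  finally show ?thesis
    by (simp add: \<beta>_def sum_distrib_left sum.distrib algebra_simps)
qed

text \<open>
  Let \<open>\<beta>\<close> be the size of a block and \<open>n\<close> the size of the matrices. Pairing \<open>x\<close> with \<open>munit k l\<close> or with
  \<open>munit k k - munit l l\<close> inside the block gives the entry \<open>(l, k)\<close> or the difference of the diagonal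
  entries, each multiplied by \<open>n + \<beta>\<close>, which is not zero. So an element of the radical is scalar on
  each block, and comparing blocks then gives equal scalars, which vanish because the trace does.
\<close>

lemma killing_radical:
  fixes x :: "('f::field_char_0, 'n) sqmat"
  assumes x: "x \<in> \<U> 0"
  shows "x \<in> \<U> 1 \<longleftrightarrow> (\<forall>y\<in>\<U> 0. killing (upper 0) x y = 0)"
proof
  assume x1: "x \<in> \<U> 1"
  show "\<forall>y\<in>\<U> 0. killing (upper 0) x y = 0"
  proof
    fix y :: "('f, 'n) sqmat" assume y: "y \<in> \<U> 0"
    have "x ** y \<in> supported (upper 1)" "y ** x \<in> supported (upper 1)"
      using mult_supported[OF _ _ upper_comp, of x 1 y 0] mult_supported[OF _ _ upper_comp, of y 0 x 1] x1 y
      by (auto simp: sl_on_def)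
    moreover have "(i, i) \<notin> upper 1" for i by (simp add: upper_def)
    ultimately have "(x ** y) $ i $ i = 0" "(y ** x) $ i $ i = 0" "x $ i $ i = 0" for i
      using supportedD sl_onD[OF x1] by blast+
    then show "killing (upper 0) x y = 0" by (simp add: killing_def)
  qed
next
  assume rad: "\<forall>y\<in>\<U> 0. killing (upper 0) x y = 0"
  define \<beta> :: "'n \<Rightarrow> 'f" where "\<beta> i = of_nat (card {j. b j = b i})" for i
  have \<beta>: "of_nat CARD('n) + \<beta> i \<noteq> 0" for i
    unfolding \<beta>_def of_nat_add[symmetric] of_nat_eq_0_iff by simp
  have two\<beta>: "z = 0" if "2 * (of_nat CARD('n) + \<beta> i) * z = 0" for i z
    using that \<beta>[of i] unfolding mult_eq_0_iff by simp
  have \<beta>eq: "\<beta> i = \<beta> j" if "b i = b j" for i j using that by (simp add: \<beta>_def)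
  have form: "2 * of_nat CARD('n) * trace (x ** y) + killing (diagonal 0) x y = 0"
    if "y \<in> \<U> 0" for y
    using trace_form_eq_killing[OF x that] rad that by simp
  have off: "x $ l $ k = 0" if kl: "k \<noteq> l" "b k = b l" for k l
  proof -
    let ?y = "munit k l :: ('f, 'n) sqmat"
    have "?y \<in> \<U> 0" using kl by (intro munit_sl_on) (auto simp: upper_def)
    note form[OF this]
    moreover have "killing (diagonal 0) x ?y = 2 * \<beta> l * x $ l $ k"
    proof -
      have "(\<Sum>j | b j = b i. ?y $ j $ j) = 0" for i using kl by (intro sum.neutral) auto
      moreover have "(\<Sum>i\<in>UNIV. \<beta> i * ((x ** ?y) $ i $ i + (?y ** x) $ i $ i)) = (\<beta> l + \<beta> k) * x $ l $ k"
        by (simp add: mult_munit_nth distrib_left distrib_right sum.distrib if_distrib[of "\<lambda>a. _ * a"] cong: if_cong)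
      ultimately show ?thesis using \<beta>eq[OF kl(2)] by (simp add: killing_diagonal \<beta>_def[symmetric])
    qed
    ultimately have "2 * (of_nat CARD('n) + \<beta> l) * x $ l $ k = 0" by (simp add: algebra_simps)
    then show ?thesis by (rule two\<beta>)
  qed
  define \<sigma> where "\<sigma> k l = (\<Sum>i\<in>UNIV. x $ i $ i * ((if b k = b i then 1 else 0) - (if b l = b i then 1 else 0)))" for k l
  have form_diag: "2 * of_nat CARD('n) * (x $ k $ k - x $ l $ l) + 2 * (\<beta> k * x $ k $ k - \<beta> l * x $ l $ l)
      - 2 * \<sigma> k l = 0" for k l
  proof -
    let ?y = "munit k k - munit l l :: ('f, 'n) sqmat"
    have "?y \<in> \<U> 0" by (intro munit_diff_sl_on) (auto simp: upper_def)
    note form[OF this]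
    moreover have "killing (diagonal 0) x ?y = 2 * (\<beta> k * x $ k $ k - \<beta> l * x $ l $ l)
       - 2 * \<sigma> k l"
    proof -
      have "(\<Sum>j | b j = b i. ?y $ j $ j) = (if b k = b i then 1 else 0) - (if b l = b i then 1 else 0)" for i
        by (simp add: sum_subtractf)
      moreover have "(\<Sum>i\<in>UNIV. \<beta> i * ((x ** ?y) $ i $ i + (?y ** x) $ i $ i)) = 2 * (\<beta> k * x $ k $ k - \<beta> l * x $ l $ l)"
        by (simp add: mult_diff_mat mult_munit_nth distrib_left right_diff_distrib sum.distrib sum_subtractf
          if_distrib[of "\<lambda>a. _ * a"] cong: if_cong)
      ultimately show ?thesis by (simp add: killing_diagonal \<beta>_def[symmetric] \<sigma>_def)
    qed
    ultimately show ?thesis by (simp add: mult_diff_mat trace_sub diff_eq_eq add_eq_0_iff)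
  qed
  have same: "x $ k $ k = x $ l $ l" if kl: "b k = b l" for k l
  proof -
    have "2 * (of_nat CARD('n) + \<beta> l) * (x $ k $ k - x $ l $ l) = 0"
      using form_diag[of k l] kl \<beta>eq[OF kl] by (simp add: \<sigma>_def algebra_simps)
    then have "x $ k $ k - x $ l $ l = 0" by (rule two\<beta>)
    then show ?thesis by simp
  qed
  have scalar: "x $ k $ k = x $ l $ l" for k l
  proof -
    have sumblock: "(\<Sum>i\<in>UNIV. x $ i $ i * (if b k = b i then 1 else 0)) = \<beta> k * x $ k $ k" for k
    proof -
      have "(\<Sum>i\<in>UNIV. x $ i $ i * (if b k = b i then 1 else 0)) = (\<Sum>i | b i = b k. x $ i $ i)"
        by (rule sum.mono_neutral_cong_right) auto
      also have "\<dots> = (\<Sum>i | b i = b k. x $ k $ k)" by (intro sum.cong refl same) simp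
      finally show ?thesis by (simp add: \<beta>_def)
    qed
    have "\<sigma> k l =
        \<beta> k * x $ k $ k - \<beta> l * x $ l $ l"
      unfolding \<sigma>_def right_diff_distrib sum_subtractf sumblock ..
    then have "2 * of_nat CARD('n) * (x $ k $ k - x $ l $ l) = 0" using form_diag[of k l] by simp
    then show ?thesis by simp
  qed
  have "trace x = of_nat CARD('n) * x $ k $ k" for k
  proof -
    have "trace x = (\<Sum>i\<in>(UNIV :: 'n set). x $ k $ k)" unfolding trace_def by (intro sum.cong refl scalar)
    then show ?thesis by simp
  qed
  then have "x $ k $ k = 0" for k using sl_on_trace[OF x] by simp
  then have "x $ i $ j = 0" if "(i, j) \<notin> upper 1" for i j
  proof (cases "(i, j) \<in> upper 0")
    case True
    then have "b j = b i" using that by (auto simp: upper_def)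
    then show ?thesis using off[of j i] \<open>\<And>k. x $ k $ k = 0\<close> by (cases "i = j") simp_all
  qed (rule sl_onD[OF x])
  then show "x \<in> \<U> 1" using x by (auto simp: sl_on_def supported_def)
qed

end

section \<open>The degree element\<close>

context blocks
begin

text \<open>
  The grading element of the block-diagonal grading: \<open>ad deg_elt\<close> multiplies the \<open>m\<close>-th
  block-diagonal by \<open>m\<close>. The constant makes the trace zero.
\<close>

definition deg_elt :: "('f::field, 'n) sqmat" where
  "deg_elt = (\<chi> i j. if i = j then (\<Sum>k\<in>UNIV. of_nat (b k)) / of_nat CARD('n) - of_nat (b i) else 0)"

definition diag_part :: "int \<Rightarrow> ('f::field, 'n) sqmat \<Rightarrow> ('f, 'n) sqmat" where
  "diag_part m x = (\<chi> i j. if (i, j) \<in> diagonal m then x $ i $ j else 0)"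

lemma deg_elt_in: "deg_elt \<in> (\<D> 0 :: ('f::field_char_0, 'n) sqmat set)"
  by (auto simp: deg_elt_def sl_on_def supported_def sl_def diagonal_def trace_def sum_subtractf)

lemma bracket_deg_elt: "bracket deg_elt x $ i $ j = (of_int (int (b j) - int (b i)) :: 'f::field) * x $ i $ j"
proof -
  have "(deg_elt ** x) $ i $ j = (\<Sum>k\<in>UNIV. if k = i then (deg_elt :: ('f, 'n) sqmat) $ i $ i * x $ i $ j else 0)"
    unfolding mat_mult_nth by (rule sum.cong) (auto simp: deg_elt_def)
  moreover have "(x ** deg_elt) $ i $ j = (\<Sum>k\<in>UNIV. if k = j then x $ i $ j * (deg_elt :: ('f, 'n) sqmat) $ j $ j else 0)"
    unfolding mat_mult_nth by (rule sum.cong) (auto simp: deg_elt_def)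
  ultimately show ?thesis
    by (simp add: bracket_def) (simp add: deg_elt_def algebra_simps)
qed

lemma bracket_deg_elt_diagonal:
  "x \<in> \<D> m \<Longrightarrow> bracket deg_elt x = mat_smult (of_int m) (x :: ('f::field, 'n) sqmat)"
proof (rule mat_eqI)
  fix i j assume x: "x \<in> \<D> m"
  show "bracket deg_elt x $ i $ j = mat_smult (of_int m) x $ i $ j"
  proof (cases "(i, j) \<in> diagonal m")
    case True
    then have "int (b j) - int (b i) = m" by (simp add: diagonal_def)
    then show ?thesis by (metis bracket_deg_elt mat_smult_nth)
  qed (simp add: bracket_deg_elt sl_onD[OF x])
qed

lemma diagonal_eigenvector:
  fixes x :: "('f::field_char_0, 'n) sqmat"
  assumes "bracket deg_elt x = mat_smult (of_int m) x" "x \<in> sl"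
  shows "x \<in> \<D> m"
proof -
  have "x $ i $ j = 0" if "(i, j) \<notin> diagonal m" for i j
  proof -
    have "mat_smult (of_int m) x $ i $ j = of_int (int (b j) - int (b i)) * x $ i $ j"
      unfolding assms(1)[symmetric] by (rule bracket_deg_elt)
    moreover have "(of_int (int (b j) - int (b i)) :: 'f) \<noteq> of_int m"
      using that unfolding of_int_eq_iff diagonal_def by auto
    ultimately show ?thesis by (metis mat_smult_nth mult_cancel_right)
  qed
  then show ?thesis using assms(2) by (auto simp: sl_on_def supported_def)
qed

lemma diag_part_add: "diag_part m (x + y) = diag_part m x + diag_part m y"
  and diag_part_smult: "diag_part m (mat_smult c x) = mat_smult c (diag_part m x)"
  and diag_part_zero [simp]: "diag_part m 0 = 0"
  by (auto simp: diag_part_def vec_eq_iff)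

lemma diag_part_sum: "diag_part m (\<Sum>a\<in>S. f a) = (\<Sum>a\<in>S. diag_part m (f a))"
  by (induction S rule: infinite_finite_induct) (simp_all add: diag_part_add)

lemma diag_part_in:
  fixes x :: "('f::field, 'n) sqmat"
  assumes "x \<in> sl_on K"
  shows "diag_part m x \<in> sl_on (K \<inter> diagonal m)"
proof -
  have "trace (diag_part m x) = (if m = 0 then trace x else 0)"
    by (auto simp: trace_def diag_part_def diagonal_def)
  then have "trace (diag_part m x) = 0" using sl_on_trace[OF assms] by simp
  then show ?thesis using assms by (auto simp: sl_on_def supported_def sl_def diag_part_def)
qed

lemma diag_part_in_diagonal: "x \<in> sl_on K \<Longrightarrow> diag_part m x \<in> \<D> m"
  using diag_part_in[of x K m] sl_on_mono[of "K \<inter> diagonal m" "diagonal m"] by blast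

lemma diag_part_in_same: "x \<in> sl_on K \<Longrightarrow> diag_part m x \<in> sl_on K"
  using diag_part_in[of x K m] sl_on_mono[of "K \<inter> diagonal m" K] by blast

lemma diag_part_homogeneous: "x \<in> \<D> m \<Longrightarrow> diag_part k x = (if k = m then x else 0)"
proof (rule mat_eqI)
  fix i j assume x: "x \<in> \<D> m"
  have "(i, j) \<notin> diagonal k \<or> (i, j) \<notin> diagonal m" if "k \<noteq> m" using that by (auto simp: diagonal_def)
  then show "diag_part k x $ i $ j = (if k = m then x else 0) $ i $ j"
    using sl_onD[OF x, of i j] by (auto simp: diag_part_def)
qed

lemma sum_diag_part: "(\<Sum>m\<in>{- int s..int s}. diag_part m x) = x"
proof (rule mat_eqI)
  fix i j
  have "(\<Sum>m\<in>{- int s..int s}. diag_part m x) $ i $ j =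
    (\<Sum>m\<in>{- int s..int s}. if m = int (b j) - int (b i) then x $ i $ j else 0)"
    unfolding sum_component by (rule sum.cong) (auto simp: diag_part_def diagonal_def)
  then show "(\<Sum>m\<in>{- int s..int s}. diag_part m x) $ i $ j = x $ i $ j"
    using b_less[of i] b_less[of j] by simp
qed

lemma diag_part_eqI: "(\<And>m. diag_part m x = diag_part m y) \<Longrightarrow> x = y"
  by (metis (no_types, lifting) sum.cong sum_diag_part)

text \<open>
  The block-diagonals are the eigenspaces of \<open>ad deg_elt\<close>, with distinct integers as eigenvalues. An
  operator of degree zero maps each component of an eigenvector to the same multiple of itself.
\<close>

lemma component_diag_part:
  fixes B :: "'g::ab_group_add \<Rightarrow> ('f::field_char_0, 'n) sqmat set"
  assumes B: "is_grading (sl_on K) B" and d: "deg_elt \<in> B 0" and x: "x \<in> sl_on K"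
  shows "component B (diag_part m x) h = diag_part m (component B x h)"
proof -
  note L = subspace_sl_on[of K]
  have sl: "sl_on K \<subseteq> sl" by (simp add: sl_on_def)
  have cL: "component B u h \<in> sl_on K" if "u \<in> sl_on K" for u h
    using component_spec(1)[OF B that] grading_subset[OF B] by blast
  have pL: "diag_part k x \<in> sl_on K" for k by (rule diag_part_in_same[OF x])
  have c: "component B (diag_part k x) h \<in> \<D> k" for k h
  proof (rule diagonal_eigenvector)
    have e: "bracket (diag_part k x) deg_elt = mat_smult (- of_int k) (diag_part k x)"
      using bracket_antisym[of "diag_part k x"] bracket_deg_elt_diagonal[OF diag_part_in_diagonal[OF x]] by simp
    have "bracket (component B (diag_part k x) h) deg_elt = component B (bracket (diag_part k x) deg_elt) (h + 0)"
      by (rule component_bracket[OF B L pL d, symmetric]) (simp only: e mats.subspace_scale[OF L pL])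
    also have "\<dots> = mat_smult (- of_int k) (component B (diag_part k x) h)"
      unfolding e by (simp only: add_0_right component_smult[OF B L pL])
    finally show "bracket deg_elt (component B (diag_part k x) h) = mat_smult (of_int k) (component B (diag_part k x) h)"
      using bracket_antisym[of deg_elt "component B (diag_part k x) h"] by simp
  qed (use cL[OF pL] sl in blast)
  have "component B x h = (\<Sum>k\<in>{- int s..int s}. component B (diag_part k x) h)"
    using component_sum[OF B L, of "{- int s..int s}" "\<lambda>k. diag_part k x" h] pL by (simp add: sum_diag_part)
  then have "diag_part m (component B x h) = (\<Sum>k\<in>{- int s..int s}. diag_part m (component B (diag_part k x) h))"
    by (simp add: diag_part_sum)
  also have "\<dots> = (\<Sum>k\<in>{- int s..int s}. if k = m then component B (diag_part m x) h else 0)"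
    by (rule sum.cong) (auto simp: diag_part_homogeneous[OF c])
  also have "\<dots> = component B (diag_part m x) h"
  proof (cases "m \<in> {- int s..int s}")
    case False
    then have "(i, j) \<notin> diagonal m" for i j
      using b_less[of i] b_less[of j] by (auto simp: diagonal_def)
    then have "diag_part m x = 0" by (simp add: diag_part_def vec_eq_iff)
    then show ?thesis using False component_smult[OF B L mats.subspace_0[OF L], of 0 h] by simp
  qed simp
  finally show ?thesis by simp
qed

lemma diag_part_in_component:
  fixes B :: "'g::ab_group_add \<Rightarrow> ('f::field_char_0, 'n) sqmat set"
  assumes B: "is_grading (sl_on K) B" and d: "deg_elt \<in> B 0" and x: "x \<in> B g"
  shows "diag_part m x \<in> B g"
proof -
  have xL: "x \<in> sl_on K" using x grading_subset[OF B] by blast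
  show ?thesis
    by (rule homogeneousI[OF B diag_part_in_same[OF xL]])
      (simp add: component_diag_part[OF B d xL] component_homogeneous[OF B x])
qed

text \<open>
  These matrices form the radical of the Killing form, which pairs components of opposite degrees
  only.
\<close>

lemma upper_1_graded:
  fixes B :: "'g::ab_group_add \<Rightarrow> ('f::field_char_0, 'n) sqmat set"
  assumes B: "is_grading (\<U> 0) B" and x: "x \<in> \<U> 1"
  shows "component B x g \<in> \<U> 1"
proof -
  have xP: "x \<in> \<U> 0" using x sl_on_upper_1 by blast
  note c = component_spec[OF B xP]
  have cP: "component B x g \<in> \<U> 0" for g using c(1) grading_subset[OF B] by blast
  note kg = killing_graded[OF upper_0_refl upper_0_trans B]
  have "killing (upper 0) (component B x g) y = 0" if y: "y \<in> \<U> 0" for y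
  proof (rule component_induct[OF B y])
    fix h
    let ?y = "component B y h"
    have yh: "?y \<in> B h" by (rule component_spec(1)[OF B y])
    show "killing (upper 0) (component B x g) ?y = 0"
    proof (cases "g + h = 0")
      case True
      have "killing (upper 0) x ?y = killing (upper 0) (component B x g) ?y"
        by (rule functional_component[OF B subspace_sl_on xP])
          (use True in \<open>auto simp: killing_add add_eq_0_iff2 intro!: kg[OF _ yh]\<close>)
      moreover have "killing (upper 0) x ?y = 0"
        using killing_radical[OF xP] x yh grading_subset[OF B] by force
      ultimately show ?thesis by simp
    qed (rule kg[OF c(1) yh])
  qed (simp_all add: killing_add)
  then show ?thesis using killing_radical[OF cP] by blast
qed

lemma bracket_P: "x \<in> \<U> 0 \<Longrightarrow> y \<in> \<U> 0 \<Longrightarrow> bracket x y \<in> \<U> 0"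
  using bracket_upper[of x 0 y 0] by simp

text \<open>
  These matrices form the square of the radical, so they are spanned by brackets of homogeneous
  elements of the radical.
\<close>

lemma upper_2_graded:
  fixes B :: "'g::ab_group_add \<Rightarrow> ('f::field_char_0, 'n) sqmat set"
  assumes B: "is_grading (\<U> 0) B" and x: "x \<in> \<U> 2"
  shows "component B x g \<in> \<U> 2"
proof -
  note L = subspace_sl_on[of "upper 0"]
  have irrefl: "Id \<inter> upper 2 = {}" by (auto simp: upper_def)
  have "x \<in> \<U> 0 \<and> component B x g \<in> \<U> 2"
    using x irrefl
  proof (induction rule: supported_bracket_induct[where I = "upper 1" and I' = "upper 1"])
    case (factor i j)
    then obtain k where "b k = b i + 1" using ex_block[of "b i + 1"] b_less[of j] by (auto simp: upper_def)
    then show ?case using factor by (intro exI[of _ k]) (auto simp: upper_def)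
  next
    case zero
    show ?case using component_smult[OF B L mats.subspace_0[OF L], of 0 g] mats.subspace_0[OF L]
      by (simp add: sl_on_zero)
  next
    case (add u v)
    then show ?case by (simp add: component_add[OF B L] sl_on_add)
  next
    case (bracket y z)
    then have yz: "y \<in> \<U> 0" "z \<in> \<U> 0" using sl_on_upper_1 by blast+
    have N2: "bracket u v \<in> \<U> 2" if "u \<in> \<U> 1" "v \<in> \<U> 1" for u v :: "('f, 'n) sqmat"
      using bracket_upper[OF that] by (simp add: numeral_2_eq_2)
    have "component B (bracket y z) g =
        (\<Sum>h | component B z h \<noteq> 0. bracket (component B y (g - h)) (component B z h))"
      by (rule component_bracket_sum[OF B L yz]) (rule bracket_P)
    also have "\<dots> \<in> \<U> 2"
      by (intro sl_on_sum N2 upper_1_graded[OF B] bracket)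
    finally show ?case using bracket_P[OF yz] by simp
  qed
  then show ?thesis ..
qed

text \<open>
  An element that acts as zero on the quotient by the radical is a scalar on each block, up to the
  radical; if it also acts as zero on the radical modulo its square, then the scalars of adjacent
  blocks agree. A traceless scalar matrix is zero.
\<close>

lemma strictly_upperI:
  fixes e :: "('f::field_char_0, 'n) sqmat"
  assumes e: "e \<in> \<U> 0" and 1: "\<And>y. y \<in> \<U> 0 \<Longrightarrow> bracket e y \<in> \<U> 1"
    and 2: "\<And>y. y \<in> \<U> 1 \<Longrightarrow> bracket e y \<in> \<U> 2"
  shows "e \<in> \<U> 1"
proof -
  have off: "e $ k $ i = 0" if "i \<noteq> k" "b i = b k" for i k
  proof -
    have "bracket e (munit i k) \<in> \<U> 1" using that by (intro 1 munit_sl_on) (auto simp: upper_def)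
    then have "bracket e (munit i k) $ k $ k = 0" by (rule sl_onD) (simp add: upper_def)
    then show ?thesis using that by (simp add: bracket_def mult_munit_nth)
  qed
  have adj: "e $ i $ i = e $ j $ j" if "b j = b i \<or> b j = b i + 1" for i j
  proof (cases "i = j")
    case False
    have "bracket e (munit i j) $ i $ j = 0"
    proof (cases "b j = b i")
      case True
      then have "bracket e (munit i j) \<in> \<U> 1" using False by (intro 1 munit_sl_on) (auto simp: upper_def)
      then show ?thesis by (rule sl_onD) (simp add: upper_def True)
    next
      case neq: False
      then have "bracket e (munit i j) \<in> \<U> 2" using False that by (intro 2 munit_sl_on) (auto simp: upper_def)
      then show ?thesis by (rule sl_onD) (use neq that in \<open>simp add: upper_def\<close>)
    qed
    then show ?thesis by (simp add: bracket_def mult_munit_nth)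
  qed simp
  obtain i0 where i0: "b i0 = 0" using ex_block[of 0] b_less by fastforce
  have diag: "\<forall>j. b j = q \<longrightarrow> e $ j $ j = e $ i0 $ i0" for q
  proof (induction q)
    case 0
    show ?case
    proof (intro allI impI)
      fix j assume "b j = 0"
      then have "b j = b i0 \<or> b j = b i0 + 1" using i0 by simp
      then show "e $ j $ j = e $ i0 $ i0" using adj by metis
    qed
  next
    case (Suc q)
    show ?case
    proof (intro allI impI)
      fix j assume j: "b j = Suc q"
      then obtain i where "b i = q" using ex_block[of q] b_less[of j] by auto
      then show "e $ j $ j = e $ i0 $ i0" using Suc adj[of j i] j by simp
    qed
  qed
  then have "trace e = (\<Sum>j\<in>(UNIV :: 'n set). e $ i0 $ i0)" unfolding trace_def using diag by (intro sum.cong refl) blast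
  then have "e $ i0 $ i0 = 0" using sl_on_trace[OF e] by simp
  then have "e $ k $ k = 0" for k using diag[of "b k"] by simp
  then have "e $ i $ j = 0" if "(i, j) \<notin> upper 1" for i j
  proof (cases "(i, j) \<in> upper 0")
    case True
    then have "b j = b i" using that by (auto simp: upper_def)
    then show ?thesis using off[of j i] \<open>\<And>k. e $ k $ k = 0\<close> by (cases "i = j") simp_all
  qed (rule sl_onD[OF e])
  then show ?thesis using e by (auto simp: sl_on_def supported_def)
qed

text \<open>
  Let \<open>N\<close> be the radical. Then \<open>ad deg_elt\<close> acts as 0 on the quotient by \<open>N\<close> and as 1 on \<open>N/N\<^sup>2\<close>.
  These spaces are graded and scalars are operators of degree zero, so every component of \<open>deg_elt\<close>
  of nonzero degree acts as zero on both and therefore lies in \<open>N\<close>.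
\<close>

lemma deg_elt_component:
  fixes B :: "'g::ab_group_add \<Rightarrow> ('f::field_char_0, 'n) sqmat set"
  assumes B: "is_grading (\<U> 0) B"
  shows "component B deg_elt 0 - deg_elt \<in> \<U> 1"
proof -
  note L = subspace_sl_on[of "upper 0"]
  have dP: "deg_elt \<in> (\<U> 0 :: ('f, 'n) sqmat set)"
    using deg_elt_in sl_on_mono[OF diagonal_upper[of 0 0]] by auto
  note c = component_spec[OF B dP]
  have cP: "component B deg_elt g \<in> \<U> 0" for g using c(1) grading_subset[OF B] by blast
  \<comment> \<open>\<open>ad deg_elt\<close> is 0 modulo the radical, and 1 on the radical modulo its square.\<close>
  have d1: "bracket deg_elt y \<in> \<U> 1" if "y \<in> \<U> 0" for y :: "('f, 'n) sqmat"
  proof -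
    have "bracket deg_elt y $ i $ j = 0" if "(i, j) \<notin> upper 1" for i j
    proof (cases "b j = b i")
      case False
      then have "(i, j) \<notin> upper 0" using that by (auto simp: upper_def)
      then show ?thesis using sl_onD[OF \<open>y \<in> \<U> 0\<close>] by (simp add: bracket_deg_elt)
    qed (simp add: bracket_deg_elt)
    then show ?thesis by (simp add: sl_on_def supported_def sl_def)
  qed
  have d2: "bracket deg_elt y - y \<in> \<U> 2" if "y \<in> \<U> 1" for y :: "('f, 'n) sqmat"
  proof -
    have "(bracket deg_elt y - y) $ i $ j = 0" if "(i, j) \<notin> upper 2" for i j
    proof (cases "b j = b i + 1")
      case False
      then have "(i, j) \<notin> upper 1" using that by (auto simp: upper_def)
      then show ?thesis using sl_onD[OF \<open>y \<in> \<U> 1\<close>] by (simp add: bracket_deg_elt)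
    qed (simp add: bracket_deg_elt)
    then show ?thesis using sl_on_trace[OF that] by (simp add: sl_on_def supported_def sl_def trace_sub)
  qed
  have e: "component B deg_elt g \<in> \<U> 1" if g: "g \<noteq> 0" for g
  proof (rule strictly_upperI[OF cP])
    fix y :: "('f, 'n) sqmat"
    have c1: "bracket (component B deg_elt g) (component B y h) = component B (bracket deg_elt (component B y h)) (g + h)"
      if "y \<in> \<U> 0" for h
      using component_bracket[OF B L dP component_spec(1)[OF B that]] component_spec(1)[OF B that] grading_subset[OF B]
        bracket_P[OF dP] by (metis subsetD)
    show "bracket (component B deg_elt g) y \<in> \<U> 1" if y: "y \<in> \<U> 0"
    proof (rule component_induct[OF B y])
      fix h
      have "component B y h \<in> \<U> 0" using component_spec(1)[OF B y] grading_subset[OF B] by blast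
      then show "bracket (component B deg_elt g) (component B y h) \<in> \<U> 1"
        unfolding c1[OF y] by (intro upper_1_graded[OF B] d1)
    qed (simp_all add: bracket_linear sl_on_zero sl_on_add)
    show "bracket (component B deg_elt g) y \<in> \<U> 2" if y: "y \<in> \<U> 1"
    proof -
      have yP: "y \<in> \<U> 0" using y sl_on_upper_1 by blast
      show ?thesis
      proof (rule component_induct[OF B yP])
        fix h
        let ?y = "component B y h"
        have y1: "?y \<in> \<U> 1" by (rule upper_1_graded[OF B y])
        then have y0: "?y \<in> \<U> 0" using sl_on_upper_1 by blast
        have yh: "?y \<in> B h" by (rule component_spec(1)[OF B yP])
        have "component B (bracket deg_elt ?y - ?y) (g + h) = bracket (component B deg_elt g) ?y"
          using g by (simp add: component_diff[OF B L bracket_P[OF dP y0] y0] c1[OF yP]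
            component_homogeneous[OF B yh])
        then show "bracket (component B deg_elt g) ?y \<in> \<U> 2"
          using upper_2_graded[OF B d2[OF y1]] by metis
      qed (simp_all add: bracket_linear sl_on_zero sl_on_add)
    qed
  qed
  let ?S = "insert 0 {g. component B deg_elt g \<noteq> 0}"
  have "deg_elt = (\<Sum>g | component B deg_elt g \<noteq> 0. component B deg_elt g)" by (rule c(3)[symmetric])
  also have "\<dots> = (\<Sum>g\<in>?S. component B deg_elt g)" by (rule sum_support) (use c(2) in auto)
  also have "\<dots> = component B deg_elt 0 + (\<Sum>g\<in>?S - {0}. component B deg_elt g)"
    using c(2) by (intro sum.remove) auto
  finally have "component B deg_elt 0 - deg_elt = - (\<Sum>g\<in>?S - {0}. component B deg_elt g)"
    by (simp add: algebra_simps)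
  then show ?thesis
    using e by (auto intro!: sl_on_neg sl_on_sum)
qed

end

section \<open>Extending brackets to negative degrees\<close>

text \<open>
  A \<open>\<int>\<close>-graded Lie algebra \<open>V\<close> with an invariant form is given, and subspaces \<open>C m g\<close> of \<open>V m\<close> that
  are closed under brackets as long as \<open>m \<ge> 0\<close>. In nonpositive degrees they are annihilators: \<open>C m g\<close>
  is orthogonal to \<open>C (- m) h\<close> whenever \<open>g + h \<in> Z\<close>. Invariance of the form moves a bracket of total
  degree at most 0 to one of nonnegative degree, where closure is known. A bracket of \<open>x\<close> of
  negative degree with \<open>y\<close> of large positive degree is out of reach of this argument; there \<open>y\<close> is
  a sum of brackets of elements of degree 1 with elements of lower positive degree, and the Jacobi
  identity gives an induction on the degree of \<open>y\<close>.

  With the nonzero degrees as \<open>Z\<close> this extends gradings, and with \<open>Z\<close> the whole group it extends the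
  graph of an automorphism.
\<close>

lemma bracket_closed_extension:
  fixes br :: "'a::ab_group_add \<Rightarrow> 'a \<Rightarrow> 'a" and form :: "'a \<Rightarrow> 'a \<Rightarrow> 'b::zero"
    and V :: "int \<Rightarrow> 'a set" and C :: "int \<Rightarrow> 'g::ab_group_add \<Rightarrow> 'a set" and Z :: "'g set"
  assumes add: "\<And>x y z. br x (y + z) = br x y + br x z"
    and anti: "\<And>x y. br x y = - br y x"
    and jacobi: "\<And>x y z. br x (br y z) = br (br x y) z + br y (br x z)"
    and inv: "\<And>x y z. form (br x y) z = form x (br y z)"
    and V: "\<And>x y m m'. x \<in> V m \<Longrightarrow> y \<in> V m' \<Longrightarrow> br x y \<in> V (m + m')"
    and CV: "\<And>x m g. x \<in> C m g \<Longrightarrow> x \<in> V m"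
    and C0: "\<And>m g. 0 \<in> C m g" and Cadd: "\<And>x y m g. x \<in> C m g \<Longrightarrow> y \<in> C m g \<Longrightarrow> x + y \<in> C m g"
    and Cminus: "\<And>x m g. x \<in> C m g \<Longrightarrow> - x \<in> C m g"
    and pos: "\<And>x y m m' g g'. 0 \<le> m \<Longrightarrow> 0 \<le> m' \<Longrightarrow> x \<in> C m g \<Longrightarrow> y \<in> C m' g' \<Longrightarrow> br x y \<in> C (m + m') (g + g')"
    and neg: "\<And>x m g. m \<le> 0 \<Longrightarrow> x \<in> C m g \<longleftrightarrow> x \<in> V m \<and> (\<forall>h z. g + h \<in> Z \<longrightarrow> z \<in> C (- m) h \<longrightarrow> form x z = 0)"
    and gen: "\<And>m g w Q. 0 < m \<Longrightarrow> w \<in> C (m + 1) g \<Longrightarrow> Q 0 \<Longrightarrow> (\<And>u v. Q u \<Longrightarrow> Q v \<Longrightarrow> Q (u + v)) \<Longrightarrow>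
      (\<And>a c y z. a + c = g \<Longrightarrow> y \<in> C 1 a \<Longrightarrow> z \<in> C m c \<Longrightarrow> Q (br y z)) \<Longrightarrow> Q w"
    and x: "x \<in> C m g" and y: "y \<in> C m' g'"
  shows "br x y \<in> C (m + m') (g + g')"
proof -
  have br0: "br x 0 = 0" for x using add[of x 0 0] by simp
  have mixed_nonpos: "br x y \<in> C (m + m') (g + g')"
    if "m \<le> 0" "0 \<le> m'" "m + m' \<le> 0" "x \<in> C m g" "y \<in> C m' g'" for x y m m' g g'
    unfolding neg[OF that(3)]
  proof (intro conjI allI impI)
    fix h z assume h: "g + g' + h \<in> Z" and z: "z \<in> C (- (m + m')) h"
    have "br y z \<in> C (m' + - (m + m')) (g' + h)" by (rule pos) (use that z in auto)
    then have "br y z \<in> C (- m) (g' + h)" by simp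
    then have "form x (br y z) = 0"
      using that(4) h unfolding neg[OF that(1)] by (simp add: add.assoc)
    then show "form (br x y) z = 0" by (simp add: inv)
  qed (use V CV that in blast)
  have mixed_pos: "br x y \<in> C (m + int k) (g + g')"
    if "m < 0" "0 < m + int k" "x \<in> C m g" "y \<in> C (int k) g'" for x y m k g g'
    using that
  proof (induction k arbitrary: x y m g g' rule: less_induct)
    case (less k)
    define l where "l = int k - 1"
    have l: "0 < l" "int k = l + 1" using less.prems by (auto simp: l_def)
    have nonneg: "br u v \<in> C (p + l) (a + c)"
      if "p \<le> 0" "0 \<le> p + l" "u \<in> C p a" "v \<in> C l c" for u v p a c
    proof (cases "p = 0")
      case True
      then show ?thesis using pos[of p l u a v c] that l by simp
    next
      case False
      show ?thesis
      proof (cases "p + l = 0")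
        case True
        then show ?thesis using mixed_nonpos[of p l u a v c] that l by simp
      next
        case neq: False
        have "l = int (nat l)" using l by simp
        then show ?thesis using less.IH[of "nat l" p u a v c] that l False neq by simp
      qed
    qed
    have "y \<in> C (l + 1) g'" using less.prems l by simp
    then show ?case
    proof (rule gen[OF l(1)])
      fix a c y' y'' assume a: "a + c = g'" and y': "y' \<in> C 1 a" and y'': "y'' \<in> C l c"
      have "br x y' \<in> C (m + 1) (g + a)"
        by (rule mixed_nonpos) (use less.prems y' in auto)
      then have 1: "br (br x y') y'' \<in> C (m + 1 + l) (g + a + c)"
        by (rule nonneg[rotated 2]) (use less.prems l y'' in auto)
      have "br x y'' \<in> C (m + l) (g + c)"
        by (rule nonneg) (use less.prems l y'' in auto)
      with less.prems l y' have 2: "br y' (br x y'') \<in> C (1 + (m + l)) (a + (g + c))"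
        by (intro pos[of 1 "m + l" y' a]) auto
      have "m + int k = m + 1 + l" "m + int k = 1 + (m + l)" "g + g' = g + a + c" "g + g' = a + (g + c)"
        using l a by (auto simp: algebra_simps)
      then show "br x (br y' y'') \<in> C (m + int k) (g + g')"
        unfolding jacobi[of x y' y''] using 1 2 Cadd by metis
    qed (simp_all add: add br0 C0 Cadd)
  qed
  have mixed: "br x y \<in> C (m + m') (g + g')"
    if "m < 0" "0 \<le> m'" "x \<in> C m g" "y \<in> C m' g'" for x y m m' g g'
  proof (cases "m + m' \<le> 0")
    case True
    then show ?thesis using mixed_nonpos[of m m' x g y g'] that by simp
  next
    case False
    have "m' = int (nat m')" using that by simp
    then show ?thesis using mixed_pos[of m "nat m'" x g y g'] that False by simp
  qed
  consider "0 \<le> m" "0 \<le> m'" | "m < 0" "0 \<le> m'" | "0 \<le> m" "m' < 0" | "m < 0" "m' < 0" by linarith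
  then show ?thesis
  proof cases
    case 3
    have "br y x \<in> C (m' + m) (g' + g)" by (rule mixed) (use 3 x y in auto)
    then have "- br y x \<in> C (m + m') (g + g')" using Cminus by (metis add.commute)
    then show ?thesis using anti[of x y] by simp
  next
    case 4
    have m: "m + m' \<le> 0" using 4 by simp
    show ?thesis
      unfolding neg[OF m]
    proof (intro conjI allI impI)
      fix h z assume h: "g + g' + h \<in> Z" and z: "z \<in> C (- (m + m')) h"
      have "br y z \<in> C (m' + - (m + m')) (g' + h)" by (rule mixed) (use 4 y z in auto)
      then have "br y z \<in> C (- m) (g' + h)" by simp
      moreover have "m \<le> 0" using 4 by simp
      ultimately have "form x (br y z) = 0"
        using x h unfolding neg[OF \<open>m \<le> 0\<close>] by (simp add: add.assoc)
      then show "form (br x y) z = 0" by (simp add: inv)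
    qed (use V CV x y in blast)
  qed (use pos mixed x y in blast)+
qed

section \<open>Normalizing a grading\<close>

context blocks
begin

lemma upper_mult:
  "x \<in> supported (upper k) \<Longrightarrow> y \<in> supported (upper l) \<Longrightarrow> x ** y \<in> supported (upper (k + l))"
  by (rule mult_supported[OF _ _ upper_comp])

lemma supported_upper_mono: "x \<in> supported (upper l) \<Longrightarrow> k \<le> l \<Longrightarrow> x \<in> supported (upper k)"
  by (auto simp: supported_def upper_def)

lemma supported_upper_trivial: "x \<in> supported (upper s) \<Longrightarrow> x = 0"
  using b_less by (auto simp: supported_def upper_def vec_eq_iff) (metis le_add2 leD le_trans)

lemma unipotent_upper:
  fixes u :: "('f::field, 'n) sqmat"
  assumes "u - mat 1 \<in> supported (upper 1)"
  shows "u \<in> supported (upper 0)"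
proof -
  have "(mat 1 :: ('f, 'n) sqmat) \<in> supported (upper 0)" by (auto simp: supported_def upper_def mat_def)
  then have "(u - mat 1) + mat 1 \<in> supported (upper 0)"
    using supported_upper_mono[OF assms, of 0] by (intro mats.subspace_add[OF subspace_supported]) auto
  then show ?thesis by simp
qed

text \<open>
  Successive approximation: if \<open>u ** v - mat 1\<close> lies in the \<open>k\<close>-th power of the radical, subtracting
  it from \<open>v\<close> moves the error to the next power.
\<close>

lemma unipotent_inverse:
  fixes u :: "('f::field, 'n) sqmat"
  assumes u: "u - mat 1 \<in> supported (upper 1)"
  shows "\<exists>v. v - mat 1 \<in> supported (upper 1) \<and> u ** v = mat 1"
proof -
  have "\<exists>v. v - mat 1 \<in> supported (upper 1) \<and> u ** v - mat 1 \<in> supported (upper (k + 1))" for k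
  proof (induction k)
    case 0
    show ?case using u by (intro exI[of _ "mat 1"]) (simp add: mats.subspace_0[OF subspace_supported])
  next
    case (Suc k)
    then obtain v where v: "v - mat 1 \<in> supported (upper 1)" "u ** v - mat 1 \<in> supported (upper (k + 1))" by blast
    define r where "r = u ** v - mat 1"
    have r: "r \<in> supported (upper (k + 1))" using v(2) by (simp add: r_def)
    have "(v - mat 1) - r \<in> supported (upper 1)"
      by (rule mats.subspace_diff[OF subspace_supported v(1) supported_upper_mono[OF r]]) simp
    then have 1: "(v - r) - mat 1 \<in> supported (upper 1)" by (simp add: algebra_simps)
    have "u ** (v - r) - mat 1 = - ((u - mat 1) ** r)"
      by (simp add: mult_diff_mat r_def)
    moreover have "(u - mat 1) ** r \<in> supported (upper (Suc k + 1))"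
      using upper_mult[OF u r] by simp
    ultimately have "u ** (v - r) - mat 1 \<in> supported (upper (Suc k + 1))"
      by (simp add: mats.subspace_neg[OF subspace_supported])
    with 1 show ?case by blast
  qed
  from this[of s] obtain v where v: "v - mat 1 \<in> supported (upper 1)" "u ** v - mat 1 \<in> supported (upper (s + 1))" by blast
  have "u ** v - mat 1 = 0" by (rule supported_upper_trivial[OF supported_upper_mono[OF v(2)]]) simp
  then show ?thesis using v by auto
qed

text \<open>
  Again by successive approximation. The error \<open>r\<close> in the \<open>(k + 1)\<close>-st power of the radical is
  cancelled to leading order by the commutator of \<open>deg_elt\<close> with a multiple of \<open>r\<close>.
\<close>

lemma deg_elt_conjugate:
  fixes x :: "('f::field_char_0, 'n) sqmat"
  assumes x: "x - deg_elt \<in> supported (upper 1)"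
  shows "\<exists>u. u - mat 1 \<in> supported (upper 1) \<and> u ** x = deg_elt ** u"
proof -
  have "\<exists>u. u - mat 1 \<in> supported (upper 1) \<and> u ** x - deg_elt ** u \<in> supported (upper (k + 1))" for k
  proof (induction k)
    case 0
    show ?case using x by (intro exI[of _ "mat 1"]) (simp add: mats.subspace_0[OF subspace_supported])
  next
    case (Suc k)
    then obtain u where u: "u - mat 1 \<in> supported (upper 1)" and uk: "u ** x - deg_elt ** u \<in> supported (upper (k + 1))"
      by blast
    define r where "r = u ** x - deg_elt ** u"
    \<comment> \<open>\<open>ad deg_elt\<close> multiplies the leading term of \<open>r\<close> by \<open>k + 1\<close>.\<close>
    define c where "c = mat_smult (1 / of_nat (k + 1)) r"
    have r: "r \<in> supported (upper (k + 1))" using uk by (simp add: r_def)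
    have c: "c \<in> supported (upper (k + 1))" unfolding c_def by (rule mats.subspace_scale[OF subspace_supported r])
    have "(u - mat 1) + c \<in> supported (upper 1)"
      using u supported_upper_mono[OF c, of 1] by (intro mats.subspace_add[OF subspace_supported]) auto
    then have 1: "(u + c) - mat 1 \<in> supported (upper 1)" by (simp add: algebra_simps)
    have "(u + c) ** x - deg_elt ** (u + c) = (r - bracket deg_elt c) + c ** (x - deg_elt)"
      by (simp add: mult_add_mat mult_diff_mat r_def bracket_def)
    moreover have "c ** (x - deg_elt) \<in> supported (upper (Suc k + 1))"
      using upper_mult[OF c x] by simp
    moreover have "r - bracket deg_elt c \<in> supported (upper (Suc k + 1))"
      unfolding supported_def
    proof (intro CollectI allI impI)
      fix i j assume ij: "(i, j) \<notin> upper (Suc k + 1)"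
      show "(r - bracket deg_elt c) $ i $ j = 0"
      proof (cases "b j = b i + (k + 1)")
        case True
        then have "(of_int (int (b j) - int (b i)) :: 'f) = of_nat (k + 1)" by simp
        then show ?thesis
          unfolding vector_minus_component bracket_deg_elt c_def
          by (simp del: of_nat_add of_nat_Suc of_int_diff)
      next
        case False
        then have "(i, j) \<notin> upper (k + 1)" using ij by (auto simp: upper_def)
        then show ?thesis using supportedD[OF r] by (simp add: bracket_deg_elt c_def)
      qed
    qed
    ultimately have "(u + c) ** x - deg_elt ** (u + c) \<in> supported (upper (Suc k + 1))"
      by (metis mats.subspace_add[OF subspace_supported])
    with 1 show ?case by blast
  qed
  from this[of s] obtain u where u: "u - mat 1 \<in> supported (upper 1)" "u ** x - deg_elt ** u \<in> supported (upper (s + 1))"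
    by blast
  have "u ** x - deg_elt ** u = 0" by (rule supported_upper_trivial[OF supported_upper_mono[OF u(2)]]) simp
  then show ?thesis using u by auto
qed

lemma conjugation_automorphism:
  fixes u v :: "('f::field, 'n) sqmat"
  assumes u: "u \<in> supported (upper 0)" and v: "v \<in> supported (upper 0)" and uv: "u ** v = mat 1" "v ** u = mat 1"
  shows "lie_automorphism (\<U> 0) (\<lambda>x. u ** x ** v)"
proof -
  have in_P: "w ** x ** w' \<in> \<U> 0"
    if "w \<in> supported (upper 0)" "w' \<in> supported (upper 0)" "w' ** w = mat 1" "x \<in> \<U> 0"
    for w w' x :: "('f, 'n) sqmat"
  proof -
    have "trace (w ** x ** w') = trace (w' ** w ** x)" by (metis matrix_mul_assoc trace_mul_sym)
    then show ?thesis
      using that upper_mult[OF upper_mult[OF that(1)], of x 0 w' 0] by (simp add: sl_on_def sl_def)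
  qed
  have cancel: "v ** (u ** x ** v) ** u = x" "u ** (v ** x ** u) ** v = x" for x
  proof -
    have "v ** (u ** x ** v) ** u = (v ** u) ** x ** (v ** u)" by (simp add: matrix_mul_assoc)
    then show "v ** (u ** x ** v) ** u = x" by (simp add: uv)
    have "u ** (v ** x ** u) ** v = (u ** v) ** x ** (u ** v)" by (simp add: matrix_mul_assoc)
    then show "u ** (v ** x ** u) ** v = x" by (simp add: uv)
  qed
  have mult: "u ** (x ** y) ** v = (u ** x ** v) ** (u ** y ** v)" for x y
  proof -
    have "(u ** x ** v) ** (u ** y ** v) = u ** x ** (v ** u) ** y ** v" by (simp add: matrix_mul_assoc)
    then show ?thesis by (simp add: uv matrix_mul_assoc)
  qed
  show ?thesis
    unfolding lie_automorphism_def
  proof (intro conjI allI ballI)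
    show "bij_betw (\<lambda>x. u ** x ** v) (\<U> 0) (\<U> 0)"
      by (rule bij_betw_byWitness[where f' = "\<lambda>x. v ** x ** u"]) (use in_P u v uv cancel in auto)
    show "u ** bracket x y ** v = bracket (u ** x ** v) (u ** y ** v)" for x y
      by (simp add: bracket_def mult_diff_mat mult)
  qed (simp_all add: mult_add_mat mult_smult_mat)
qed

text \<open>
  The component of \<open>deg_elt\<close> of degree zero differs from \<open>deg_elt\<close> by an element of the radical, so a
  unipotent conjugation moves it to \<open>deg_elt\<close>.
\<close>

lemma normalize_grading:
  fixes B :: "'g::ab_group_add \<Rightarrow> ('f::field_char_0, 'n) sqmat set"
  assumes B: "is_grading (\<U> 0) B"
  shows "\<exists>\<phi>. lie_automorphism (\<U> 0) \<phi> \<and> deg_elt \<in> \<phi> ` B 0"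
proof -
  let ?d = "component B deg_elt 0"
  have dP: "deg_elt \<in> (\<U> 0 :: ('f, 'n) sqmat set)"
    using deg_elt_in sl_on_mono[OF diagonal_upper[of 0 0]] by auto
  have d0: "?d \<in> B 0" by (rule component_spec(1)[OF B dP])
  have "?d - deg_elt \<in> supported (upper 1)" using deg_elt_component[OF B] by (simp add: sl_on_def)
  then obtain u where u: "u - mat 1 \<in> supported (upper 1)" "u ** ?d = deg_elt ** u" using deg_elt_conjugate by blast
  obtain v where v: "v - mat 1 \<in> supported (upper 1)" "u ** v = mat 1" using unipotent_inverse[OF u(1)] by blast
  have "v ** u = mat 1" using v(2) by (simp add: matrix_left_right_inverse)
  moreover have "u ** ?d ** v = deg_elt" unfolding u(2) by (simp add: v(2) flip: matrix_mul_assoc)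
  ultimately show ?thesis
    using conjugation_automorphism[OF unipotent_upper[OF u(1)] unipotent_upper[OF v(1)] v(2)] d0
    by (intro exI[of _ "\<lambda>x. u ** x ** v"]) (metis image_eqI)
qed

end

section \<open>Extending a normalized grading to sl\<close>

lemma trace_mult: "trace (x ** y) = (\<Sum>i\<in>UNIV. \<Sum>j\<in>UNIV. x $ i $ j * (y $ j $ i :: 'f::field))"
  by (simp add: trace_def mat_mult_nth)

context blocks
begin

lemma diagonal_subset_upper: "0 \<le> m \<Longrightarrow> \<D> m \<subseteq> \<U> 0"
  by (intro sl_on_mono diagonal_upper) simp

lemma component_in_diagonal:
  fixes B :: "'g::ab_group_add \<Rightarrow> ('f::field_char_0, 'n) sqmat set"
  assumes B: "is_grading (sl_on K) B" and d: "deg_elt \<in> B 0" and x: "x \<in> sl_on K" "x \<in> \<D> m"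
  shows "component B x g \<in> \<D> m"
proof -
  have "component B x g = diag_part m (component B x g)"
    using component_diag_part[OF B d x(1), of m g] diag_part_homogeneous[OF x(2), of m] by simp
  moreover have "component B x g \<in> sl_on K"
    using component_spec(1)[OF B x(1)] grading_subset[OF B] by blast
  ultimately show ?thesis using diag_part_in_diagonal by metis
qed

lemma trace_diag_part: "y \<in> \<D> (- m) \<Longrightarrow> trace (diag_part m x ** y) = trace (x ** y)"
  unfolding trace_mult
proof (intro sum.cong refl)
  fix i j assume y: "y \<in> \<D> (- m)"
  have "(j, i) \<notin> diagonal (- m)" if "(i, j) \<notin> diagonal m" using that by (auto simp: diagonal_def)
  then show "diag_part m x $ i $ j * y $ j $ i = x $ i $ j * y $ j $ i"
    using sl_onD[OF y, of j i] by (auto simp: diag_part_def)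
qed

lemma trace_diagonal_zero:
  assumes x: "x \<in> \<D> m" and y: "y \<in> \<D> k" and "m + k \<noteq> 0"
  shows "trace (x ** y) = 0"
  unfolding trace_mult
proof (intro sum.neutral ballI)
  fix i j
  have "(i, j) \<notin> diagonal m \<or> (j, i) \<notin> diagonal k" using assms(3) by (auto simp: diagonal_def)
  then show "x $ i $ j * y $ j $ i = 0" using sl_onD[OF x] sl_onD[OF y] by auto
qed

lemma diagonal_nondegenerate:
  fixes x :: "('f::field_char_0, 'n) sqmat"
  assumes "x \<in> \<D> m" "\<And>y. y \<in> \<D> (- m) \<Longrightarrow> trace (x ** y) = 0"
  shows "x = 0"
  by (rule trace_form_nondegenerate[OF assms(1) diagonal_refl_or_irrefl])
    (use assms(2) in \<open>simp add: converse_diagonal\<close>)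

lemma diagonal_bracket_induct:
  assumes "x \<in> \<D> (m + 1)" "0 < m"
    and "Q 0" "\<And>u v. Q u \<Longrightarrow> Q v \<Longrightarrow> Q (u + v)"
    and "\<And>y z. y \<in> \<D> 1 \<Longrightarrow> z \<in> \<D> m \<Longrightarrow> Q (bracket y z)"
  shows "Q x"
proof (rule supported_bracket_induct[OF assms(1), where I = "diagonal 1" and I' = "diagonal m"])
  show "Id \<inter> diagonal (m + 1) = {}" using assms(2) by (auto simp: diagonal_def)
  fix i j assume ij: "(i, j) \<in> diagonal (m + 1)"
  then have "b i + 1 < s" using b_less[of j] assms(2) by (auto simp: diagonal_def)
  then obtain k where "b k = b i + 1" using ex_block by blast
  then show "\<exists>k. (i, k) \<in> diagonal 1 \<and> (k, j) \<in> diagonal m \<and> k \<noteq> i \<and> k \<noteq> j"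
    using ij assms(2) by (intro exI[of _ k]) (auto simp: diagonal_def)
qed (use assms in auto)

text \<open>
  Killing forms are graded, and on the zeroth block-diagonal the trace form is a combination of the
  Killing forms of the block-triangular algebra and of its block-diagonal part.
\<close>

lemma trace_form_graded:
  fixes B :: "'g::ab_group_add \<Rightarrow> ('f::field_char_0, 'n) sqmat set"
  assumes B: "is_grading (\<U> 0) B" and d: "deg_elt \<in> B 0"
    and x: "x \<in> B g" "x \<in> \<D> 0" and y: "y \<in> B h" "y \<in> \<D> 0" and gh: "g + h \<noteq> 0"
  shows "trace (x ** y) = 0"
proof -
  have sub: "\<D> 0 \<subseteq> (\<U> 0 :: ('f, 'n) sqmat set)" by (rule diagonal_subset_upper) simp
  have B0: "is_grading (\<D> 0) (\<lambda>g. B g \<inter> \<D> 0)"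
  proof (rule restrict_grading[OF B subspace_sl_on subspace_sl_on sub])
    show "bracket u v \<in> \<D> 0" if "u \<in> \<D> 0" "v \<in> \<D> 0" for u v :: "('f, 'n) sqmat"
      using bracket_diagonal[OF that] by simp
    show "component B u g \<in> \<D> 0" if "u \<in> \<D> 0" for u g
      using component_in_diagonal[OF B d _ that] that sub by blast
  qed
  have "2 * of_nat CARD('n) * trace (x ** y) = 2 * killing (upper 0) x y - killing (diagonal 0) x y"
    by (rule trace_form_eq_killing) (use x y sub in auto)
  also have "killing (upper 0) x y = 0"
    by (rule killing_graded[OF upper_0_refl upper_0_trans B x(1) y(1) gh])
  also have "killing (diagonal 0) x y = 0"
    by (rule killing_graded[OF diagonal_0_refl diagonal_0_trans B0 _ _ gh]) (use x y in auto)
  finally show ?thesis by simp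
qed

text \<open>
  The trace form pairs the \<open>m\<close>-th block-diagonal with the \<open>- m\<close>-th one, and elements of degrees \<open>g\<close>
  and \<open>h\<close> of a grading of \<open>sl\<close> are orthogonal unless \<open>g + h = 0\<close>. This forces the definition in
  negative degrees.
\<close>

definition extend_grading ::
    "('g::ab_group_add \<Rightarrow> ('f::field, 'n) sqmat set) \<Rightarrow> int \<times> 'g \<Rightarrow> ('f, 'n) sqmat set" where
  "extend_grading B p = (if 0 \<le> fst p then B (snd p) \<inter> \<D> (fst p) else
     {x \<in> \<D> (fst p). \<forall>h. snd p + h \<noteq> 0 \<longrightarrow>
        (\<forall>y\<in>B h \<inter> \<D> (- fst p). trace (x ** y) = 0)})"

lemma extend_grading_nonneg: "0 \<le> m \<Longrightarrow> extend_grading B (m, g) = B g \<inter> \<D> m"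
  by (simp add: extend_grading_def)

lemma extend_grading_diagonal: "x \<in> extend_grading B (m, g) \<Longrightarrow> x \<in> \<D> m"
  by (auto simp: extend_grading_def split: if_splits)

text \<open>
  The description by annihilators is also valid for \<open>m = 0\<close>, where it follows from the trace form
  being graded and nondegenerate on the zeroth block-diagonal.
\<close>

lemma extend_grading_nonpos:
  fixes B :: "'g::ab_group_add \<Rightarrow> ('f::field_char_0, 'n) sqmat set"
  assumes B: "is_grading (\<U> 0) B" and d: "deg_elt \<in> B 0" and m: "m \<le> 0"
  shows "x \<in> extend_grading B (m, g) \<longleftrightarrow> x \<in> \<D> m \<and>
    (\<forall>h y. g + h \<noteq> 0 \<longrightarrow> y \<in> extend_grading B (- m, h) \<longrightarrow> trace (x ** y) = 0)"
proof (cases "m = 0")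
  case False
  then show ?thesis using m by (auto simp: extend_grading_def)
next
  case True
  note L = subspace_sl_on[of "upper 0"]
  show ?thesis
    unfolding True
  proof (intro iffI conjI allI impI)
    assume x: "x \<in> \<D> 0 \<and>
      (\<forall>h y. g + h \<noteq> 0 \<longrightarrow> y \<in> extend_grading B (- 0, h) \<longrightarrow> trace (x ** y) = 0)"
    then have x0: "x \<in> \<D> 0" and xP: "x \<in> \<U> 0"
      using diagonal_subset_upper[of 0] by auto
    have "component B x k = 0" if k: "k \<noteq> g" for k
    proof (rule diagonal_nondegenerate)
      show xk0: "component B x k \<in> \<D> 0" by (rule component_in_diagonal[OF B d xP x0])
      fix y :: "('f, 'n) sqmat" assume "y \<in> \<D> (- 0)"
      then have y0: "y \<in> \<D> 0" by simp
      then have yP: "y \<in> \<U> 0" using diagonal_subset_upper[of 0] by auto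
      show "trace (component B x k ** y) = 0"
      proof (rule component_induct[OF B yP])
        fix h
        let ?y = "component B y h"
        have yh: "?y \<in> B h" "?y \<in> \<D> 0"
          using component_spec(1)[OF B yP] component_in_diagonal[OF B d yP y0] by auto
        have xk: "component B x k \<in> B k" for k by (rule component_spec(1)[OF B xP])
        show "trace (component B x k ** ?y) = 0"
        proof (cases "k + h = 0")
          case True
          then have "g + h \<noteq> 0" using k by (metis add_right_imp_eq)
          then have "trace (x ** ?y) = 0" using x yh by (simp add: extend_grading_nonneg)
          moreover have "trace (diag_part 0 x ** ?y) = trace (diag_part 0 (component B x k) ** ?y)"
          proof (rule functional_component[OF B L xP])
            fix l u assume "l \<noteq> k" "u \<in> B l"
            then show "trace (diag_part 0 u ** ?y) = 0"
              using True grading_subset[OF B, of l] diag_part_in_component[OF B d, of u l 0]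
              by (intro trace_form_graded[OF B d _ diag_part_in_diagonal[of u "upper 0"] yh])
                (auto simp: add_eq_0_iff2)
          qed (simp add: diag_part_add mult_add_mat trace_add)
          ultimately show ?thesis
            by (simp add: diag_part_homogeneous[OF x0] diag_part_homogeneous[OF xk0])
        qed (use trace_form_graded[OF B d xk xk0 yh] in auto)
      qed (simp_all add: mult_add_mat trace_add)
    qed
    then have "x \<in> B g" by (rule homogeneousI[OF B xP])
    then show "x \<in> extend_grading B (0, g)" using x0 by (simp add: extend_grading_nonneg)
  qed (auto simp: extend_grading_nonneg intro: trace_form_graded[OF B d])
qed

lemma subspace_extend_grading:
  fixes B :: "'g::ab_group_add \<Rightarrow> ('f::field_char_0, 'n) sqmat set"
  assumes B: "is_grading (\<U> 0) B"
  shows "mats.subspace (extend_grading B p)"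
proof (cases "0 \<le> fst p")
  case True
  then show ?thesis
    by (simp add: extend_grading_def mats.subspace_inter[OF grading_subspace[OF B] subspace_sl_on])
next
  case False
  then show ?thesis
    unfolding mats.subspace_def extend_grading_def
    by (auto simp: sl_on_zero sl_on_add
      sl_on_scale mult_add_mat trace_add mult_smult_mat)
qed

lemma bracket_extend_grading:
  fixes B :: "'g::ab_group_add \<Rightarrow> ('f::field_char_0, 'n) sqmat set"
  assumes B: "is_grading (\<U> 0) B" and d: "deg_elt \<in> B 0"
    and x: "x \<in> extend_grading B (m, g)" and y: "y \<in> extend_grading B (m', g')"
  shows "bracket x y \<in> extend_grading B (m + m', g + g')"
proof -
  note L = subspace_sl_on[of "upper 0"]
  have gen: "Q w" if m: "0 < m" and w: "w \<in> extend_grading B (m + 1, g)" and Q: "Q 0" "\<And>u v. Q u \<Longrightarrow> Q v \<Longrightarrow> Q (u + v)"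
    and br: "\<And>a c y z. a + c = g \<Longrightarrow> y \<in> extend_grading B (1, a) \<Longrightarrow> z \<in> extend_grading B (m, c) \<Longrightarrow> Q (bracket y z)"
    for m g w Q
  proof -
    have w': "w \<in> B g" "w \<in> \<D> (m + 1)" using w m by (simp_all add: extend_grading_nonneg)
    have sumQ: "Q (\<Sum>a\<in>S. f a)" if "\<And>a. a \<in> S \<Longrightarrow> Q (f a)" for f and S :: "'g set"
      using that by (induction S rule: infinite_finite_induct) (auto intro: Q)
    have "w \<in> \<U> 0 \<and> Q (component B w g)"
      using w'(2) m
    proof (rule diagonal_bracket_induct)
      fix y z :: "('f, 'n) sqmat" assume yz: "y \<in> \<D> 1" "z \<in> \<D> m"
      then have yzP: "y \<in> \<U> 0" "z \<in> \<U> 0"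
        using diagonal_subset_upper[of 1] diagonal_subset_upper[of m] m by auto
      have "component B (bracket y z) g =
          (\<Sum>h | component B z h \<noteq> 0. bracket (component B y (g - h)) (component B z h))"
        by (rule component_bracket_sum[OF B L yzP]) (rule bracket_P)
      moreover have "Q (bracket (component B y (g - h)) (component B z h))" for h
        using m component_spec(1)[OF B] component_in_diagonal[OF B d] yz yzP
        by (intro br[of "g - h" h]) (simp_all add: extend_grading_nonneg)
      ultimately show "bracket y z \<in> \<U> 0 \<and> Q (component B (bracket y z) g)"
        using sumQ bracket_P[OF yzP] by simp
    qed (auto simp: component_add[OF B L] component_zero[OF B L] mats.subspace_0[OF L] mats.subspace_add[OF L] Q)
    then show "Q w" using component_homogeneous[OF B w'(1)] by simp
  qed
  note sub = subspace_extend_grading[OF B]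
  show ?thesis
  proof (rule bracket_closed_extension[where br = bracket and form = "\<lambda>x y. trace (x ** y)"
      and V = "\<lambda>m. \<D> m" and C = "\<lambda>m g. extend_grading B (m, g)" and Z = "{g. g \<noteq> 0}"])
    show "bracket x y \<in> extend_grading B (m + m', g + g')"
      if "0 \<le> m" "0 \<le> m'" "x \<in> extend_grading B (m, g)" "y \<in> extend_grading B (m', g')" for x y m m' g g'
      using that by (auto simp: extend_grading_nonneg intro: grading_bracket[OF B] bracket_diagonal)
    show "x \<in> extend_grading B (m, g) \<longleftrightarrow> x \<in> \<D> m \<and>
      (\<forall>h z. g + h \<in> {g. g \<noteq> 0} \<longrightarrow> z \<in> extend_grading B (- m, h) \<longrightarrow> trace (x ** z) = 0)" if "m \<le> 0" for x m g
      using extend_grading_nonpos[OF B d that] by simp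
    show "Q w" if "0 < m" "w \<in> extend_grading B (m + 1, g)" "Q 0" "\<And>u v. Q u \<Longrightarrow> Q v \<Longrightarrow> Q (u + v)"
      "\<And>a c y z. a + c = g \<Longrightarrow> y \<in> extend_grading B (1, a) \<Longrightarrow> z \<in> extend_grading B (m, c) \<Longrightarrow> Q (bracket y z)"
      for m g w Q
      by (rule gen[OF that(1,2), of Q]) (fact that)+
  qed (use x y in \<open>auto intro: bracket_linear bracket_antisym bracket_jacobi trace_bracket_invariant
    bracket_diagonal extend_grading_diagonal mats.subspace_0[OF sub] mats.subspace_add[OF sub] mats.subspace_neg[OF sub]\<close>)
qed

lemma diag_part_trivial: "m \<notin> {- int s..int s} \<Longrightarrow> diag_part m x = 0"
proof -
  assume m: "m \<notin> {- int s..int s}"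
  have "(i, j) \<notin> diagonal m" for i j
    using b_less[of i] b_less[of j] m by (auto simp: diagonal_def)
  then show ?thesis by (simp add: diag_part_def vec_eq_iff)
qed

text \<open>
  In negative degrees the projections are the adjoints, with respect to the trace form, of the
  projections in positive degrees.
\<close>

lemma extend_grading_decomposition:
  fixes B :: "'g::ab_group_add \<Rightarrow> ('f::field_char_0, 'n) sqmat set"
  assumes B: "is_grading (\<U> 0) B" and d: "deg_elt \<in> B 0" and x: "x \<in> sl"
  shows "\<exists>f S. finite S \<and> (\<forall>p. f p \<in> extend_grading B p) \<and> (\<forall>p. p \<notin> S \<longrightarrow> f p = 0) \<and> x = (\<Sum>p\<in>S. f p)"
proof -
  note L = subspace_sl_on[of "upper 0"]
  obtain S0 where S0: "finite S0" "\<And>x g. x \<in> \<U> 0 \<Longrightarrow> g \<notin> S0 \<Longrightarrow> component B x g = 0"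
    using grading_finite_support[OF upper_0_refl B] by blast
  \<comment> \<open>Adjoints reverse the sign of the degree, so the support is made symmetric.\<close>
  define S1 where "S1 = S0 \<union> uminus ` S0"
  have S1: "finite S1" using S0 by (simp add: S1_def)
  \<comment> \<open>The adjoint of the projection to degree \<open>- g\<close>, restricted to the \<open>m\<close>-th block-diagonal.\<close>
  define adj where "adj m g = (\<chi> i j. if (i, j) \<in> diagonal m then trace (x ** component B (munit j i) (- g)) else 0)"
    for m g
  define f where "f p = (if 0 \<le> fst p then component B (diag_part (fst p) x) (snd p) else adj (fst p) (snd p))" for p
  have xK: "x \<in> sl_on UNIV" using x by (simp add: sl_on_UNIV)
  have part: "diag_part m x \<in> \<D> m" for m by (rule diag_part_in_diagonal[OF xK])
  have partP: "diag_part m x \<in> \<U> 0" if "0 \<le> m" for m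
    using part diagonal_subset_upper[OF that] by blast
  have adjE: "adj m g \<in> \<D> m" if "m < 0" for m g
  proof -
    have "adj m g \<in> supported (diagonal m)" by (simp add: adj_def supported_def)
    moreover have "Id \<inter> diagonal m = {}" using that by (auto simp: diagonal_def)
    ultimately show ?thesis using supported_irrefl by blast
  qed
  have munitP: "munit j i \<in> (\<D> (- m) :: ('f, 'n) sqmat set)" "munit j i \<in> (\<U> 0 :: ('f, 'n) sqmat set)"
    if "(i, j) \<in> diagonal m" "m < 0" for i j m
    using that by (auto simp: diagonal_def upper_def intro!: munit_sl_on)
  have adj: "trace (adj m g ** y) = trace (x ** component B y (- g))"
    if m: "m < 0" and y: "y \<in> \<D> (- m)" for m g y
  proof -
    let ?e = "\<lambda>i j. mat_smult (y $ j $ i) (munit j i) :: ('f, 'n) sqmat"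
    have yji: "y $ j $ i = 0" if "(i, j) \<notin> diagonal m" for i j
      by (rule sl_onD[OF y]) (use that in \<open>auto simp: diagonal_def\<close>)
    have eP: "?e i j \<in> \<U> 0" for i j
      using yji[of i j] munitP(2)[OF _ m, of i j] mats.subspace_0[OF L] mats.subspace_scale[OF L] by (cases "(i, j) \<in> diagonal m") auto
    have "y = (\<Sum>j\<in>UNIV. \<Sum>i\<in>UNIV. ?e i j)" by (rule sum_munit)
    then have "y = (\<Sum>i\<in>UNIV. \<Sum>j\<in>UNIV. ?e i j)" by (subst sum.swap)
    then have "component B y (- g) = component B (\<Sum>i\<in>UNIV. \<Sum>j\<in>UNIV. ?e i j) (- g)" by (rule arg_cong)
    also have "\<dots> = (\<Sum>i\<in>UNIV. \<Sum>j\<in>UNIV. component B (?e i j) (- g))"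
      by (simp add: component_sum[OF B L] eP mats.subspace_sum[OF L])
    finally have "trace (x ** component B y (- g)) = (\<Sum>i\<in>UNIV. \<Sum>j\<in>UNIV. trace (x ** component B (?e i j) (- g)))"
      by (simp add: mult_sum_mat trace_sum)
    also have "\<dots> = (\<Sum>i\<in>UNIV. \<Sum>j\<in>UNIV. adj m g $ i $ j * y $ j $ i)"
    proof (intro sum.cong refl)
      fix i j
      show "trace (x ** component B (?e i j) (- g)) = adj m g $ i $ j * y $ j $ i"
      proof (cases "(i, j) \<in> diagonal m")
        case True
        then show ?thesis using munitP(2)[OF _ m, of i j]
          by (simp add: adj_def component_smult[OF B L] mult_smult_mat)
      next
        case False
        then show ?thesis using yji by (simp add: component_zero[OF B L])
      qed
    qed
    finally show ?thesis by (simp add: trace_mult[of "adj m g"])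
  qed
  have fA: "f (m, g) \<in> extend_grading B (m, g)" for m g
  proof (cases "0 \<le> m")
    case True
    then show ?thesis
      using component_spec(1)[OF B partP] component_in_diagonal[OF B d partP part]
      by (simp add: f_def extend_grading_nonneg)
  next
    case False
    have "trace (adj m g ** y) = 0" if "g + h \<noteq> 0" "y \<in> B h" "y \<in> \<D> (- m)" for h y
    proof -
      have "- g \<noteq> h" using that(1) by auto
      then show ?thesis using adj[of m y g] component_homogeneous[OF B that(2)] that False by simp
    qed
    then show ?thesis using False adjE by (auto simp: f_def extend_grading_def)
  qed
  let ?S = "{- int s..int s} \<times> S1"
  have f0: "f (m, g) = 0" if "(m, g) \<notin> ?S" for m g
  proof (cases "0 \<le> m")
    case True
    have "component B (diag_part m x) g = 0"
    proof (cases "m \<in> {- int s..int s}")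
      case False
      then show ?thesis unfolding diag_part_trivial[OF False] by (simp add: component_zero[OF B L])
    next
      case m: True
      then have "g \<notin> S0" using that by (simp add: S1_def)
      then show ?thesis by (rule S0(2)[OF partP[OF True]])
    qed
    then show ?thesis using True by (simp add: f_def)
  next
    case False
    have "adj m g $ i $ j = 0" for i j
    proof (cases "(i, j) \<in> diagonal m")
      case True
      then have "m \<in> {- int s..int s}" using b_less[of i] b_less[of j] by (auto simp: diagonal_def)
      then have "- g \<notin> S0" using that unfolding S1_def by force
      then show ?thesis using S0(2)[OF munitP(2)[OF True]] False by (simp add: adj_def)
    qed (simp add: adj_def)
    then have "adj m g = 0" by (simp add: vec_eq_iff)
    then show ?thesis using False by (simp add: f_def)
  qed
  have sumf: "(\<Sum>g\<in>S1. f (m, g)) = diag_part m x" for m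
  proof (cases "0 \<le> m")
    case True
    have "(\<Sum>g\<in>S1. component B (diag_part m x) g) = (\<Sum>g | component B (diag_part m x) g \<noteq> 0. component B (diag_part m x) g)"
      by (rule sum_support[OF S1, symmetric]) (use S0(2)[OF partP[OF True]] in \<open>auto simp: S1_def\<close>)
    then show ?thesis using True component_spec(3)[OF B partP[OF True]] by (simp add: f_def)
  next
    case False
    then have m: "m < 0" by simp
    have "(\<Sum>g\<in>S1. adj m g) - diag_part m x = 0"
    proof (rule diagonal_nondegenerate)
      show "(\<Sum>g\<in>S1. adj m g) - diag_part m x \<in> \<D> m"
        by (intro sl_on_diff sl_on_sum adjE part m)
      fix y :: "('f, 'n) sqmat" assume y: "y \<in> \<D> (- m)"
      then have yP: "y \<in> \<U> 0" using diagonal_subset_upper[of "- m"] m by auto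
      have "(\<Sum>g\<in>S1. component B y (- g)) = (\<Sum>g\<in>S1. component B y g)"
        by (rule sum.reindex_bij_witness[of _ uminus uminus]) (auto simp: S1_def)
      also have "\<dots> = (\<Sum>g | component B y g \<noteq> 0. component B y g)"
        by (rule sum_support[OF S1, symmetric]) (use S0(2)[OF yP] in \<open>auto simp: S1_def\<close>)
      also have "\<dots> = y" by (rule component_spec(3)[OF B yP])
      finally have "trace (x ** y) = (\<Sum>g\<in>S1. trace (x ** component B y (- g)))"
        by (metis (no_types) mult_sum_mat(1) trace_sum)
      then show "trace (((\<Sum>g\<in>S1. adj m g) - diag_part m x) ** y) = 0"
        by (simp add: mult_diff_mat trace_sub trace_diag_part[OF y] mult_sum_mat trace_sum adj[OF m y])
    qed
    then show ?thesis using False by (simp add: f_def)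
  qed
  have "x = (\<Sum>m\<in>{- int s..int s}. diag_part m x)" by (rule sum_diag_part[symmetric])
  also have "\<dots> = (\<Sum>p\<in>?S. f p)" by (simp add: sumf sum.cartesian_product')
  finally show ?thesis using fA f0 S1 by (intro exI[of _ f] exI[of _ ?S]) auto
qed

lemma is_grading_extend_grading:
  fixes B :: "'g::ab_group_add \<Rightarrow> ('f::field_char_0, 'n) sqmat set"
  assumes B: "is_grading (\<U> 0) B" and d: "deg_elt \<in> B 0"
  shows "is_grading sl (extend_grading B)"
proof (rule is_gradingI)
  note L = subspace_sl_on[of "upper 0"]
  show "mats.subspace (extend_grading B p)" for p by (rule subspace_extend_grading[OF B])
  show "extend_grading B p \<subseteq> sl" for p
    using extend_grading_diagonal[of _ B "fst p" "snd p"] by (auto simp: sl_on_def)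
  show "bracket x y \<in> extend_grading B (p + q)" if "x \<in> extend_grading B p" "y \<in> extend_grading B q" for p q x y
    using bracket_extend_grading[OF B d, of x "fst p" "snd p" y "fst q" "snd q"] that by (simp add: plus_prod_def)
  show "\<exists>f S. finite S \<and> (\<forall>p. f p \<in> extend_grading B p) \<and> (\<forall>p. p \<notin> S \<longrightarrow> f p = 0) \<and> x = (\<Sum>p\<in>S. f p)"
    if "x \<in> sl" for x
    by (rule extend_grading_decomposition[OF B d that])
  fix f S assume S: "finite S" and f: "\<And>p. f p \<in> extend_grading B p" and f0: "\<And>p. p \<notin> S \<Longrightarrow> f p = 0"
    and sum0: "(\<Sum>p\<in>S. f p) = 0"
  define T where "T = snd ` S"
  have T: "finite T" using S by (simp add: T_def)
  have fT: "f (m, g) = 0" if "g \<notin> T" for m g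
    using f0[of "(m, g)"] that by (force simp: T_def)
  have fE: "f (m, g) \<in> \<D> m" for m g using f extend_grading_diagonal by blast
  have row: "(\<Sum>g\<in>T. f (m, g)) = 0" for m
  proof -
    have "(\<Sum>p\<in>S. f p) = (\<Sum>p\<in>insert m (fst ` S) \<times> T. f p)"
      by (rule sum.mono_neutral_left) (use S T f0 in \<open>force simp: T_def\<close>)+
    also have "\<dots> = (\<Sum>k\<in>insert m (fst ` S). \<Sum>g\<in>T. f (k, g))"
      by (simp add: sum.cartesian_product')
    finally have "diag_part m (\<Sum>k\<in>insert m (fst ` S). \<Sum>g\<in>T. f (k, g)) = 0" using sum0 by simp
    moreover have "diag_part m (\<Sum>k\<in>insert m (fst ` S). \<Sum>g\<in>T. f (k, g)) =
        (\<Sum>k\<in>insert m (fst ` S). if k = m then \<Sum>g\<in>T. f (m, g) else 0)"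
      unfolding diag_part_sum by (intro sum.cong refl) (auto simp: diag_part_homogeneous[OF fE])
    ultimately show ?thesis using S by simp
  qed
  have "f (m, g) = 0" for m g
  proof (cases "0 \<le> m")
    case True
    have "(\<lambda>g. f (m, g)) = (\<lambda>g. 0)"
      by (rule grading_independent[OF B L T])
        (use f[of "(m, _)"] True fT row in \<open>auto simp: extend_grading_nonneg\<close>)
    then show ?thesis by metis
  next
    case False
    then have m: "m < 0" by simp
    show ?thesis
    proof (rule diagonal_nondegenerate[OF fE])
      fix y :: "('f, 'n) sqmat" assume y: "y \<in> \<D> (- m)"
      then have yP: "y \<in> \<U> 0" using diagonal_subset_upper[of "- m"] m by auto
      have orth: "trace (f (m, k) ** component B y h) = 0" if "k + h \<noteq> 0" for k h
        using f[of "(m, k)"] that component_spec(1)[OF B yP] component_in_diagonal[OF B d yP y] m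
        by (auto simp: extend_grading_def)
      show "trace (f (m, g) ** y) = 0"
      proof (rule component_induct[OF B yP])
        fix h
        show "trace (f (m, g) ** component B y h) = 0"
        proof (cases "g + h = 0")
          case True
          have "0 = (\<Sum>k\<in>T. trace (f (m, k) ** component B y h))"
            unfolding trace_sum[symmetric] mult_sum_mat(2)[symmetric] row by simp
          also have "\<dots> = (\<Sum>k\<in>{g}. trace (f (m, k) ** component B y h))"
          proof (rule sum.mono_neutral_cong)
            show "finite T" by (rule T)
            show "trace (f (m, k) ** component B y h) = 0" if "k \<in> T - {g}" for k
              using that True by (intro orth) (auto simp: add_eq_0_iff2)
          qed (use fT in auto)
          finally show ?thesis by simp
        qed (rule orth)
      qed (simp_all add: mult_add_mat trace_add)
    qed
  qed
  then show "f = (\<lambda>p. 0)" by (auto simp: fun_eq_iff)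
qed

end

section \<open>Coarsenings\<close>

lemma coarsening_base: "x \<in> A g \<Longrightarrow> x \<in> coarsening \<alpha> A (\<alpha> g)"
  unfolding coarsening_def by (rule mats.span_base) auto

lemma coarsening_induct [consumes 2, case_names base zero add]:
  assumes x: "x \<in> coarsening \<alpha> A h" and sub: "\<And>g. mats.subspace (A g)"
    and base: "\<And>g u. \<alpha> g = h \<Longrightarrow> u \<in> A g \<Longrightarrow> Q u" and zero: "Q 0" and add: "\<And>u v. Q u \<Longrightarrow> Q v \<Longrightarrow> Q (u + v)"
  shows "Q x"
  using x unfolding coarsening_def
proof (induction rule: mats.span_induct_alt)
  case (step c u v)
  then obtain g where "\<alpha> g = h" "u \<in> A g" by auto
  then show ?case by (intro add base[of g] mats.subspace_scale[OF sub] step)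
qed (rule zero)

lemma coarsening_grading:
  fixes A :: "'g::ab_group_add \<Rightarrow> ('f::field, 'n::finite) sqmat set" and \<alpha> :: "'g \<Rightarrow> 'h::ab_group_add"
  assumes A: "is_grading L A" and L: "mats.subspace L" and \<alpha>: "\<And>g h. \<alpha> (g + h) = \<alpha> g + \<alpha> h"
  shows "is_grading L (coarsening \<alpha> A)"
proof (rule is_gradingI)
  note sub = grading_subspace[OF A]
  have csub: "mats.subspace (coarsening \<alpha> A h)" for h unfolding coarsening_def by (rule mats.subspace_span)
  then show "mats.subspace (coarsening \<alpha> A h)" for h .
  show cL: "coarsening \<alpha> A h \<subseteq> L" for h
    unfolding coarsening_def by (rule mats.span_minimal[OF _ L]) (use grading_subset[OF A] in auto)
  show "\<exists>f S. finite S \<and> (\<forall>h. f h \<in> coarsening \<alpha> A h) \<and> (\<forall>h. h \<notin> S \<longrightarrow> f h = 0) \<and> x = (\<Sum>h\<in>S. f h)"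
    if x: "x \<in> L" for x
  proof -
    let ?S = "{g. component A x g \<noteq> 0}"
    let ?f = "\<lambda>h. \<Sum>g\<in>{g \<in> ?S. \<alpha> g = h}. component A x g"
    have fin: "finite ?S" by (rule component_spec(2)[OF A x])
    have 1: "?f h \<in> coarsening \<alpha> A h" for h
    proof (rule mats.subspace_sum[OF csub])
      fix g assume "g \<in> {g \<in> ?S. \<alpha> g = h}"
      then show "component A x g \<in> coarsening \<alpha> A h"
        using coarsening_base[of "component A x g" A g \<alpha>] component_spec(1)[OF A x] by simp
    qed
    have 2: "?f h = 0" if "h \<notin> \<alpha> ` ?S" for h by (rule sum.neutral) (use that in auto)
    have 3: "x = (\<Sum>h\<in>\<alpha> ` ?S. ?f h)"
      using sum.group[of ?S "\<alpha> ` ?S" \<alpha> "component A x"] fin component_spec(3)[OF A x] by simp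
    show ?thesis
      by (rule exI[of _ ?f], rule exI[of _ "\<alpha> ` ?S"]) (use 1 2 3 fin in blast)
  qed
  show "bracket x y \<in> coarsening \<alpha> A (h + h')" if "x \<in> coarsening \<alpha> A h" "y \<in> coarsening \<alpha> A h'" for h h' x y
    using that(1) sub
  proof (induction rule: coarsening_induct)
    case (base g u)
    show ?case
      using that(2) sub
    proof (induction rule: coarsening_induct)
      case (base g' v)
      have "bracket u v \<in> A (g + g')" by (rule grading_bracket[OF A \<open>u \<in> A g\<close> base(2)])
      then have "bracket u v \<in> coarsening \<alpha> A (\<alpha> (g + g'))" by (rule coarsening_base)
      then show ?case using \<open>\<alpha> g = h\<close> base(1) \<alpha> by metis
    qed (simp_all add: bracket_linear mats.subspace_0[OF csub] mats.subspace_add[OF csub])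
  qed (simp_all add: bracket_linear mats.subspace_0[OF csub] mats.subspace_add[OF csub])
  have comp0: "u \<in> L \<and> component A u g = 0" if "u \<in> coarsening \<alpha> A h" "\<alpha> g \<noteq> h" for u g h
    using that(1) sub
  proof (induction rule: coarsening_induct)
    case (base k v)
    then show ?case using that(2) component_homogeneous[OF A base(2)] grading_subset[OF A] by auto
  qed (simp_all add: component_zero[OF A L] component_add[OF A L] mats.subspace_0[OF L] mats.subspace_add[OF L])
  fix f S assume S: "finite S" and f: "\<And>h. f h \<in> coarsening \<alpha> A h" "\<And>h. h \<notin> S \<Longrightarrow> f h = 0" "(\<Sum>h\<in>S. f h) = 0"
  have fL: "f h \<in> L" for h using f(1) cL by blast
  have "component A (f h) g = 0" for h g
  proof (cases "\<alpha> g = h")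
    case True
    have "0 = component A (\<Sum>h\<in>S. f h) g" by (simp add: f(3) component_zero[OF A L])
    also have "\<dots> = (\<Sum>h\<in>S. component A (f h) g)" by (rule component_sum[OF A L fL])
    also have "\<dots> = (\<Sum>h\<in>S. if h = \<alpha> g then component A (f h) g else 0)"
      by (rule sum.cong) (use comp0[OF f(1)] in auto)
    also have "\<dots> = component A (f h) g"
      using S True f(2)[of h] by (simp add: component_zero[OF A L])
    finally show ?thesis by simp
  qed (use comp0[OF f(1)] in blast)
  then have "f h = 0" for h using component_spec(3)[OF A fL, of h] by simp
  then show "f = (\<lambda>h. 0)" by (simp add: fun_eq_iff)
qed

lemma trace_form_graded_sl:
  fixes A :: "'g::ab_group_add \<Rightarrow> ('f::field_char_0, 'n::finite) sqmat set"
  assumes A: "is_grading sl A" and xy: "x \<in> A g" "y \<in> A h" "g + h \<noteq> 0"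
  shows "trace (x ** y) = 0"
proof -
  have "is_grading (sl_on UNIV) A" using A by (simp add: sl_on_UNIV)
  then have "killing UNIV x y = 0" using xy by (intro killing_graded) auto
  moreover have "trace x = 0" using xy(1) grading_subset[OF A] by (auto simp: sl_def)
  ultimately show ?thesis by (simp add: killing_UNIV)
qed

section \<open>Gradings of sl refining the block-diagonal grading\<close>

context blocks
begin

definition refines_diagonals :: "(int \<times> 'g::ab_group_add \<Rightarrow> ('f::field, 'n) sqmat set) \<Rightarrow> bool" where
  "refines_diagonals A \<longleftrightarrow> is_grading sl A \<and> (\<forall>m g. A (m, g) \<subseteq> \<D> m)"

lemma refines_diagonalsD:
  assumes "refines_diagonals A"
  shows "is_grading sl A" "x \<in> A (m, g) \<Longrightarrow> x \<in> \<D> m"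
  using assms by (auto simp: refines_diagonals_def)

text \<open>
  The components of \<open>x\<close> in the degrees \<open>(m, g)\<close> are the components of \<open>diag_part m x\<close>.
\<close>

lemma refines_diagonals_component:
  fixes A :: "int \<times> 'g::ab_group_add \<Rightarrow> ('f::field, 'n) sqmat set"
  assumes A: "refines_diagonals A" and x: "x \<in> sl" "diag_part m x = 0"
  shows "component A x (m, g) = 0"
proof -
  note gr = refines_diagonalsD(1)[OF A]
  let ?S = "{p. component A x p \<noteq> 0}"
  let ?f = "\<lambda>p. if fst p = m then component A x p else 0"
  have E: "component A x p \<in> \<D> (fst p)" for p
    using component_spec(1)[OF gr x(1), of p] refines_diagonalsD(2)[OF A, of _ "fst p" "snd p"] by simp
  have "0 = diag_part m (\<Sum>p\<in>?S. component A x p)" using component_spec(3)[OF gr x(1)] x(2) by simp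
  also have "\<dots> = (\<Sum>p\<in>?S. diag_part m (component A x p))" by (rule diag_part_sum)
  also have "\<dots> = (\<Sum>p\<in>?S. ?f p)" by (rule sum.cong) (auto simp: diag_part_homogeneous[OF E])
  finally have "(\<Sum>p\<in>?S. ?f p) = 0" by simp
  then have "?f = (\<lambda>p. 0)"
    using component_spec[OF gr x(1)] mats.subspace_0[OF grading_subspace[OF gr]]
    by (intro grading_independent[OF gr subspace_sl, of ?S]) auto
  then have "?f (m, g) = 0" by metis
  then show ?thesis by simp
qed

lemma sl_induct:
  assumes "x \<in> sl" "Q 0" "\<And>u v. Q u \<Longrightarrow> Q v \<Longrightarrow> Q (u + v)" "\<And>m u. u \<in> \<D> m \<Longrightarrow> Q u"
  shows "Q x"
proof -
  have "Q (diag_part m x)" for m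
    using assms(1) by (intro assms(4)[of _ m] diag_part_in_diagonal[of x UNIV]) (simp add: sl_on_UNIV)
  then have "Q (\<Sum>m\<in>S. diag_part m x)" for S
    by (induction S rule: infinite_finite_induct) (auto intro: assms)
  then show ?thesis using sum_diag_part[of x] by metis
qed

lemma upper_induct:
  assumes x: "x \<in> \<U> 0" and Q: "Q 0" "\<And>u v. Q u \<Longrightarrow> Q v \<Longrightarrow> Q (u + v)"
    and E: "\<And>m u. 0 \<le> m \<Longrightarrow> u \<in> \<D> m \<Longrightarrow> Q u"
  shows "Q x"
proof -
  have "Q (diag_part m x)" for m
  proof (cases "0 \<le> m")
    case True
    then show ?thesis by (intro E[of m] diag_part_in_diagonal[OF x])
  next
    case False
    have "diag_part m x $ i $ j = 0" for i j
      using False sl_onD[OF x, of i j] by (auto simp: diag_part_def diagonal_def upper_def)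
    then have "diag_part m x = 0" by (simp add: vec_eq_iff)
    then show ?thesis using Q by simp
  qed
  then have "Q (\<Sum>m\<in>S. diag_part m x)" for S
    by (induction S rule: infinite_finite_induct) (auto intro: Q)
  then show ?thesis using sum_diag_part[of x] by metis
qed

lemma diag_part_upper:
  assumes "x \<in> \<U> k" "m < int k"
  shows "diag_part m x = 0"
proof -
  have "diag_part m x $ i $ j = 0" for i j
    using assms(2) sl_onD[OF assms(1), of i j] by (auto simp: diag_part_def diagonal_def upper_def)
  then show ?thesis by (simp add: vec_eq_iff)
qed

lemma sl_on_upper_subset_sl: "sl_on K \<subseteq> sl" by (simp add: sl_on_def)

text \<open>
  The element \<open>deg_elt\<close> has degree zero in the induced integer grading, so the block-diagonals, being
  the eigenspaces of \<open>ad deg_elt\<close>, are graded subspaces. The nonnegative ones have the right degree by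
  hypothesis, and the trace form pairs the negative ones with the positive ones.
\<close>

lemma refines_diagonalsI:
  fixes A :: "int \<times> 'g::ab_group_add \<Rightarrow> ('f::field_char_0, 'n) sqmat set"
  assumes A: "is_grading sl A" and adm: "\<And>m. 0 \<le> m \<Longrightarrow> \<D> m \<subseteq> coarsening fst A m"
  shows "refines_diagonals A"
proof -
  let ?C = "coarsening fst A"
  have C: "is_grading sl ?C" by (rule coarsening_grading[OF A subspace_sl]) simp
  have "x \<in> \<D> m" if x: "x \<in> A (m, g)" for x m g
  proof -
    have xC: "x \<in> ?C m" using coarsening_base[of x A "(m, g)" fst] x by simp
    have xs: "x \<in> sl_on UNIV" using grading_subset[OF A] x by (auto simp: sl_on_UNIV)
    have part: "diag_part k x \<in> \<D> k" for k by (rule diag_part_in_diagonal[OF xs])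
    have d0: "deg_elt \<in> ?C 0" using adm[of 0] deg_elt_in by auto
    have partC: "diag_part k x \<in> ?C m" for k
      by (rule diag_part_in_component[of UNIV, OF _ d0 xC]) (simp add: sl_on_UNIV C)
    have "diag_part k x = 0" if "k \<noteq> m" for k
    proof (cases "0 \<le> k")
      case True
      then have "diag_part k x \<in> ?C k" using adm part by blast
      then show ?thesis using grading_disjoint[OF C partC] that by blast
    next
      case False
      show ?thesis
      proof (rule diagonal_nondegenerate[OF part])
        fix y :: "('f, 'n) sqmat" assume "y \<in> \<D> (- k)"
        then have "y \<in> ?C (- k)" using adm[of "- k"] False by auto
        then show "trace (diag_part k x ** y) = 0"
          using that by (intro trace_form_graded_sl[OF C partC]) auto
      qed
    qed
    then have "diag_part k x = diag_part k (diag_part m x)" for k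
      by (simp add: diag_part_homogeneous[OF part])
    then have "x = diag_part m x" by (rule diag_part_eqI)
    then show ?thesis using part by metis
  qed
  then show ?thesis using A by (auto simp: refines_diagonals_def)
qed

lemma restrict_to_upper:
  fixes A :: "int \<times> 'g::ab_group_add \<Rightarrow> ('f::field, 'n) sqmat set"
  assumes A: "refines_diagonals A"
  shows "is_grading (\<U> 0) (\<lambda>p. A p \<inter> \<U> 0)"
proof (rule restrict_grading[OF refines_diagonalsD(1)[OF A] subspace_sl subspace_sl_on sl_on_upper_subset_sl bracket_P])
  fix x :: "('f, 'n) sqmat" and p :: "int \<times> 'g" assume x: "x \<in> \<U> 0"
  then have xs: "x \<in> sl" using sl_on_upper_subset_sl by blast
  obtain m g where p: "p = (m, g)" by (cases p)
  show "component A x p \<in> \<U> 0"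
  proof (cases "0 \<le> m")
    case True
    have "component A x p \<in> A p" by (rule component_spec(1)[OF refines_diagonalsD(1)[OF A] xs])
    then show ?thesis using refines_diagonalsD(2)[OF A] diagonal_subset_upper[OF True] p by blast
  next
    case False
    then have "component A x p = 0"
      unfolding p using diag_part_upper[OF x, of m] by (intro refines_diagonals_component[OF A xs]) auto
    then show ?thesis by (simp add: sl_on_zero)
  qed
qed

lemma nonneg_part_eq_coarsening:
  fixes A :: "int \<times> 'g::ab_group_add \<Rightarrow> ('f::field, 'n) sqmat set"
  assumes A: "refines_diagonals A"
  shows "nonneg_part A = coarsening snd (\<lambda>p. A p \<inter> \<U> 0)"
proof
  fix g
  let ?U = "\<Union>m\<in>{0..}. A (m, g)" and ?V = "\<Union>p\<in>snd -` {g}. A p \<inter> \<U> 0"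
  have "?U \<subseteq> ?V"
    using refines_diagonalsD(2)[OF A] diagonal_subset_upper by fastforce
  moreover have "?V \<subseteq> mats.span ?U"
  proof
    fix x assume "x \<in> ?V"
    then obtain m where x: "x \<in> A (m, g)" "x \<in> \<U> 0" by auto
    show "x \<in> mats.span ?U"
    proof (cases "0 \<le> m")
      case True
      then show ?thesis using x by (intro mats.span_base) auto
    next
      case False
      then have "x = 0"
        using diag_part_upper[OF x(2), of m] diag_part_homogeneous[OF refines_diagonalsD(2)[OF A x(1)], of m] by simp
      then show ?thesis by (simp add: mats.span_zero)
    qed
  qed
  ultimately show "nonneg_part A g = coarsening snd (\<lambda>p. A p \<inter> \<U> 0) g"
    unfolding nonneg_part_def coarsening_def
    by (meson mats.span_mono mats.span_minimal mats.subspace_span subset_antisym)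
qed

lemma nonneg_part_grading:
  fixes A :: "int \<times> 'g::ab_group_add \<Rightarrow> ('f::field, 'n) sqmat set"
  assumes "refines_diagonals A"
  shows "is_grading (\<U> 0) (nonneg_part A)"
  unfolding nonneg_part_eq_coarsening[OF assms]
  by (rule coarsening_grading[OF restrict_to_upper[OF assms] subspace_sl_on]) simp

lemma nonneg_part_induct [consumes 2, case_names base zero add]:
  assumes x: "x \<in> nonneg_part A g" and sub: "\<And>p. mats.subspace (A p)"
    and base: "\<And>m u. 0 \<le> m \<Longrightarrow> u \<in> A (m, g) \<Longrightarrow> Q u" and zero: "Q 0" and add: "\<And>u v. Q u \<Longrightarrow> Q v \<Longrightarrow> Q (u + v)"
  shows "Q x"
  using x unfolding nonneg_part_def
proof (induction rule: mats.span_induct_alt)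
  case (step c u v)
  then obtain m where "0 \<le> m" "u \<in> A (m, g)" by auto
  then show ?case by (intro add base[of m] mats.subspace_scale[OF sub] step)
qed (rule zero)

lemma nonneg_part_base: "0 \<le> m \<Longrightarrow> x \<in> A (m, g) \<Longrightarrow> x \<in> nonneg_part A g"
  unfolding nonneg_part_def by (rule mats.span_base) auto

lemma subspace_nonneg_part: "mats.subspace (nonneg_part A g)"
  unfolding nonneg_part_def by (rule mats.subspace_span)

lemma diag_part_nonneg_part:
  fixes A :: "int \<times> 'g::ab_group_add \<Rightarrow> ('f::field, 'n) sqmat set"
  assumes A: "refines_diagonals A" and x: "x \<in> nonneg_part A g" 
  shows "diag_part m x \<in> A (m, g)"
proof -
  note sub = grading_subspace[OF refines_diagonalsD(1)[OF A]]
  show ?thesis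
    using x sub
  proof (induction rule: nonneg_part_induct)
    case (base k u)
    then show ?case
      by (simp add: diag_part_homogeneous[OF refines_diagonalsD(2)[OF A]] mats.subspace_0[OF sub])
  qed (simp_all add: diag_part_add mats.subspace_0[OF sub] mats.subspace_add[OF sub])
qed

text \<open>An isomorphism of two such gradings of \<open>sl\<close> preserves all block-diagonals, so it restricts.\<close>

lemma nonneg_part_iso:
  fixes A A' :: "int \<times> 'g::ab_group_add \<Rightarrow> ('f::field, 'n) sqmat set"
  assumes A: "refines_diagonals A" and A': "refines_diagonals A'" and iso: "(A, A') \<in> grading_iso sl"
  shows "(nonneg_part A, nonneg_part A') \<in> grading_iso (\<U> 0)"
proof -
  let ?P = "\<U> 0 :: ('f, 'n) sqmat set"
  obtain \<phi> where \<phi>: "lie_automorphism sl \<phi>" and \<phi>A: "\<And>p. \<phi> ` A p = A' p"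
    using iso by (auto simp: grading_iso_def)
  define \<phi>' where "\<phi>' = inv_into sl \<phi>"
  have bij: "bij_betw \<phi> sl sl" using \<phi> by (simp add: lie_automorphism_def)
  have \<phi>': "lie_automorphism sl \<phi>'"
    unfolding \<phi>'_def by (rule lie_automorphism_inv[OF \<phi> subspace_sl]) (simp add: sl_def)
  have \<phi>'A: "\<phi>' ` A' p = A p" for p
    using bij_betw_inv_into_left[OF bij] grading_subset[OF refines_diagonalsD(1)[OF A], of p]
    unfolding \<phi>A[symmetric] \<phi>'_def by (force simp: image_image)
  have E: "\<theta> x \<in> \<D> m"
    if \<theta>: "lie_automorphism sl \<theta>" and C: "refines_diagonals C" and C': "refines_diagonals C'"
      and \<theta>C: "\<And>p. \<theta> ` C p = C' p" and x: "x \<in> \<D> m"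
    for \<theta> and C C' :: "int \<times> 'g \<Rightarrow> ('f, 'n) sqmat set" and x m
  proof -
    note gr = refines_diagonalsD(1)[OF C]
    have xs: "x \<in> sl" using x by (simp add: sl_on_def)
    have "\<theta> (component C x p) \<in> \<D> m" for p
    proof (cases "fst p = m")
      case True
      have "component C x p \<in> C p" by (rule component_spec(1)[OF gr xs])
      then have "\<theta> (component C x p) \<in> C' (m, snd p)" using \<theta>C[of p] True by (metis image_eqI prod.collapse)
      then show ?thesis by (rule refines_diagonalsD(2)[OF C'])
    next
      case False
      then have "component C x p = 0"
        using refines_diagonals_component[OF C xs, of "fst p" "snd p"] diag_part_homogeneous[OF x, of "fst p"] by simp
      then show ?thesis
        by (simp add: lie_automorphism_zero[OF \<theta> subspace_sl] sl_on_zero)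
    qed
    then have "(\<Sum>p | component C x p \<noteq> 0. \<theta> (component C x p)) \<in> \<D> m"
      by (intro sl_on_sum)
    moreover have "\<theta> x = (\<Sum>p | component C x p \<noteq> 0. \<theta> (component C x p))"
      using lie_automorphism_sum[OF \<theta> subspace_sl, of "{p. component C x p \<noteq> 0}" "component C x"]
        component_spec[OF gr xs] grading_subset[OF gr] by (metis subsetD)
    ultimately show ?thesis by simp
  qed
  have up: "\<theta> x \<in> ?P" if \<theta>: "lie_automorphism sl \<theta>" and C: "refines_diagonals C" "refines_diagonals C'"
      and \<theta>C: "\<And>p. \<theta> ` C p = C' p" and x: "x \<in> ?P"
    for \<theta> and C C' :: "int \<times> 'g \<Rightarrow> ('f, 'n) sqmat set" and x
  proof -
    have "x \<in> sl \<and> \<theta> x \<in> ?P"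
      using x
    proof (rule upper_induct)
      show "u \<in> sl \<and> \<theta> u \<in> ?P" if "0 \<le> m" "u \<in> \<D> m" for m u
        using E[OF \<theta> C \<theta>C that(2)] that diagonal_subset_upper[OF that(1)] by (auto simp: sl_on_def)
    qed (use \<theta> in \<open>auto simp: lie_automorphism_zero[OF \<theta> subspace_sl] lie_automorphism_def
      sl_on_zero mats.subspace_0[OF subspace_sl] sl_on_add mats.subspace_add[OF subspace_sl]\<close>)
    then show ?thesis by simp
  qed
  have "bij_betw \<phi> ?P ?P"
    by (rule bij_betw_byWitness[where f' = \<phi>'])
      (use up[OF \<phi> A A' \<phi>A] up[OF \<phi>' A' A \<phi>'A] sl_on_upper_subset_sl[of "upper 0"]
        bij_betw_inv_into_left[OF bij] bij_betw_inv_into_right[OF bij] in \<open>auto simp: \<phi>'_def\<close>)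
  then have aut: "lie_automorphism ?P \<phi>"
    using \<phi> sl_on_upper_subset_sl[of "upper 0"] unfolding lie_automorphism_def by blast
  have "\<phi> ` nonneg_part A g \<subseteq> nonneg_part A' g" for g
  proof clarify
    fix x assume "x \<in> nonneg_part A g"
    then have "x \<in> sl \<and> \<phi> x \<in> nonneg_part A' g"
      using grading_subspace[OF refines_diagonalsD(1)[OF A]]
    proof (induction rule: nonneg_part_induct)
      case (base m u)
      then show ?case using \<phi>A[of "(m, g)"] nonneg_part_base[of m _ A' g] grading_subset[OF refines_diagonalsD(1)[OF A]] by blast
    qed (use \<phi> in \<open>auto simp: lie_automorphism_zero[OF \<phi> subspace_sl] lie_automorphism_def
      mats.subspace_0[OF subspace_nonneg_part] mats.subspace_0[OF subspace_sl]
      mats.subspace_add[OF subspace_nonneg_part] mats.subspace_add[OF subspace_sl]\<close>)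
    then show "\<phi> x \<in> nonneg_part A' g" by simp
  qed
  then show ?thesis
    by (intro grading_isoI[OF nonneg_part_grading[OF A] nonneg_part_grading[OF A'] aut subspace_sl_on])
qed

text \<open>
  After normalization all block-diagonals are graded subspaces, which refines the grading by an
  integer degree; the refined grading extends to \<open>sl\<close>.
\<close>

lemma ex_nonneg_part_iso:
  fixes B :: "'g::ab_group_add \<Rightarrow> ('f::field_char_0, 'n) sqmat set"
  assumes B: "is_grading (\<U> 0) B"
  shows "\<exists>A. is_grading sl A \<and> (\<forall>m\<ge>0. \<D> m \<subseteq> coarsening fst A m) \<and>
    (B, nonneg_part A) \<in> grading_iso (\<U> 0)"
proof -
  note L = subspace_sl_on[of "upper 0"]
  obtain \<phi> where \<phi>: "lie_automorphism (\<U> 0) \<phi>" and d: "deg_elt \<in> \<phi> ` B 0"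
    using normalize_grading[OF B] by blast
  define B' where "B' g = \<phi> ` B g" for g
  have B': "is_grading (\<U> 0) B'" unfolding B'_def by (rule image_grading[OF B \<phi> L])
  have d': "deg_elt \<in> B' 0" using d by (simp add: B'_def)
  let ?A = "extend_grading B'"
  have A: "is_grading sl ?A" by (rule is_grading_extend_grading[OF B' d'])
  have "nonneg_part ?A = B'"
  proof (intro ext subset_antisym subsetI)
    fix g x assume "x \<in> nonneg_part ?A g"
    then show "x \<in> B' g"
      using grading_subspace[OF A]
      by (induction rule: nonneg_part_induct)
        (auto simp: extend_grading_nonneg mats.subspace_0[OF grading_subspace[OF B']] mats.subspace_add[OF grading_subspace[OF B']])
  next
    fix g x assume x: "x \<in> B' g"
    then have xP: "x \<in> \<U> 0" using grading_subset[OF B'] by blast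
    have "diag_part m x \<in> nonneg_part ?A g" for m
    proof (cases "0 \<le> m")
      case True
      then show ?thesis
        using diag_part_in_component[OF B' d' x] diag_part_in_diagonal[OF xP]
        by (intro nonneg_part_base[OF True]) (simp add: extend_grading_nonneg)
    next
      case False
      then show ?thesis using diag_part_upper[OF xP, of m] mats.subspace_0[OF subspace_nonneg_part] by simp
    qed
    then have "(\<Sum>m\<in>{- int s..int s}. diag_part m x) \<in> nonneg_part ?A g"
      by (intro mats.subspace_sum[OF subspace_nonneg_part])
    then show "x \<in> nonneg_part ?A g" by (simp add: sum_diag_part)
  qed
  moreover have "x \<in> coarsening fst ?A m" if m: "0 \<le> m" and x: "x \<in> \<D> m" for m x
  proof -
    have xP: "x \<in> \<U> 0" using x diagonal_subset_upper[OF m] by blast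
    have csub: "mats.subspace (coarsening fst ?A m)" unfolding coarsening_def by (rule mats.subspace_span)
    show ?thesis
    proof (rule component_induct[OF B' xP])
      fix g
      have "component B' x g \<in> ?A (m, g)"
        using component_spec(1)[OF B' xP] component_in_diagonal[OF B' d' xP x] m by (simp add: extend_grading_nonneg)
      then show "component B' x g \<in> coarsening fst ?A m" using coarsening_base[of _ ?A "(m, g)" fst] by simp
    qed (simp_all add: mats.subspace_0[OF csub] mats.subspace_add[OF csub])
  qed
  moreover have "(B, B') \<in> grading_iso (\<U> 0)"
    by (rule grading_isoI[OF B B' \<phi> L]) (simp add: B'_def)
  ultimately show ?thesis using A by (intro exI[of _ ?A]) auto
qed

end

section \<open>Graded automorphisms and their extension\<close>

context blocks
begin

text \<open>
  For \<open>k = 1\<close> these matrices are the radical of the Killing form, which automorphisms preserve; for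
  larger \<open>k\<close> they are spanned by iterated brackets of elements of the radical.
\<close>

lemma automorphism_upper:
  fixes x :: "('f::field_char_0, 'n) sqmat"
  assumes \<psi>: "lie_automorphism (\<U> 0) \<psi>" and x: "x \<in> \<U> k"
  shows "\<psi> x \<in> \<U> k"
  using x
proof (induction k arbitrary: x)
  case 0
  then show ?case using \<psi> by (auto simp: lie_automorphism_def bij_betw_def)
next
  case (Suc k)
  note L = subspace_sl_on[of "upper 0"]
  have bij: "bij_betw \<psi> (\<U> 0) (\<U> 0)" using \<psi> by (simp add: lie_automorphism_def)
  then have \<psi>P: "\<psi> y \<in> \<U> 0" if "y \<in> \<U> 0" for y using that by (auto simp: bij_betw_def)
  have one: "\<psi> y \<in> \<U> 1" if y: "y \<in> \<U> 1" for y
  proof -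
    have yP: "y \<in> \<U> 0" using y sl_on_upper_1 by blast
    have "killing (upper 0) (\<psi> y) z = 0" if "z \<in> \<U> 0" for z
    proof -
      obtain z' where z': "z' \<in> \<U> 0" "z = \<psi> z'" using bij \<open>z \<in> \<U> 0\<close> by (auto simp: bij_betw_def)
      then show ?thesis
        using killing_automorphism[OF upper_0_refl upper_0_trans \<psi> yP z'(1)] killing_radical[OF yP] y by simp
    qed
    then show ?thesis using killing_radical[OF \<psi>P[OF yP]] by blast
  qed
  show ?case
  proof (cases "k = 0")
    case True
    then show ?thesis using one Suc.prems by simp
  next
    case False
    have irrefl: "Id \<inter> upper (Suc k) = {}" by (auto simp: upper_def)
    have "x \<in> \<U> 0 \<and> \<psi> x \<in> \<U> (Suc k)"
      using Suc.prems irrefl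
    proof (induction rule: supported_bracket_induct[where I = "upper 1" and I' = "upper k"])
      case (factor i j)
      then obtain l where "b l = b i + 1" using ex_block[of "b i + 1"] b_less[of j] by (auto simp: upper_def)
      then show ?case using factor False by (intro exI[of _ l]) (auto simp: upper_def)
    next
      case zero
      show ?case by (simp add: lie_automorphism_zero[OF \<psi> L] sl_on_zero)
    next
      case (add u v)
      then show ?case using \<psi> by (simp add: lie_automorphism_def sl_on_add)
    next
      case (bracket y z)
      then have yz: "y \<in> \<U> 0" "z \<in> \<U> 0"
        using sl_on_upper_1 sl_on_mono[OF upper_mono[of 0 k]] by auto
      have "bracket (\<psi> y) (\<psi> z) \<in> \<U> (1 + k)"
        by (rule bracket_upper[OF one[OF bracket(1)] Suc.IH[OF bracket(2)]])
      then show ?case using \<psi> yz bracket_P[OF yz] by (simp add: lie_automorphism_def)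
    qed
    then show ?thesis ..
  qed
qed

text \<open>
  The map induced by \<open>\<psi>\<close> on the associated graded algebra of the filtration by \<open>\<U> k\<close>, which is
  identified with the block-triangular algebra itself.
\<close>

definition graded_map ::
    "(('f::field, 'n) sqmat \<Rightarrow> ('f, 'n) sqmat) \<Rightarrow> ('f, 'n) sqmat \<Rightarrow> ('f, 'n) sqmat" where
  "graded_map \<psi> x = (\<Sum>m\<in>{0..int s}. diag_part m (\<psi> (diag_part m x)))"

lemma graded_map_homogeneous:
  assumes \<psi>0: "\<psi> 0 = 0" and x: "x \<in> \<D> m" and m: "0 \<le> m"
  shows "graded_map \<psi> x = diag_part m (\<psi> x)"
proof -
  have "graded_map \<psi> x = (\<Sum>k\<in>{0..int s}. if k = m then diag_part m (\<psi> x) else 0)"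
    unfolding graded_map_def by (rule sum.cong) (auto simp: diag_part_homogeneous[OF x] \<psi>0)
  moreover have "x = 0" if "int s < m"
    using diag_part_trivial[of m x] diag_part_homogeneous[OF x, of m] that by simp
  ultimately show ?thesis using m \<psi>0 by (cases "int s < m") auto
qed

lemma diag_part_remainder:
  assumes "x \<in> \<U> k"
  shows "x - diag_part (int k) x \<in> \<U> (Suc k)"
proof -
  have "(x - diag_part (int k) x) $ i $ j = 0" if "(i, j) \<notin> upper (Suc k)" for i j
    using that sl_onD[OF assms, of i j] by (auto simp: diag_part_def diagonal_def upper_def)
  moreover have "x - diag_part (int k) x \<in> sl"
    using assms diag_part_in_same[OF assms] sl_on_upper_subset_sl mats.subspace_diff[OF subspace_sl] by blast
  ultimately show ?thesis by (simp add: sl_on_def supported_def)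
qed

lemma diag_part_bracket:
  assumes x: "x \<in> \<U> k" and y: "y \<in> \<U> l"
  shows "diag_part (int k + int l) (bracket x y) = bracket (diag_part (int k) x) (diag_part (int l) y)"
proof -
  define x' y' where "x' = diag_part (int k) x" and "y' = diag_part (int l) y"
  have x': "x' \<in> \<D> (int k)" and y': "y' \<in> \<D> (int l)"
    unfolding x'_def y'_def by (rule diag_part_in_diagonal[OF x], rule diag_part_in_diagonal[OF y])
  have "x' \<in> \<U> k" unfolding x'_def by (rule diag_part_in_same[OF x])
  have "bracket x y = bracket x' y' + (bracket x' (y - y') + bracket (x - x') y)"
    by (simp add: bracket_def mult_diff_mat algebra_simps)
  moreover have "diag_part (int k + int l) (bracket x' (y - y')) = 0"
    using bracket_upper[OF \<open>x' \<in> \<U> k\<close> diag_part_remainder[OF y]] unfolding y'_def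
    by (rule diag_part_upper) simp
  moreover have "diag_part (int k + int l) (bracket (x - x') y) = 0"
    using bracket_upper[OF diag_part_remainder[OF x] y] unfolding x'_def
    by (rule diag_part_upper) simp
  moreover have "diag_part (int k + int l) (bracket x' y') = bracket x' y'"
    using diag_part_homogeneous[OF bracket_diagonal[OF x' y']] by simp
  ultimately show ?thesis by (simp add: diag_part_add x'_def y'_def)
qed

lemma diagonal_in_upper: "0 \<le> m \<Longrightarrow> x \<in> \<D> m \<Longrightarrow> x \<in> \<U> (nat m)"
  using sl_on_mono[OF diagonal_upper[of "nat m" m]] by auto

text \<open>
  Passing to leading terms is compatible with composition and with brackets. In particular the
  leading terms of the inverse give the inverse.
\<close>

lemma graded_map_automorphism:
  fixes \<psi> :: "('f::field_char_0, 'n) sqmat \<Rightarrow> ('f, 'n) sqmat"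
  assumes \<psi>: "lie_automorphism (\<U> 0) \<psi>"
  defines "\<psi>' \<equiv> inv_into (\<U> 0) \<psi>"
  shows "lie_automorphism (\<U> 0) (graded_map \<psi>)"
    and "x \<in> \<U> 0 \<Longrightarrow> graded_map \<psi>' (graded_map \<psi> x) = x"
    and "x \<in> \<U> 0 \<Longrightarrow> graded_map \<psi> (graded_map \<psi>' x) = x"
proof -
  let ?P = "\<U> 0 :: ('f, 'n) sqmat set"
  note L = subspace_sl_on[of "upper 0"]
  have \<psi>': "lie_automorphism ?P \<psi>'" unfolding \<psi>'_def by (rule lie_automorphism_inv[OF \<psi> L bracket_P])
  have bij: "bij_betw \<psi> ?P ?P" using \<psi> by (simp add: lie_automorphism_def)
  have aut: "\<theta> 0 = 0" "\<And>x. x \<in> ?P \<Longrightarrow> \<theta> x \<in> ?P" "\<And>x y. x \<in> ?P \<Longrightarrow> y \<in> ?P \<Longrightarrow> \<theta> (x + y) = \<theta> x + \<theta> y"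
    "\<And>c x. x \<in> ?P \<Longrightarrow> \<theta> (mat_smult c x) = mat_smult c (\<theta> x)"
    "\<And>x y. x \<in> ?P \<Longrightarrow> y \<in> ?P \<Longrightarrow> \<theta> (bracket x y) = bracket (\<theta> x) (\<theta> y)"
    if "lie_automorphism ?P \<theta>" for \<theta>
    using that lie_automorphism_zero[OF that L] by (auto simp: lie_automorphism_def bij_betw_def)
  have in_P: "graded_map \<theta> x \<in> ?P" if "lie_automorphism ?P \<theta>" "x \<in> ?P" for \<theta> x
    unfolding graded_map_def
    by (intro mats.subspace_sum[OF L] diag_part_in_same aut(2)[OF that(1)] that(2))
  have add: "graded_map \<theta> (x + y) = graded_map \<theta> x + graded_map \<theta> y"
    if "lie_automorphism ?P \<theta>" "x \<in> ?P" "y \<in> ?P" for \<theta> x y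
    unfolding graded_map_def
    by (simp add: diag_part_add aut(3)[OF that(1) diag_part_in_same diag_part_in_same, OF that(2,3)] sum.distrib)
  have inv: "graded_map \<theta>' (graded_map \<theta> x) = x"
    if \<theta>: "lie_automorphism ?P \<theta>" and \<theta>': "lie_automorphism ?P \<theta>'" and \<theta>\<theta>': "\<And>x. x \<in> ?P \<Longrightarrow> \<theta>' (\<theta> x) = x"
      and x: "x \<in> ?P" for \<theta> \<theta>' x
  proof -
    have "x \<in> ?P \<and> graded_map \<theta>' (graded_map \<theta> x) = x"
      using x
    proof (rule upper_induct)
      fix m and u :: "('f, 'n) sqmat" assume m: "0 \<le> m" and u: "u \<in> \<D> m"
      have uP: "u \<in> ?P" using u diagonal_subset_upper[OF m] by blast
      have uk: "u \<in> \<U> (nat m)" by (rule diagonal_in_upper[OF m u])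
      have \<theta>u: "\<theta> u \<in> \<U> (nat m)" by (rule automorphism_upper[OF \<theta> uk])
      \<comment> \<open>The leading term of \<open>\<theta> u\<close>; the remainder lies deeper in the filtration, and \<open>\<theta>'\<close> keeps it there.\<close>
      define w where "w = diag_part m (\<theta> u)"
      have w: "w \<in> \<D> m" unfolding w_def by (rule diag_part_in_diagonal[OF \<theta>u])
      have wP: "w \<in> ?P" using w diagonal_subset_upper[OF m] by blast
      have r: "\<theta> u - w \<in> sl_on (upper (Suc (nat m)))"
        using diag_part_remainder[OF \<theta>u] m by (simp add: w_def)
      then have "\<theta>' (\<theta> u - w) \<in> sl_on (upper (Suc (nat m)))" by (rule automorphism_upper[OF \<theta>'])
      then have 0: "diag_part m (\<theta>' (\<theta> u - w)) = 0" by (rule diag_part_upper) (use m in simp)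
      have rP: "\<theta> u - w \<in> ?P" by (rule mats.subspace_diff[OF L aut(2)[OF \<theta> uP] wP])
      have "u = \<theta>' (w + (\<theta> u - w))" using \<theta>\<theta>'[OF uP] by simp
      also have "\<dots> = \<theta>' w + \<theta>' (\<theta> u - w)" by (rule aut(3)[OF \<theta>' wP rP])
      finally have "diag_part m u = diag_part m (\<theta>' w)" using 0 by (metis add.right_neutral diag_part_add)
      then have "diag_part m (\<theta>' w) = u" using diag_part_homogeneous[OF u, of m] by simp
      then show "u \<in> ?P \<and> graded_map \<theta>' (graded_map \<theta> u) = u"
        using uP by (simp add: graded_map_homogeneous[of \<theta>, OF aut(1)[OF \<theta>] u m]
          graded_map_homogeneous[of \<theta>', OF aut(1)[OF \<theta>'] w m] flip: w_def)
    next
      show "0 \<in> ?P \<and> graded_map \<theta>' (graded_map \<theta> 0) = 0"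
        by (simp add: graded_map_def aut(1)[OF \<theta>] aut(1)[OF \<theta>'] mats.subspace_0[OF L])
    next
      show "u + v \<in> ?P \<and> graded_map \<theta>' (graded_map \<theta> (u + v)) = u + v"
        if "u \<in> ?P \<and> graded_map \<theta>' (graded_map \<theta> u) = u" "v \<in> ?P \<and> graded_map \<theta>' (graded_map \<theta> v) = v" for u v
        using that by (simp add: add[OF \<theta>] add[OF \<theta>'] in_P[OF \<theta>] mats.subspace_add[OF L])
    qed
    then show ?thesis ..
  qed
  have l: "\<psi>' (\<psi> x) = x" and r: "\<psi> (\<psi>' x) = x" if "x \<in> ?P" for x
    using that bij by (simp_all add: \<psi>'_def bij_betw_inv_into_left bij_betw_inv_into_right)
  show 1: "x \<in> ?P \<Longrightarrow> graded_map \<psi>' (graded_map \<psi> x) = x" for x by (rule inv[OF \<psi> \<psi>' l])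
  show 2: "x \<in> ?P \<Longrightarrow> graded_map \<psi> (graded_map \<psi>' x) = x" for x by (rule inv[OF \<psi>' \<psi> r])
  have br: "graded_map \<psi> (bracket x y) = bracket (graded_map \<psi> x) (graded_map \<psi> y)" if "x \<in> ?P" "y \<in> ?P" for x y
  proof -
    have "x \<in> ?P \<and> graded_map \<psi> (bracket x y) = bracket (graded_map \<psi> x) (graded_map \<psi> y)"
      using that(1)
    proof (rule upper_induct)
      fix m and u :: "('f, 'n) sqmat" assume m: "0 \<le> m" and u: "u \<in> \<D> m"
      have uP: "u \<in> ?P" using u diagonal_subset_upper[OF m] by blast
      have "y \<in> ?P \<and> graded_map \<psi> (bracket u y) = bracket (graded_map \<psi> u) (graded_map \<psi> y)"
        using that(2)
      proof (rule upper_induct)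
        fix k and v :: "('f, 'n) sqmat" assume k: "0 \<le> k" and v: "v \<in> \<D> k"
        have vP: "v \<in> ?P" using v diagonal_subset_upper[OF k] by blast
        have uv: "bracket u v \<in> \<D> (m + k)" by (rule bracket_diagonal[OF u v])
        have "graded_map \<psi> (bracket u v) = diag_part (m + k) (\<psi> (bracket u v))"
          by (rule graded_map_homogeneous[of \<psi>, OF aut(1)[OF \<psi>] uv]) (use m k in simp)
        also have "\<dots> = diag_part (int (nat m) + int (nat k)) (bracket (\<psi> u) (\<psi> v))"
          using m k by (simp add: aut(5)[OF \<psi> uP vP])
        also have "\<dots> = bracket (diag_part (int (nat m)) (\<psi> u)) (diag_part (int (nat k)) (\<psi> v))"
          by (intro diag_part_bracket automorphism_upper[OF \<psi>] diagonal_in_upper m k u v)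
        also have "\<dots> = bracket (graded_map \<psi> u) (graded_map \<psi> v)"
          using m k by (simp add: graded_map_homogeneous[of \<psi>, OF aut(1)[OF \<psi>] u m] graded_map_homogeneous[of \<psi>, OF aut(1)[OF \<psi>] v k])
        finally show "v \<in> ?P \<and> graded_map \<psi> (bracket u v) = bracket (graded_map \<psi> u) (graded_map \<psi> v)" using vP by simp
      qed (simp_all add: bracket_linear add[OF \<psi>] bracket_P uP mats.subspace_0[OF L] mats.subspace_add[OF L],
           simp add: graded_map_def aut(1)[OF \<psi>] bracket_linear)
      then show "u \<in> ?P \<and> graded_map \<psi> (bracket u y) = bracket (graded_map \<psi> u) (graded_map \<psi> y)" using uP by simp
    qed (simp_all add: bracket_linear add[OF \<psi>] bracket_P that(2) mats.subspace_0[OF L] mats.subspace_add[OF L],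
           simp add: graded_map_def aut(1)[OF \<psi>] bracket_linear)
    then show ?thesis ..
  qed
  show "lie_automorphism ?P (graded_map \<psi>)"
    unfolding lie_automorphism_def
  proof (intro conjI ballI allI)
    show "bij_betw (graded_map \<psi>) ?P ?P"
      by (rule bij_betw_byWitness[where f' = "graded_map \<psi>'"]) (use 1 2 in_P[OF \<psi>] in_P[OF \<psi>'] in auto)
    show "graded_map \<psi> (mat_smult c x) = mat_smult c (graded_map \<psi> x)" if "x \<in> ?P" for c x
      unfolding graded_map_def
      by (simp add: diag_part_smult aut(4)[OF \<psi> diag_part_in_same[OF that]] mats.scale_sum_right)
  qed (use add[OF \<psi>] br in auto)
qed

lemma graded_map_diagonal:
  assumes \<psi>: "lie_automorphism (\<U> 0) \<psi>" and m: "0 \<le> m" and x: "x \<in> \<D> m"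
  shows "graded_map \<psi> x \<in> \<D> m"
proof -
  have xP: "x \<in> \<U> 0" using x diagonal_subset_upper[OF m] by blast
  have "\<psi> x \<in> \<U> 0" using \<psi> xP by (auto simp: lie_automorphism_def bij_betw_def)
  then show ?thesis
    using graded_map_homogeneous[of \<psi>, OF lie_automorphism_zero[OF \<psi> subspace_sl_on] x m] diag_part_in_diagonal by metis
qed

text \<open>
  A graded automorphism restricts to the block-diagonal part, so it preserves both Killing forms
  of which the trace form is a combination.
\<close>

lemma graded_automorphism_isometry:
  fixes \<theta> :: "('f::field_char_0, 'n) sqmat \<Rightarrow> ('f, 'n) sqmat"
  assumes \<theta>: "lie_automorphism (\<U> 0) \<theta>"
    and \<theta>E: "\<And>x. x \<in> \<D> 0 \<Longrightarrow> \<theta> x \<in> \<D> 0"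
    and \<theta>'E: "\<And>x. x \<in> \<D> 0 \<Longrightarrow> \<theta>' x \<in> \<D> 0"
    and inv: "\<And>x. x \<in> \<U> 0 \<Longrightarrow> \<theta>' (\<theta> x) = x" "\<And>x. x \<in> \<U> 0 \<Longrightarrow> \<theta> (\<theta>' x) = x"
    and xy: "x \<in> \<D> 0" "y \<in> \<D> 0"
  shows "trace (\<theta> x ** \<theta> y) = trace (x ** y)"
proof -
  have sub: "\<D> 0 \<subseteq> (\<U> 0 :: ('f, 'n) sqmat set)" by (rule diagonal_subset_upper) simp
  have "bij_betw \<theta> (\<D> 0) (\<D> 0)"
    by (rule bij_betw_byWitness[where f' = \<theta>']) (use inv sub \<theta>E \<theta>'E in auto)
  then have "lie_automorphism (\<D> 0) \<theta>" using \<theta> sub unfolding lie_automorphism_def by blast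
  then have D: "killing (diagonal 0) (\<theta> x) (\<theta> y) = killing (diagonal 0) x y"
    by (rule killing_automorphism[OF diagonal_0_refl diagonal_0_trans _ xy])
  have U: "killing (upper 0) (\<theta> x) (\<theta> y) = killing (upper 0) x y"
    by (rule killing_automorphism[OF upper_0_refl upper_0_trans \<theta>]) (use xy sub in auto)
  have "2 * of_nat CARD('n) * trace (\<theta> x ** \<theta> y) = 2 * of_nat CARD('n) * trace (x ** y)"
    using trace_form_eq_killing[of "\<theta> x" "\<theta> y"] trace_form_eq_killing[of x y] \<theta>E xy sub D U by (simp add: subset_iff)
  then show ?thesis by simp
qed

definition upper_part :: "('f::field, 'n) sqmat \<Rightarrow> ('f, 'n) sqmat" where
  "upper_part x = (\<chi> i j. if (i, j) \<in> upper 0 then x $ i $ j else 0)"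

text \<open>
  Below the block diagonal the entries are those of the adjoint of \<open>\<theta>'\<close> for the trace form. With
  \<open>\<theta>'\<close> the inverse of \<open>\<theta>\<close>, this is the only way to extend an isometry \<open>\<theta>\<close> to an automorphism
  of \<open>sl\<close>, because automorphisms of \<open>sl\<close> preserve the trace form.
\<close>

definition extend_automorphism ::
    "(('f::field, 'n) sqmat \<Rightarrow> ('f, 'n) sqmat) \<Rightarrow> (('f, 'n) sqmat \<Rightarrow> ('f, 'n) sqmat) \<Rightarrow> ('f, 'n) sqmat \<Rightarrow> ('f, 'n) sqmat" where
  "extend_automorphism \<theta> \<theta>' x =
     \<theta> (upper_part x) + (\<chi> i j. if (i, j) \<in> upper 0 then 0 else trace (x ** \<theta>' (munit j i)))"

lemma upper_part_in: "x \<in> sl \<Longrightarrow> upper_part x \<in> \<U> 0"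
proof -
  assume "x \<in> sl"
  moreover have "upper_part x $ i $ i = x $ i $ i" for i by (simp add: upper_part_def upper_def)
  ultimately have "upper_part x \<in> sl" by (simp add: sl_def trace_def)
  then show ?thesis by (simp add: sl_on_def supported_def upper_part_def)
qed

lemma upper_part_id: "x \<in> \<U> 0 \<Longrightarrow> upper_part x = x"
  by (rule mat_eqI) (auto simp: upper_part_def dest: sl_onD)

lemma trace_upper_strict:
  assumes "x \<in> \<U> 0" "y \<in> \<U> 1"
  shows "trace (x ** y) = 0"
proof -
  have "x ** y \<in> supported (upper (0 + 1))" using assms by (intro upper_mult) (auto simp: sl_on_def)
  then have "(x ** y) $ i $ i = 0" for i by (rule supportedD) (simp add: upper_def)
  then show ?thesis by (simp add: trace_def)
qed

end

locale graded_automorphism = blocks b s for b :: "'n::finite \<Rightarrow> nat" and s +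
  fixes \<theta> \<theta>' :: "('f::field_char_0, 'n) sqmat \<Rightarrow> ('f, 'n) sqmat"
  assumes aut: "lie_automorphism (\<U> 0) \<theta>" and aut': "lie_automorphism (\<U> 0) \<theta>'"
    and left_inv: "\<And>x. x \<in> \<U> 0 \<Longrightarrow> \<theta>' (\<theta> x) = x"
    and right_inv: "\<And>x. x \<in> \<U> 0 \<Longrightarrow> \<theta> (\<theta>' x) = x"
    and diag: "\<And>m x. 0 \<le> m \<Longrightarrow> x \<in> \<D> m \<Longrightarrow> \<theta> x \<in> \<D> m"
    and diag': "\<And>m x. 0 \<le> m \<Longrightarrow> x \<in> \<D> m \<Longrightarrow> \<theta>' x \<in> \<D> m"
begin

abbreviation "\<Theta> \<equiv> extend_automorphism \<theta> \<theta>'"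

lemma swapped: "graded_automorphism b s \<theta>' \<theta>"
  by (intro graded_automorphism.intro graded_automorphism_axioms.intro blocks_axioms aut aut' left_inv right_inv diag diag')

lemma lower_munit: "(i, j) \<notin> upper 0 \<Longrightarrow> munit j i \<in> (sl_on (diagonal (int (b i) - int (b j))) :: ('f, 'n) sqmat set)"
  and lower_munit_upper: "(i, j) \<notin> upper 0 \<Longrightarrow> munit j i \<in> (\<U> 0 :: ('f, 'n) sqmat set)"
  by (auto simp: diagonal_def upper_def intro!: munit_sl_on)

lemma \<theta>'_strict: "(i, j) \<notin> upper 0 \<Longrightarrow> \<theta>' (munit j i) \<in> \<U> 1"
  by (rule automorphism_upper[OF aut' munit_sl_on]) (auto simp: upper_def)

lemma extend_lower: "(i, j) \<notin> upper 0 \<Longrightarrow> x \<in> sl \<Longrightarrow> \<Theta> x $ i $ j = trace (x ** \<theta>' (munit j i))"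
proof -
  assume ij: "(i, j) \<notin> upper 0" and "x \<in> sl"
  then have "\<theta> (upper_part x) \<in> \<U> 0"
    using aut upper_part_in by (auto simp: lie_automorphism_def bij_betw_def)
  then show ?thesis using ij sl_onD by (simp add: extend_automorphism_def)
qed

lemma upper_part_extend: "x \<in> sl \<Longrightarrow> upper_part (\<Theta> x) = \<theta> (upper_part x)"
proof -
  assume "x \<in> sl"
  then have "\<theta> (upper_part x) \<in> \<U> 0"
    using aut upper_part_in by (auto simp: lie_automorphism_def bij_betw_def)
  then show ?thesis
    by (intro mat_eqI) (auto simp: upper_part_def extend_automorphism_def dest: sl_onD)
qed

lemma extend_upper: "x \<in> \<U> 0 \<Longrightarrow> \<Theta> x = \<theta> x"
  using trace_upper_strict[OF _ \<theta>'_strict]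
  by (auto simp: extend_automorphism_def upper_part_id vec_eq_iff)

lemma extend_in_sl: "x \<in> sl \<Longrightarrow> \<Theta> x \<in> sl"
proof -
  assume x: "x \<in> sl"
  have "\<theta> (upper_part x) \<in> \<U> 0"
    using aut upper_part_in[OF x] by (auto simp: lie_automorphism_def bij_betw_def)
  moreover have "trace (\<Theta> x) = trace (\<theta> (upper_part x))"
    using upper_0_refl unfolding trace_def by (intro sum.cong refl) (auto simp: extend_automorphism_def)
  ultimately show ?thesis by (simp add: sl_def sl_on_def)
qed

lemma extend_add: "x \<in> sl \<Longrightarrow> y \<in> sl \<Longrightarrow> \<Theta> (x + y) = \<Theta> x + \<Theta> y"
proof -
  assume "x \<in> sl" "y \<in> sl"
  then have 1: "\<theta> (upper_part x + upper_part y) = \<theta> (upper_part x) + \<theta> (upper_part y)"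
    using aut upper_part_in unfolding lie_automorphism_def by blast
  have 2: "upper_part (x + y) = upper_part x + upper_part y" by (auto simp: upper_part_def vec_eq_iff)
  show ?thesis unfolding extend_automorphism_def 2 1 by (simp add: vec_eq_iff mult_add_mat trace_add)
qed

lemma extend_smult: "x \<in> sl \<Longrightarrow> \<Theta> (mat_smult c x) = mat_smult c (\<Theta> x)"
proof -
  assume "x \<in> sl"
  then have 1: "\<theta> (mat_smult c (upper_part x)) = mat_smult c (\<theta> (upper_part x))"
    using aut upper_part_in unfolding lie_automorphism_def by blast
  have 2: "upper_part (mat_smult c x) = mat_smult c (upper_part x)" by (auto simp: upper_part_def vec_eq_iff)
  show ?thesis unfolding extend_automorphism_def 2 1 by (simp add: vec_eq_iff mult_smult_mat distrib_left)
qed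

text \<open>
  Against a strictly block-triangular \<open>y\<close> only the entries below the block diagonal contribute.
\<close>

lemma extend_adjoint:
  assumes x: "x \<in> sl" and y: "y \<in> \<U> 1"
  shows "trace (\<Theta> x ** y) = trace (x ** \<theta>' y)"
proof -
  note L = subspace_sl_on[of "upper 0"]
  define l where "l = (\<chi> i j. if (i, j) \<in> upper 0 then 0 else trace (x ** \<theta>' (munit j i)))"
  have "\<theta> (upper_part x) \<in> \<U> 0"
    using aut upper_part_in[OF x] by (auto simp: lie_automorphism_def bij_betw_def)
  then have "trace (\<Theta> x ** y) = trace (l ** y)"
    using trace_upper_strict[OF _ y] by (simp add: extend_automorphism_def l_def mult_add_mat trace_add)
  also have "\<dots> = (\<Sum>i\<in>UNIV. \<Sum>j\<in>UNIV. trace (x ** \<theta>' (mat_smult (y $ j $ i) (munit j i))))"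
    unfolding trace_mult[of l]
  proof (intro sum.cong refl)
    fix i j
    show "l $ i $ j * y $ j $ i = trace (x ** \<theta>' (mat_smult (y $ j $ i) (munit j i)))"
    proof (cases "(i, j) \<in> upper 0")
      case True
      then have "y $ j $ i = 0" by (intro sl_onD[OF y]) (auto simp: upper_def)
      then show ?thesis by (simp add: lie_automorphism_zero[OF aut' L])
    next
      case False
      then have "\<theta>' (mat_smult (y $ j $ i) (munit j i)) = mat_smult (y $ j $ i) (\<theta>' (munit j i))"
        using aut' lower_munit_upper unfolding lie_automorphism_def by blast
      then show ?thesis using False by (simp add: l_def mult_smult_mat)
    qed
  qed
  also have "\<dots> = trace (x ** (\<Sum>i\<in>UNIV. \<Sum>j\<in>UNIV. \<theta>' (mat_smult (y $ j $ i) (munit j i))))"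
    by (simp add: mult_sum_mat trace_sum)
  also have "(\<Sum>i\<in>UNIV. \<Sum>j\<in>UNIV. \<theta>' (mat_smult (y $ j $ i) (munit j i))) = \<theta>' y"
  proof -
    have e: "mat_smult (y $ j $ i) (munit j i) \<in> \<U> 0" for i j
    proof (cases "(i, j) \<in> upper 0")
      case True
      then have "y $ j $ i = 0" by (intro sl_onD[OF y]) (auto simp: upper_def)
      then show ?thesis by (simp add: mats.subspace_0[OF L])
    qed (intro mats.subspace_scale[OF L] lower_munit_upper)
    have "y = (\<Sum>i\<in>UNIV. \<Sum>j\<in>UNIV. mat_smult (y $ j $ i) (munit j i))"
      using sum_munit[of y] by (subst sum.swap)
    then have "\<theta>' y = \<theta>' (\<Sum>i\<in>UNIV. \<Sum>j\<in>UNIV. mat_smult (y $ j $ i) (munit j i))" by (rule arg_cong)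
    then show ?thesis
      by (simp add: lie_automorphism_sum[OF aut' L] e mats.subspace_sum[OF L])
  qed
  finally show ?thesis .
qed

lemma extend_diagonal:
  assumes x: "x \<in> \<D> m"
  shows "\<Theta> x \<in> \<D> m"
proof (cases "0 \<le> m")
  case True
  then have "x \<in> \<U> 0" using x diagonal_subset_upper by blast
  then show ?thesis using diag[OF True x] extend_upper by simp
next
  case False
  have xs: "x \<in> sl" using x by (simp add: sl_on_def)
  have "upper_part x $ i $ j = 0" for i j
    using False sl_onD[OF x, of i j] by (auto simp: upper_part_def diagonal_def upper_def)
  then have up: "upper_part x = 0" by (simp add: vec_eq_iff)
  have "\<Theta> x $ i $ j = 0" if ij: "(i, j) \<notin> diagonal m" for i j
  proof (cases "(i, j) \<in> upper 0")
    case True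
    then show ?thesis
      by (simp add: extend_automorphism_def up lie_automorphism_zero[OF aut subspace_sl_on])
  next
    case low: False
    have "\<theta>' (munit j i) \<in> sl_on (diagonal (int (b i) - int (b j)))"
      by (rule diag'[OF _ lower_munit[OF low]]) (use low in \<open>simp add: upper_def\<close>)
    then have "trace (x ** \<theta>' (munit j i)) = 0"
      by (rule trace_diagonal_zero[OF x]) (use ij in \<open>auto simp: diagonal_def\<close>)
    then show ?thesis using extend_lower[OF low xs] by simp
  qed
  then show ?thesis using extend_in_sl[OF xs] by (simp add: sl_on_def supported_def)
qed

lemma extend_inverse: "x \<in> sl \<Longrightarrow> extend_automorphism \<theta>' \<theta> (\<Theta> x) = x"
proof (rule mat_eqI)
  interpret inv: graded_automorphism b s \<theta>' \<theta>
    by (rule swapped)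
  fix i j assume x: "x \<in> sl"
  show "extend_automorphism \<theta>' \<theta> (\<Theta> x) $ i $ j = x $ i $ j"
  proof (cases "(i, j) \<in> upper 0")
    case True
    have "upper_part (extend_automorphism \<theta>' \<theta> (\<Theta> x)) = upper_part x"
      by (simp add: inv.upper_part_extend[OF extend_in_sl[OF x]] upper_part_extend[OF x] left_inv upper_part_in[OF x])
    then have "upper_part (extend_automorphism \<theta>' \<theta> (\<Theta> x)) $ i $ j = upper_part x $ i $ j" by simp
    then show ?thesis using True by (simp add: upper_part_def)
  next
    case False
    have "extend_automorphism \<theta>' \<theta> (\<Theta> x) $ i $ j = trace (\<Theta> x ** \<theta> (munit j i))"
      by (rule inv.extend_lower[OF False extend_in_sl[OF x]])
    also have "\<dots> = trace (x ** \<theta>' (\<theta> (munit j i)))"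
      by (rule extend_adjoint[OF x inv.\<theta>'_strict[OF False]])
    also have "\<dots> = x $ i $ j" by (simp add: left_inv[OF lower_munit_upper[OF False]])
    finally show ?thesis .
  qed
qed

text \<open>
  The graph of the extension is a subspace of \<open>sl \<times> sl\<close>, graded by the block-diagonals. In
  nonnegative degrees it is the graph of the automorphism \<open>\<theta>\<close>, and in nonpositive degrees it is the
  annihilator of the opposite degree for the difference of the two trace forms.
\<close>

lemma extend_bracket_homogeneous:
  assumes x: "x \<in> \<D> m" and y: "y \<in> \<D> k"
  shows "\<Theta> (bracket x y) = bracket (\<Theta> x) (\<Theta> y)"
proof -
  let ?P = "\<U> 0 :: ('f, 'n) sqmat set"
  define br :: "('f, 'n) sqmat \<times> ('f, 'n) sqmat \<Rightarrow> ('f, 'n) sqmat \<times> ('f, 'n) sqmat \<Rightarrow> ('f, 'n) sqmat \<times> ('f, 'n) sqmat"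
    where "br p q = (bracket (fst p) (fst q), bracket (snd p) (snd q))" for p q
  define form :: "('f, 'n) sqmat \<times> ('f, 'n) sqmat \<Rightarrow> ('f, 'n) sqmat \<times> ('f, 'n) sqmat \<Rightarrow> 'f"
    where "form p q = trace (fst p ** fst q) - trace (snd p ** snd q)" for p q
  define V :: "int \<Rightarrow> (('f, 'n) sqmat \<times> ('f, 'n) sqmat) set"
    where "V m = \<D> m \<times> \<D> m" for m
  \<comment> \<open>The graph is graded by \<open>m\<close> alone, so \<open>C\<close> is constant in its second argument.\<close>
  define C where "C m (g :: int) = {(u, \<Theta> u) | u. u \<in> \<D> m}" for m g
  have CI: "u \<in> \<D> m \<Longrightarrow> (u, \<Theta> u) \<in> C m g" for u m g by (auto simp: C_def)
  have Esl: "u \<in> \<D> m \<Longrightarrow> u \<in> sl" for u :: "('f, 'n) sqmat" and m by (simp add: sl_on_def)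
  have EP: "u \<in> \<D> m \<Longrightarrow> 0 \<le> m \<Longrightarrow> u \<in> ?P" for u m using diagonal_subset_upper by blast
  have \<Theta>E: "\<Theta> u = \<theta> u" if "u \<in> \<D> m" "0 \<le> m" for u m by (rule extend_upper[OF EP[OF that]])
  have \<theta>br: "\<theta> (bracket u v) = bracket (\<theta> u) (\<theta> v)" if "u \<in> ?P" "v \<in> ?P" for u v
    using aut that by (simp add: lie_automorphism_def)
  have adj: "trace (\<Theta> u ** \<theta> v) = trace (u ** v)"
    if u: "u \<in> \<D> m" and v: "v \<in> \<D> (- m)" and m: "m \<le> 0" for u v m
  proof (cases "m = 0")
    case True
    then show ?thesis
      using graded_automorphism_isometry[OF aut diag[of 0] diag'[of 0] left_inv right_inv, of u v] u v \<Theta>E[of u 0] by simp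
  next
    case False
    have "\<theta> v \<in> \<D> (- m)" by (rule diag[OF _ v]) (use m in simp)
    then have "\<theta> v \<in> \<U> 1"
      using sl_on_mono[OF diagonal_upper[of 1 "- m"]] m False by auto
    then have "trace (\<Theta> u ** \<theta> v) = trace (u ** \<theta>' (\<theta> v))" by (rule extend_adjoint[OF Esl[OF u]])
    then show ?thesis using left_inv[OF EP[OF v]] m by simp
  qed
  have "br (x, \<Theta> x) (y, \<Theta> y) \<in> C (m + k) (0 + 0)"
  proof (rule bracket_closed_extension[where V = V and C = C and br = br and form = form and Z = UNIV])
    show "br p (q + r) = br p q + br p r" for p q r by (simp add: br_def bracket_linear)
    show "br p q = - br q p" for p q
      using bracket_antisym[of "fst p" "fst q"] bracket_antisym[of "snd p" "snd q"] by (simp add: br_def prod_eq_iff)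
    show "br p (br q r) = br (br p q) r + br q (br p r)" for p q r
      using bracket_jacobi[of "fst p" "fst q" "fst r"] bracket_jacobi[of "snd p" "snd q" "snd r"] by (simp add: br_def)
    show "form (br p q) r = form p (br q r)" for p q r
      by (simp add: br_def form_def trace_bracket_invariant)
    show "p \<in> V m \<Longrightarrow> q \<in> V m' \<Longrightarrow> br p q \<in> V (m + m')" for p q m m'
      by (auto simp: V_def br_def intro: bracket_diagonal)
    show "p \<in> C m g \<Longrightarrow> p \<in> V m" for p m g by (auto simp: C_def V_def intro: extend_diagonal)
    have "\<Theta> 0 = 0" using extend_upper[OF sl_on_zero] lie_automorphism_zero[OF aut subspace_sl_on] by simp
    then show "0 \<in> C m g" for m g
      using CI[OF sl_on_zero, of m g] by (simp add: zero_prod_def)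
    show "p + q \<in> C m g" if pq: "p \<in> C m g" "q \<in> C m g" for p q m g
    proof -
      obtain u v where "p = (u, \<Theta> u)" "q = (v, \<Theta> v)" "u \<in> \<D> m" "v \<in> \<D> m"
        using pq by (auto simp: C_def)
      then show ?thesis using CI[OF sl_on_add, of u m v g] by (simp add: extend_add[OF Esl Esl])
    qed
    show "- p \<in> C m g" if p: "p \<in> C m g" for p m g
    proof -
      obtain u where u: "p = (u, \<Theta> u)" "u \<in> \<D> m" using p by (auto simp: C_def)
      have "\<Theta> (- u) = - \<Theta> u" using extend_smult[OF Esl[OF u(2)], of "- 1"] by simp
      then show ?thesis using CI[OF sl_on_neg[OF u(2)], of g] u(1) by simp
    qed
    show "br p q \<in> C (m + m') (g + g')" if m: "0 \<le> m" "0 \<le> m'" and pq: "p \<in> C m g" "q \<in> C m' g'" for p q m m' g g'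
    proof -
      obtain u v where uv: "p = (u, \<Theta> u)" "q = (v, \<Theta> v)" "u \<in> \<D> m" "v \<in> sl_on (diagonal m')"
        using pq by (auto simp: C_def)
      have uvE: "bracket u v \<in> \<D> (m + m')" by (rule bracket_diagonal[OF uv(3,4)])
      have "\<Theta> (bracket u v) = bracket (\<Theta> u) (\<Theta> v)"
        using m \<theta>br[OF EP EP, OF uv(3) m(1) uv(4) m(2)] by (simp add: \<Theta>E[OF uv(3)] \<Theta>E[OF uv(4)] \<Theta>E[OF uvE])
      then show ?thesis using CI[OF uvE, of "g + g'"] uv(1,2) by (simp add: br_def)
    qed
    show "p \<in> C m g \<longleftrightarrow> p \<in> V m \<and> (\<forall>h r. g + h \<in> UNIV \<longrightarrow> r \<in> C (- m) h \<longrightarrow> form p r = 0)"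
      if m: "m \<le> 0" for p m g
    proof (intro iffI conjI allI impI)
      fix h r assume "p \<in> C m g" "r \<in> C (- m) h"
      then obtain u v where uv: "p = (u, \<Theta> u)" "r = (v, \<Theta> v)" "u \<in> \<D> m" "v \<in> \<D> (- m)"
        by (auto simp: C_def)
      then show "form p r = 0" using adj[OF uv(3,4) m] \<Theta>E[OF uv(4)] m by (simp add: form_def)
    next
      assume p: "p \<in> V m \<and> (\<forall>h r. g + h \<in> UNIV \<longrightarrow> r \<in> C (- m) h \<longrightarrow> form p r = 0)"
      then obtain u u' where u: "p = (u, u')" "u \<in> \<D> m" "u' \<in> \<D> m" by (auto simp: V_def)
      have "u' - \<Theta> u = 0"
      proof (rule diagonal_nondegenerate)
        show "u' - \<Theta> u \<in> \<D> m" by (intro sl_on_diff extend_diagonal u)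
        fix v :: "('f, 'n) sqmat" assume v: "v \<in> \<D> (- m)"
        then have v': "\<theta>' v \<in> \<D> (- m)" using m by (intro diag') auto
        have "form p (\<theta>' v, \<Theta> (\<theta>' v)) = 0" using p CI[OF v'] by blast
        moreover have "\<Theta> (\<theta>' v) = v" using \<Theta>E[OF v'] right_inv[OF EP[OF v]] m by simp
        ultimately have "trace (u' ** v) = trace (u ** \<theta>' v)" by (simp add: form_def u(1))
        moreover have "trace (\<Theta> u ** v) = trace (u ** \<theta>' v)"
          using adj[OF u(2) v' m] right_inv[OF EP[OF v]] m by simp
        ultimately show "trace ((u' - \<Theta> u) ** v) = 0" by (simp add: mult_diff_mat trace_sub)
      qed
      then show "p \<in> C m g" using CI[OF u(2)] u(1) by simp
    qed (auto simp: C_def V_def intro: extend_diagonal)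
    show "Q w" if m: "0 < m" and w: "w \<in> C (m + 1) g" and Q: "Q 0" "\<And>u v. Q u \<Longrightarrow> Q v \<Longrightarrow> Q (u + v)"
      and Qbr: "\<And>a c y z. a + c = g \<Longrightarrow> y \<in> C 1 a \<Longrightarrow> z \<in> C m c \<Longrightarrow> Q (br y z)" for m g w Q
    proof -
      obtain u where u: "w = (u, \<Theta> u)" "u \<in> \<D> (m + 1)" using w by (auto simp: C_def)
      have "u \<in> ?P \<and> Q (u, \<theta> u)"
        using u(2) m
      proof (rule diagonal_bracket_induct)
        show "0 \<in> ?P \<and> Q (0, \<theta> 0)"
          using Q(1) by (simp add: lie_automorphism_zero[OF aut subspace_sl_on] sl_on_zero zero_prod_def)
        show "u + v \<in> ?P \<and> Q (u + v, \<theta> (u + v))" if "u \<in> ?P \<and> Q (u, \<theta> u)" "v \<in> ?P \<and> Q (v, \<theta> v)" for u v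
          using that Q(2)[of "(u, \<theta> u)" "(v, \<theta> v)"] aut
          by (simp add: lie_automorphism_def sl_on_add)
        fix y z :: "('f, 'n) sqmat" assume y: "y \<in> \<D> 1" and z: "z \<in> \<D> m"
        have "Q (br (y, \<Theta> y) (z, \<Theta> z))" by (rule Qbr[of 0 g, OF _ CI[OF y] CI[OF z]]) simp
        moreover have "y \<in> ?P" "z \<in> ?P" using EP[OF y] EP[OF z] m by auto
        ultimately show "bracket y z \<in> ?P \<and> Q (bracket y z, \<theta> (bracket y z))"
          by (simp add: br_def \<theta>br bracket_P extend_upper)
      qed
      then show "Q w" using u(1) extend_upper by simp
    qed
  qed (use CI[OF x] CI[OF y] in auto)
  then show ?thesis by (auto simp: C_def br_def)
qed

lemma extend_automorphism: "lie_automorphism sl \<Theta>"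
  unfolding lie_automorphism_def
proof (intro conjI ballI allI)
  interpret inv: graded_automorphism b s \<theta>' \<theta>
    by (rule swapped)
  show "bij_betw \<Theta> sl sl"
    by (rule bij_betw_byWitness[where f' = "extend_automorphism \<theta>' \<theta>"])
      (use extend_inverse inv.extend_inverse extend_in_sl inv.extend_in_sl in auto)
  have \<Theta>0: "\<Theta> 0 = 0"
    using extend_upper[OF sl_on_zero] lie_automorphism_zero[OF aut subspace_sl_on] by simp
  have brsl: "bracket x y \<in> sl" for x y :: "('f, 'n) sqmat" by (simp add: sl_def)
  fix x y :: "('f, 'n) sqmat" assume x: "x \<in> sl" and y: "y \<in> sl"
  have "x \<in> sl \<and> \<Theta> (bracket x y) = bracket (\<Theta> x) (\<Theta> y)"
    using x
  proof (rule sl_induct)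
    fix m and u :: "('f, 'n) sqmat" assume u: "u \<in> \<D> m"
    have "y \<in> sl \<and> \<Theta> (bracket u y) = bracket (\<Theta> u) (\<Theta> y)"
      using y
      by (rule sl_induct)
        (use extend_bracket_homogeneous[OF u] in \<open>auto simp: bracket_linear \<Theta>0 extend_add brsl
          mats.subspace_0[OF subspace_sl] mats.subspace_add[OF subspace_sl] sl_on_def\<close>)
    then show "u \<in> sl \<and> \<Theta> (bracket u y) = bracket (\<Theta> u) (\<Theta> y)" using u by (simp add: sl_on_def)
  qed (auto simp: bracket_linear \<Theta>0 extend_add brsl mats.subspace_0[OF subspace_sl] mats.subspace_add[OF subspace_sl])
  then show "\<Theta> (bracket x y) = bracket (\<Theta> x) (\<Theta> y)" ..
qed (simp_all add: extend_add extend_smult)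

end

context blocks
begin

text \<open>
  The leading terms of an isomorphism of the nonnegative parts still map components to components,
  and they form a graded automorphism, which extends to \<open>sl\<close>. In negative degrees a component is the
  annihilator of the components of positive degree other than the opposite one, so the extension,
  being an isometry, respects it as well.
\<close>

lemma iso_of_nonneg_part_iso:
  fixes A A' :: "int \<times> 'g::ab_group_add \<Rightarrow> ('f::field_char_0, 'n) sqmat set"
  assumes A: "refines_diagonals A" and A': "refines_diagonals A'"
    and iso: "(nonneg_part A, nonneg_part A') \<in> grading_iso (\<U> 0)"
  shows "(A, A') \<in> grading_iso sl"
proof -
  let ?P = "\<U> 0 :: ('f, 'n) sqmat set"
  note grA = refines_diagonalsD(1)[OF A] and grA' = refines_diagonalsD(1)[OF A']
  note L = subspace_sl_on[of "upper 0"]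
  obtain \<psi> where \<psi>: "lie_automorphism ?P \<psi>" and \<psi>A: "\<And>g. \<psi> ` nonneg_part A g = nonneg_part A' g"
    using iso by (auto simp: grading_iso_def)
  define \<psi>' where "\<psi>' = inv_into ?P \<psi>"
  have \<psi>': "lie_automorphism ?P \<psi>'" unfolding \<psi>'_def by (rule lie_automorphism_inv[OF \<psi> L bracket_P])
  have bij: "bij_betw \<psi> ?P ?P" using \<psi> by (simp add: lie_automorphism_def)
  have \<psi>'A: "\<psi>' ` nonneg_part A' g = nonneg_part A g" for g
    using bij_betw_inv_into_left[OF bij] grading_subset[OF nonneg_part_grading[OF A], of g]
    unfolding \<psi>A[symmetric] \<psi>'_def by (force simp: image_image)
  have inv\<psi>': "inv_into ?P \<psi>' x = \<psi> x" if "x \<in> ?P" for x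
    using bij that unfolding \<psi>'_def by (metis bij_betw_def bij_betw_inv_into inv_into_inv_into_eq)
  define \<theta> \<theta>' where "\<theta> = graded_map \<psi>" and "\<theta>' = graded_map \<psi>'"
  interpret gr: graded_automorphism b s \<theta> \<theta>'
    unfolding \<theta>_def \<theta>'_def \<psi>'_def
    by (intro graded_automorphism.intro graded_automorphism_axioms.intro blocks_axioms
      graded_map_automorphism[OF \<psi>] graded_map_automorphism(1)[OF \<psi>'[unfolded \<psi>'_def]]
      graded_map_diagonal[OF \<psi>] graded_map_diagonal[OF \<psi>'[unfolded \<psi>'_def]])
  let ?\<Theta> = "extend_automorphism \<theta> \<theta>'"
  have graded: "graded_map \<eta> x \<in> D (m, g)"
    if \<eta>: "lie_automorphism ?P \<eta>" and C: "refines_diagonals C" and D: "refines_diagonals D"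
      and \<eta>C: "\<And>g. \<eta> ` nonneg_part C g = nonneg_part D g" and m: "0 \<le> m" and x: "x \<in> C (m, g)"
    for \<eta> m g x and C D :: "int \<times> 'g \<Rightarrow> ('f, 'n) sqmat set"
  proof -
    have "\<eta> x \<in> nonneg_part D g" using \<eta>C nonneg_part_base[of m x C g, OF m x] by blast
    then have "diag_part m (\<eta> x) \<in> D (m, g)" by (rule diag_part_nonneg_part[OF D])
    then show ?thesis
      using graded_map_homogeneous[of \<eta>, OF lie_automorphism_zero[OF \<eta> L] refines_diagonalsD(2)[OF C x] m] by simp
  qed
  have "?\<Theta> x \<in> A' (m, g)" if x: "x \<in> A (m, g)" for m g x
  proof (cases "0 \<le> m")
    case True
    have "x \<in> ?P" using refines_diagonalsD(2)[OF A x] diagonal_subset_upper[OF True] by blast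
    then have "?\<Theta> x = graded_map \<psi> x" using gr.extend_upper by (simp only: \<theta>_def)
    then show ?thesis using graded[OF \<psi> A A' \<psi>A True x] by (simp only:)
  next
    case False
    have xE: "x \<in> \<D> m" by (rule refines_diagonalsD(2)[OF A x])
    have \<Theta>E: "?\<Theta> x \<in> \<D> m" by (rule gr.extend_diagonal[OF xE])
    then have \<Theta>s: "?\<Theta> x \<in> sl" by (simp add: sl_on_def)
    show ?thesis
    proof (rule homogeneousI[OF grA' \<Theta>s])
      fix p assume p: "p \<noteq> (m, g)"
      show "component A' (?\<Theta> x) p = 0"
      proof (cases "fst p = m")
        case neq: False
        then show ?thesis
          using refines_diagonals_component[OF A' \<Theta>s, of "fst p" "snd p"] diag_part_homogeneous[OF \<Theta>E, of "fst p"] by simp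
      next
        case True
        then have h: "snd p \<noteq> g" using p by (metis prod.collapse)
        let ?z = "component A' (?\<Theta> x) p"
        have zA: "?z \<in> A' p" by (rule component_spec(1)[OF grA' \<Theta>s])
        then have "?z \<in> A' (m, snd p)" using True by (metis prod.collapse)
        then have zE: "?z \<in> \<D> m" by (rule refines_diagonalsD(2)[OF A'])
        show ?thesis
        proof (rule diagonal_nondegenerate[OF zE])
          fix y :: "('f, 'n) sqmat" assume "y \<in> \<D> (- m)"
          then have ys: "y \<in> sl" by (simp add: sl_on_def)
          let ?y = "component A' y (- p)"
          have yA: "?y \<in> A' (- m, - snd p)"
            using component_spec(1)[OF grA' ys, of "- p"] True by (metis uminus_prod_def)
          have "trace (?z ** y) = trace (?z ** ?y)"
          proof (rule functional_component[OF grA' subspace_sl ys])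
            show "trace (?z ** u) = 0" if "k \<noteq> - p" "u \<in> A' k" for k u
              using that by (intro trace_form_graded_sl[OF grA' zA]) (auto simp: add_eq_0_iff)
          qed (simp add: mult_add_mat trace_add)
          also have "\<dots> = trace (?\<Theta> x ** ?y)"
          proof (rule functional_component[OF grA' subspace_sl \<Theta>s, symmetric])
            show "trace (u ** ?y) = 0" if "k \<noteq> p" "u \<in> A' k" for k u
              using that by (intro trace_form_graded_sl[OF grA' _ component_spec(1)[OF grA' ys]]) (auto simp: add_eq_0_iff2)
          qed (simp add: mult_add_mat trace_add)
          also have "\<dots> = trace (x ** \<theta>' ?y)"
          proof (rule gr.extend_adjoint)
            show "x \<in> sl" using xE by (simp add: sl_on_def)
            show "?y \<in> \<U> 1"
              using refines_diagonalsD(2)[OF A' yA] sl_on_mono[OF diagonal_upper[of 1 "- m"]] False by auto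
          qed
          also have "\<dots> = 0"
          proof -
            have "\<theta>' ?y \<in> A (- m, - snd p)"
              unfolding \<theta>'_def by (rule graded[OF \<psi>' A' A \<psi>'A _ yA]) (use False in simp)
            then show ?thesis
              by (rule trace_form_graded_sl[OF grA x]) (use h in \<open>auto simp: zero_prod_def\<close>)
          qed
          finally show "trace (?z ** y) = 0" .
        qed
      qed
    qed
  qed
  then show ?thesis
    by (intro grading_isoI[OF grA grA' gr.extend_automorphism subspace_sl]) auto
qed

end

section \<open>Isomorphism classes\<close>

lemma equiv_grading_iso:
  assumes L: "mats.subspace L" and br: "\<And>x y. x \<in> L \<Longrightarrow> y \<in> L \<Longrightarrow> bracket x y \<in> L"
  shows "equiv {A :: 'g::ab_group_add \<Rightarrow> ('f::field, 'n::finite) sqmat set. is_grading L A} (grading_iso L)"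
proof (rule equivI)
  let ?G = "{A :: 'g \<Rightarrow> ('f, 'n) sqmat set. is_grading L A}"
  let ?R = "grading_iso L :: (('g \<Rightarrow> ('f, 'n) sqmat set) \<times> ('g \<Rightarrow> ('f, 'n) sqmat set)) set"
  show "grading_iso L \<subseteq> ?G \<times> ?G" by (auto simp: grading_iso_def)
  have "(A, A) \<in> grading_iso L" if "A \<in> ?G" for A
    using that by (intro grading_isoI[OF _ _ lie_automorphism_id L]) auto
  then show "refl_on ?G (grading_iso L)" by (auto simp: refl_on_def grading_iso_def)
  show "sym ?R"
  proof (rule symI)
    fix A B :: "'g \<Rightarrow> ('f, 'n) sqmat set" assume "(A, B) \<in> grading_iso L"
    then obtain \<phi> where \<phi>: "lie_automorphism L \<phi>" and A: "is_grading L A" and B: "is_grading L B"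
      and AB: "\<And>g. \<phi> ` A g = B g" by (auto simp: grading_iso_def)
    have bij: "bij_betw \<phi> L L" using \<phi> by (simp add: lie_automorphism_def)
    have "inv_into L \<phi> ` B g \<subseteq> A g" for g
      using bij_betw_inv_into_left[OF bij] grading_subset[OF A, of g] unfolding AB[symmetric] by force
    then show "(B, A) \<in> grading_iso L"
      by (intro grading_isoI[OF B A lie_automorphism_inv[OF \<phi> L br] L])
  qed
  show "trans ?R"
  proof (rule transI)
    fix A B C :: "'g \<Rightarrow> ('f, 'n) sqmat set"
    assume AB: "(A, B) \<in> grading_iso L" and BC: "(B, C) \<in> grading_iso L"
    obtain \<phi> where \<phi>: "lie_automorphism L \<phi>" "\<And>g. \<phi> ` A g = B g" using AB by (auto simp: grading_iso_def)
    obtain \<psi> where \<psi>: "lie_automorphism L \<psi>" "\<And>g. \<psi> ` B g = C g" using BC by (auto simp: grading_iso_def)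
    have "is_grading L A" "is_grading L C" using AB BC by (auto simp: grading_iso_def)
    then show "(A, C) \<in> grading_iso L"
      by (rule grading_isoI[OF _ _ lie_automorphism_comp[OF \<phi>(1) \<psi>(1)] L])
        (auto simp flip: \<phi>(2) \<psi>(2))
  qed
qed

text \<open>
  The map \<open>f\<close> is defined on the representatives singled out by \<open>ad\<close>. On classes it is well defined
  and injective by \<open>iff\<close>, and onto by \<open>surj\<close>.
\<close>

lemma bij_betw_quotient:
  assumes R: "equiv X R" and S: "equiv Y S"
    and ad: "\<And>a. ad a \<Longrightarrow> a \<in> X" and f: "\<And>a. ad a \<Longrightarrow> f a \<in> Y"
    and iff: "\<And>a a'. ad a \<Longrightarrow> ad a' \<Longrightarrow> (a, a') \<in> R \<longleftrightarrow> (f a, f a') \<in> S"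
    and surj: "\<And>y. y \<in> Y \<Longrightarrow> \<exists>a. ad a \<and> (y, f a) \<in> S"
  shows "\<exists>\<Phi>. (\<forall>a. ad a \<longrightarrow> \<Phi> (R `` {a}) = S `` {f a}) \<and>
    bij_betw \<Phi> {C \<in> X // R. \<exists>a\<in>C. ad a} (Y // S)"
proof -
  define \<Phi> where "\<Phi> C = S `` {f (SOME a. a \<in> C \<and> ad a)}" for C
  have val: "\<Phi> (R `` {a}) = S `` {f a}" if a: "ad a" for a
  proof -
    define c where "c = (SOME a'. a' \<in> R `` {a} \<and> ad a')"
    have "a \<in> R `` {a} \<and> ad a" using equiv_class_self[OF R ad[OF a]] a by simp
    then have "c \<in> R `` {a} \<and> ad c" unfolding c_def by (rule someI)
    then have "(f a, f c) \<in> S" using iff[OF a, of c] by blast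
    then show ?thesis unfolding \<Phi>_def c_def by (rule equiv_class_eq[OF S, symmetric])
  qed
  have rep: "\<exists>a. ad a \<and> C = R `` {a}" if "C \<in> {C \<in> X // R. \<exists>a\<in>C. ad a}" for C
  proof -
    obtain a where a: "a \<in> C" "ad a" "C \<in> X // R" using \<open>C \<in> {C \<in> X // R. \<exists>a\<in>C. ad a}\<close> by blast
    then obtain x where "C = R `` {x}" by (auto elim: quotientE)
    then have "C = R `` {a}" using equiv_class_eq[OF R, of x a] a(1) by simp
    then show ?thesis using a(2) by blast
  qed
  have "bij_betw \<Phi> {C \<in> X // R. \<exists>a\<in>C. ad a} (Y // S)"
  proof (rule bij_betw_imageI)
    show "inj_on \<Phi> {C \<in> X // R. \<exists>a\<in>C. ad a}"
    proof (rule inj_onI)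
      fix C D assume CD: "C \<in> {C \<in> X // R. \<exists>a\<in>C. ad a}" "D \<in> {C \<in> X // R. \<exists>a\<in>C. ad a}" "\<Phi> C = \<Phi> D"
      obtain a c where a: "ad a" "C = R `` {a}" and c: "ad c" "D = R `` {c}" using rep[OF CD(1)] rep[OF CD(2)] by blast
      have "(f a, f c) \<in> S" using CD(3) val a c by (intro eq_equiv_class[OF _ S f]) auto
      then have "(a, c) \<in> R" using iff a c by simp
      then show "C = D" unfolding a(2) c(2) by (rule equiv_class_eq[OF R])
    qed
    show "\<Phi> ` {C \<in> X // R. \<exists>a\<in>C. ad a} = Y // S"
    proof (intro subset_antisym subsetI)
      fix D assume "D \<in> \<Phi> ` {C \<in> X // R. \<exists>a\<in>C. ad a}"
      then obtain a where "ad a" "D = \<Phi> (R `` {a})" using rep by blast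
      then show "D \<in> Y // S" using val quotientI[OF f] by simp
    next
      fix D assume "D \<in> Y // S"
      then obtain y where y: "y \<in> Y" "D = S `` {y}" by (rule quotientE)
      obtain a where a: "ad a" "(y, f a) \<in> S" using surj[OF y(1)] by blast
      have "D = \<Phi> (R `` {a})" using equiv_class_eq[OF S a(2)] y(2) val[OF a(1)] by simp
      moreover have "R `` {a} \<in> {C \<in> X // R. \<exists>a\<in>C. ad a}"
        using quotientI[OF ad[OF a(1)]] equiv_class_self[OF R ad[OF a(1)]] a(1) by blast
      ultimately show "D \<in> \<Phi> ` {C \<in> X // R. \<exists>a\<in>C. ad a}" by blast
    qed
  qed
  then show ?thesis using val by blast
qed

section \<open>Block sizes\<close>

lemma range_pos: "range (pos :: 'n::{finite,linorder} \<Rightarrow> nat) = {..<CARD('n)}"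
proof (rule card_subset_eq)
  have less: "pos i < pos j" if "i < j" for i j :: 'n
    unfolding pos_def by (rule psubset_card_mono) (use that in auto)
  then have "inj (pos :: 'n \<Rightarrow> nat)" by (metis injI less_irrefl neqE)
  then show "card (range (pos :: 'n \<Rightarrow> nat)) = card {..<CARD('n)}" by (simp add: card_image)
  have "pos i < CARD('n)" for i :: 'n
    unfolding pos_def by (rule psubset_card_mono) auto
  then show "range (pos :: 'n \<Rightarrow> nat) \<subseteq> {..<CARD('n)}" by auto
qed simp

lemma sum_list_take_mono: "a \<le> c \<Longrightarrow> sum_list (take a ns) \<le> sum_list (take c (ns :: nat list))"
  by (metis le_add1 le_add_diff_inverse sum_list_append take_add)

lemma range_block:
  assumes "\<forall>k\<in>set ns. 1 \<le> k" "sum_list ns = CARD('n)"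
  shows "range (block ns :: 'n::{finite,linorder} \<Rightarrow> nat) = {..<length ns}"
proof (intro subset_antisym subsetI)
  fix q assume "q \<in> range (block ns :: 'n \<Rightarrow> nat)"
  then obtain i :: 'n where q: "q = block ns i" by blast
  have "pos i < sum_list ns" using range_pos[where 'n = 'n] assms(2) by auto
  moreover from this have "ns \<noteq> []" by auto
  ultimately have "pos i < sum_list (take (Suc (length ns - 1)) ns)" by simp
  then have "block ns i \<le> length ns - 1" unfolding block_def by (rule Least_le)
  then show "q \<in> {..<length ns}" using q \<open>ns \<noteq> []\<close> by (cases ns) auto
next
  fix q assume "q \<in> {..<length ns}"
  then have q: "q < length ns" by simp
  let ?p = "sum_list (take q ns)"
  have "1 \<le> ns ! q" using assms(1) nth_mem[OF q] by blast
  then have less: "?p < sum_list (take (Suc q) ns)" using q by (simp add: take_Suc_conv_app_nth)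
  also have "\<dots> \<le> CARD('n)" using sum_list_take_mono[of "Suc q" "length ns" ns] q assms(2) by simp
  finally have "?p \<in> range (pos :: 'n \<Rightarrow> nat)" unfolding range_pos by simp
  then obtain i :: 'n where i: "pos i = ?p" by (metis imageE)
  have "block ns i = q"
    unfolding block_def i
  proof (rule Least_equality)
    show "?p < sum_list (take (Suc q) ns)" by (rule less)
    fix r assume r: "?p < sum_list (take (Suc r) ns)"
    show "q \<le> r"
    proof (rule ccontr)
      assume "\<not> q \<le> r"
      then show False using sum_list_take_mono[of "Suc r" q ns] r by simp
    qed
  qed
  then show "q \<in> range (block ns :: 'n \<Rightarrow> nat)" by blast
qed

lemma block_diagonal_eq:
  "block_diagonal ns m = supported {(i, j). int (block ns j) = int (block ns i) + m}"
    (is "_ = supported ?K")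
proof
  show "block_diagonal ns m \<subseteq> supported ?K"
    unfolding block_diagonal_def munit_def[symmetric]
    by (rule mats.span_minimal[OF _ subspace_supported]) (auto intro: munit_supported)
  show "supported ?K \<subseteq> block_diagonal ns m"
  proof
    fix x assume x: "x \<in> supported ?K"
    have "mat_smult (x $ i $ j) (munit i j) \<in> block_diagonal ns m" for i j
    proof (cases "(i, j) \<in> ?K")
      case True
      then have "munit i j \<in> block_diagonal ns m"
        unfolding block_diagonal_def munit_def[symmetric] by (intro mats.span_base) auto
      then show ?thesis unfolding block_diagonal_def by (rule mats.span_scale)
    next
      case False
      then have "x $ i $ j = 0" by (rule supportedD[OF x])
      then show ?thesis by (simp add: block_diagonal_def mats.span_zero)
    qed
    then have "(\<Sum>i\<in>UNIV. \<Sum>j\<in>UNIV. mat_smult (x $ i $ j) (munit i j)) \<in> block_diagonal ns m"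
      unfolding block_diagonal_def by (intro mats.span_sum)
    then show "x \<in> block_diagonal ns m" using sum_munit[of x] by simp
  qed
qed

theorem theorem15:
  fixes ns :: "nat list"
  assumes block_sizes: "\<forall>k\<in>set ns. 1 \<le> k" "sum_list ns = CARD('n)"
  shows
    "(\<forall>A :: int \<times> 'g::ab_group_add \<Rightarrow>
          ('f::{alg_closed_field, field_char_0}, 'n::{finite,linorder}) sqmat set.
        admissible ns A \<longrightarrow>
          is_grading (UT0 ns) (nonneg_part A) \<and>
          nonneg_part A = coarsening snd (\<lambda>k. A k \<inter> UT0 ns)) \<and>
     (\<exists>\<Phi> :: (int \<times> 'g \<Rightarrow> ('f, 'n) sqmat set) set \<Rightarrow> ('g \<Rightarrow> ('f, 'n) sqmat set) set.
        (\<forall>A. admissible ns A \<longrightarrow>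
           \<Phi> (grading_iso sl `` {A}) = grading_iso (UT0 ns) `` {nonneg_part A}) \<and>
        bij_betw \<Phi> (admissible_classes ns) (iso_classes (UT0 ns)))"
proof -
  interpret blocks "block ns :: 'n \<Rightarrow> nat" "length ns"
    by (rule blocks.intro[OF range_block[OF block_sizes]])
  have UT0: "UT0 ns = (sl_on (upper 0) :: ('f, 'n) sqmat set)"
    unfolding UT0_def UT_def sl_on_def supported_def sl_def upper_def by (auto simp: not_le)
  have natural: "natural_grading ns m = (sl_on (diagonal m) :: ('f, 'n) sqmat set)" if "0 \<le> m" for m
  proof (cases "m < int (length ns)")
    case True
    have "supported (diagonal m) \<inter> sl_on (upper 0) = (sl_on (diagonal m) :: ('f, 'n) sqmat set)"
      using diagonal_subset_upper[OF that] by (auto simp: sl_on_def)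
    then show ?thesis
      using True that by (simp add: natural_grading_def UT0 block_diagonal_eq diagonal_def)
  next
    case False
    then have "x = 0" if "x \<in> sl_on (diagonal m)" for x :: "('f, 'n) sqmat"
      using sl_on_mono[OF diagonal_upper[of "length ns" m]] that
      by (intro supported_upper_trivial) (auto simp: sl_on_def)
    then show ?thesis
      using False sl_on_zero by (auto simp: natural_grading_def)
  qed
  have refines: "refines_diagonals A" if "admissible ns A" for A :: "int \<times> 'g \<Rightarrow> ('f, 'n) sqmat set"
    using that natural unfolding admissible_def by (intro refines_diagonalsI) blast+
  have brsl: "bracket x y \<in> sl" for x y :: "('f, 'n) sqmat" by (simp add: sl_def)
  have "\<exists>\<Phi>. (\<forall>A :: int \<times> 'g \<Rightarrow> ('f, 'n) sqmat set. admissible ns A \<longrightarrow>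
      \<Phi> (grading_iso sl `` {A}) = grading_iso (UT0 ns) `` {nonneg_part A}) \<and>
    bij_betw \<Phi> {C \<in> {A. is_grading sl A} // grading_iso sl. \<exists>A\<in>C. admissible ns A}
      ({B. is_grading (UT0 ns) B} // grading_iso (UT0 ns))"
  proof (rule bij_betw_quotient)
    show "equiv {A. is_grading sl A} (grading_iso (sl :: ('f, 'n) sqmat set))"
      by (rule equiv_grading_iso[OF subspace_sl brsl])
    show "equiv {B. is_grading (UT0 ns) B} (grading_iso (UT0 ns :: ('f, 'n) sqmat set))"
      unfolding UT0 by (rule equiv_grading_iso[OF subspace_sl_on bracket_P])
    fix A :: "int \<times> 'g \<Rightarrow> ('f, 'n) sqmat set" assume A: "admissible ns A"
    then show "A \<in> {A. is_grading sl A}" by (simp add: admissible_def)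
    show "nonneg_part A \<in> {B. is_grading (UT0 ns) B}"
      unfolding UT0 using nonneg_part_grading[OF refines[OF A]] by simp
    fix A' :: "int \<times> 'g \<Rightarrow> ('f, 'n) sqmat set" assume A': "admissible ns A'"
    show "(A, A') \<in> grading_iso sl \<longleftrightarrow> (nonneg_part A, nonneg_part A') \<in> grading_iso (UT0 ns)"
      unfolding UT0 using nonneg_part_iso iso_of_nonneg_part_iso refines[OF A] refines[OF A'] by blast
  next
    fix B :: "'g \<Rightarrow> ('f, 'n) sqmat set" assume "B \<in> {B. is_grading (UT0 ns) B}"
    then obtain A :: "int \<times> 'g \<Rightarrow> ('f, 'n) sqmat set" where A: "is_grading sl A"
      "\<forall>m\<ge>0. sl_on (diagonal m) \<subseteq> coarsening fst A m" "(B, nonneg_part A) \<in> grading_iso (UT0 ns)"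
      using ex_nonneg_part_iso[of B] unfolding UT0 by blast
    have "natural_grading ns m \<subseteq> coarsening fst A m" for m
    proof (cases "0 \<le> m")
      case True
      then show ?thesis using natural A(2) by blast
    next
      case False
      then show ?thesis by (simp add: natural_grading_def coarsening_def mats.span_zero)
    qed
    then show "\<exists>A. admissible ns A \<and> (B, nonneg_part A) \<in> grading_iso (UT0 ns)"
      using A by (auto simp: admissible_def)
  qed
  moreover have "is_grading (UT0 ns) (nonneg_part A) \<and> nonneg_part A = coarsening snd (\<lambda>k. A k \<inter> UT0 ns)"
    if "admissible ns A" for A :: "int \<times> 'g \<Rightarrow> ('f, 'n) sqmat set"
    unfolding UT0 using nonneg_part_grading nonneg_part_eq_coarsening refines[OF that] by blast
  ultimately show ?thesis
    unfolding admissible_classes_def iso_classes_def by blast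
qed

end
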